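(* Let $\beta>0$ and $\tau_1,\tau_2>0$ be fixed. As $n\to\infty$, locally uniformly for $z$ in $S_{\beta/2}=\{z\in\mathbb{C}:\mathrm{Re}(z)>-\beta/2\}$, $$\log\mathbb{E}\left[e^{z\log(\det W_n^{L,\beta})}\right]=z\mu^L_{\beta,n}+\frac{z^2}{\beta}\log n+\Upsilon(z)+o(1),$$ $$\log\mathbb{E}\left[e^{z\log(\det W_n^{G,\beta})}\right]=z\mu^G_{\beta,n}+\frac{z^2}{\beta}\log n-\frac{z^2}{\beta}+\Upsilon(z)+o(1),$$ $$\log\mathbb{E}\left[e^{z\log(\det W_n^{J,\beta})}\right]=z\mu^J_{\beta,n}+\frac{z^2}{\beta}\log n+\frac{z^2}{\beta}\log\left(\frac{\tau_1\tau_2}{\tau_1+\tau_2}\right)+\Upsilon(z)+o(1),$$ where $$\mu^L_{\beta,n}:=\left(\tfrac12-\tfrac1\beta\right)\log n-n+n\log(\beta n),\qquad \mu^G_{\beta,n}:=\left(\tfrac12-\tfrac1\beta\right)\log n-n+\tfrac1\beta,$$ $$\mu^J_{\beta,n}:=\left(\tfrac12-\tfrac1\beta\right)\log n+\left(\tfrac12-\tfrac1\beta\right)\log\left(\tfrac{\tau_1\tau_2}{\tau_1+\tau_2}\right)-\varepsilon(\lfloor n\tau_1\rfloor,\lfloor n\tau_2\rfloor)-\varepsilon(\lfloor n\tau_2\rfloor,\lfloor n\tau_1\rfloor),$$ with $\varepsilon(x,y):=x\log\left(1+\frac yx\right)$.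
   Context: Random determinants. (L) $\det W_n^{L,\beta}=\prod_{k=1}^n\lambda_k$, where $(\lambda_1,\dots,\lambda_n)$ has density on $(0,\infty)^n$ proportional to $\prod_{j<k}|\lambda_k-\lambda_j|^\beta\prod_{k=1}^n\lambda_k^{\beta/2-1}e^{-\lambda_k/2}$ ($\beta$-Laguerre ensemble). (G) $\det W_n^{G,\beta}$ is a random variable distributed as $\prod_{k=2}^n\rho_k$ with $\rho_k$ independent, $\rho_k\sim\mathrm{Beta}\left(\frac\beta2(n-k+1),\frac\beta2(k-1)\right)$ ($\beta$-Uniform Gram ensemble). (J) With $n_1=\lfloor n\tau_1\rfloor$, $n_2=\lfloor n\tau_2\rfloor$, $m=\min(n_1,n_2)$, $M=\max(n_1,n_2)$: $\det W_n^{J,\beta}=\prod_{k=1}^m\lambda_k$, where $(\lambda_1,\dots,\lambda_m)$ has density on $(0,1)^m$ proportional to $\prod_{j<k}|\lambda_k-\lambda_j|^\beta\prod_{k=1}^m\lambda_k^{\beta/2-1}(1-\lambda_k)^{\frac\beta2(M-m+1)-1}$ ($\beta$-Jacobi ensemble). The function $\Upsilon$ is defined for $\mathrm{Re}(z)>-\beta/2$ by $$\Upsilon(z)=\frac\beta2\log G\left(\frac{2z}\beta+1\right)-\left(z-\frac12\right)\log\Gamma\left(\frac{2z}\beta+1\right)+\int_0^\infty\frac{\varphi(s)(e^{-sz}-1)}{e^{s\beta/2}-1}ds+\frac{z^2}\beta+\frac z2,$$ $\varphi(s)=\left(\frac12-\frac1s+\frac1{e^s-1}\right)\frac1s$, where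 $G$ is the Barnes $G$-function (entire, $G(1)=1$, $G(z+1)=G(z)\Gamma(z)$, $G(1+z)=(2\pi)^{z/2}e^{-(z+1)z/2}\prod_{j\ge1}\{(1+\frac zj)^j(1+\frac1j)^{z^2/2}e^{-z}\}$); $\log G,\log\Gamma$ are the analytic branches on the right half-plane that are real on $(0,\infty)$. $\log\mathbb{E}[\cdot]$ is the analytic branch on $S_{\beta/2}$ vanishing at $z=0$. *)

theory Defs
  imports "HOL-Analysis.Analysis"
begin

definition half_plane :: "real \<Rightarrow> complex set" where
  "half_plane a = {z. Re z > - a}"

definition locally_uniform_limit_on ::
  "'a::topological_space set \<Rightarrow> ('b \<Rightarrow> 'a \<Rightarrow> 'c::metric_space) \<Rightarrow> ('a \<Rightarrow> 'c) \<Rightarrow> 'b filter \<Rightarrow> bool" where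
  "locally_uniform_limit_on A f l F \<longleftrightarrow>
     (\<forall>x\<in>A. \<exists>U. open U \<and> x \<in> U \<and> uniform_limit (U \<inter> A) f l F)"


subsection \<open>Analytic branches of the logarithm\<close>

definition log_branch :: "complex set \<Rightarrow> (complex \<Rightarrow> complex) \<Rightarrow> (complex \<Rightarrow> complex) \<Rightarrow> bool" where
  "log_branch A f L \<longleftrightarrow> L holomorphic_on A \<and> (\<forall>z\<in>A. exp (L z) = f z)"

text \<open>
  On a connected set, a branch is determined by its value at one point, so the two choices
  made below (of \<open>ln_barnes_G\<close> and \<open>log_mellin\<close>) are determined on the half-planes in question.
\<close>

lemma log_branch_unique:
  assumes L: "log_branch A f L" and L': "log_branch A f L'"
    and A: "connected A" "a \<in> A" "z \<in> A" and eq: "L a = L' a"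
  shows "L z = L' z"
proof -
  define d where "d = (\<lambda>w. L w - L' w)"
  have exp_d: "exp (d w) = 1" if "w \<in> A" for w
    using L L' that by (simp add: d_def log_branch_def exp_diff)
       (metis divide_self exp_not_eq_zero)
  have "d constant_on A"
  proof (rule continuous_discrete_range_constant[OF \<open>connected A\<close>])
    show "continuous_on A d"
      using L L' unfolding d_def log_branch_def
      by (intro continuous_intros holomorphic_on_imp_continuous_on) auto
    fix x assume x: "x \<in> A"
    have "2 * pi \<le> norm (d y - d x)" if "y \<in> A" "d y \<noteq> d x" for y
    proof -
      have "exp (d y) = exp (d x)" using exp_d x that by simp
      then obtain k :: int where k: "d y = d x + of_int (2 * k) * pi * \<i>"
        by (auto simp: exp_eq)
      with that have "k \<noteq> 0" by auto
      hence "1 \<le> \<bar>k\<bar>" by linarith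
      hence "1 \<le> \<bar>real_of_int k\<bar>" by linarith
      moreover have "norm (d y - d x) = 2 * pi * \<bar>real_of_int k\<bar>"
        by (simp add: k norm_mult)
      ultimately show ?thesis by simp
    qed
    thus "\<exists>e>0. \<forall>y. y \<in> A \<and> d y \<noteq> d x \<longrightarrow> e \<le> norm (d y - d x)"
      by (intro exI[of _ "2 * pi"]) auto
  qed
  with A have "d z = d a" unfolding constant_on_def by metis
  with eq show ?thesis by (simp add: d_def)
qed


subsection \<open>The Barnes function and the limiting function\<close>

text \<open>
  The argument is shifted: \<open>barnes_G (1 + z)\<close> is given by the Weierstrass product in
  \<open>z\<close>, whose factor of index \<open>j \<ge> 1\<close> is found at position \<open>j - 1\<close>.
\<close>

definition barnes_G :: "complex \<Rightarrow> complex" where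
  "barnes_G w = (let z = w - 1 in
     exp (z / 2 * of_real (ln (2 * pi))) * exp (- ((z + 1) * z / 2)) *
     (\<Prod>j. (1 + z / of_nat (Suc j)) ^ Suc j *
           exp (z\<^sup>2 / 2 * of_real (ln (1 + 1 / real (Suc j)))) * exp (- z)))"

definition ln_barnes_G :: "complex \<Rightarrow> complex" where
  "ln_barnes_G = (SOME L. log_branch {z. Re z > 0} barnes_G L \<and> (\<forall>x>0. L (of_real x) \<in> \<real>))"

definition binet_phi :: "real \<Rightarrow> real" where
  "binet_phi s = (1 / 2 - 1 / s + 1 / (exp s - 1)) * (1 / s)"

text \<open>
  The library function \<^const>\<open>ln_Gamma\<close> on complex numbers is the branch that is holomorphic
  off the nonpositive real axis and real on the positive one (it is not
  \<open>Ln \<circ> Gamma\<close>).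
\<close>

definition Upsilon :: "real \<Rightarrow> complex \<Rightarrow> complex" where
  "Upsilon \<beta> z =
     of_real (\<beta> / 2) * ln_barnes_G (2 * z / of_real \<beta> + 1)
     - (z - 1 / 2) * ln_Gamma (2 * z / of_real \<beta> + 1)
     + (LINT s:{0<..}|lborel.
          of_real (binet_phi s) * (exp (- (of_real s * z)) - 1) / of_real (exp (s * \<beta> / 2) - 1))
     + z\<^sup>2 / of_real \<beta> + z / 2"


subsection \<open>The random matrix ensembles\<close>

definition normalized_density :: "'a measure \<Rightarrow> ('a \<Rightarrow> real) \<Rightarrow> 'a measure" where
  "normalized_density M w = density M (\<lambda>x. ennreal (w x) / (\<integral>\<^sup>+y. ennreal (w y) \<partial>M))"

text \<open>
  The first two measures are the joint laws of the eigenvalues, as laws on functions on the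
  index set; the third is the joint law of the independent variables \<open>\<rho>\<^sub>2, \<dots>, \<rho>\<^sub>n\<close>.
\<close>

definition laguerre_ensemble :: "real \<Rightarrow> nat \<Rightarrow> (nat \<Rightarrow> real) measure" where
  "laguerre_ensemble \<beta> n = normalized_density (\<Pi>\<^sub>M k\<in>{1..n}. lborel)
     (\<lambda>x. if \<forall>k\<in>{1..n}. 0 < x k then
            (\<Prod>k=1..n. \<Prod>j=1..<k. \<bar>x k - x j\<bar> powr \<beta>) *
            (\<Prod>k=1..n. x k powr (\<beta> / 2 - 1) * exp (- x k / 2))
          else 0)"

definition jacobi_ensemble :: "real \<Rightarrow> nat \<Rightarrow> nat \<Rightarrow> (nat \<Rightarrow> real) measure" where
  "jacobi_ensemble \<beta> n1 n2 = (let m = min n1 n2; M = max n1 n2 in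
     normalized_density (\<Pi>\<^sub>M k\<in>{1..m}. lborel)
     (\<lambda>x. if \<forall>k\<in>{1..m}. 0 < x k \<and> x k < 1 then
            (\<Prod>k=1..m. \<Prod>j=1..<k. \<bar>x k - x j\<bar> powr \<beta>) *
            (\<Prod>k=1..m. x k powr (\<beta> / 2 - 1) *
                (1 - x k) powr (\<beta> / 2 * (real M - real m + 1) - 1))
          else 0))"

definition beta_density :: "real \<Rightarrow> real \<Rightarrow> real \<Rightarrow> real" where
  "beta_density a b x =
     (if 0 < x \<and> x < 1 then x powr (a - 1) * (1 - x) powr (b - 1) / Beta a b else 0)"

definition gram_ensemble :: "real \<Rightarrow> nat \<Rightarrow> (nat \<Rightarrow> real) measure" where
  "gram_ensemble \<beta> n = (\<Pi>\<^sub>M k\<in>{2..n}.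
     density lborel (\<lambda>x. ennreal
       (beta_density (\<beta> / 2 * (real n - real k + 1)) (\<beta> / 2 * (real k - 1)) x)))"

definition laguerre_det :: "nat \<Rightarrow> (nat \<Rightarrow> real) \<Rightarrow> real" where
  "laguerre_det n x = (\<Prod>k=1..n. x k)"

definition gram_det :: "nat \<Rightarrow> (nat \<Rightarrow> real) \<Rightarrow> real" where
  "gram_det n x = (\<Prod>k=2..n. x k)"

definition jacobi_det :: "nat \<Rightarrow> nat \<Rightarrow> (nat \<Rightarrow> real) \<Rightarrow> real" where
  "jacobi_det n1 n2 x = (\<Prod>k=1..min n1 n2. x k)"

definition log_mellin :: "real \<Rightarrow> 'a measure \<Rightarrow> ('a \<Rightarrow> real) \<Rightarrow> complex \<Rightarrow> complex" where
  "log_mellin \<beta> P D =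
     (SOME L. log_branch (half_plane (\<beta> / 2)) (\<lambda>z. LINT x|P. exp (z * of_real (ln (D x)))) L \<and> L 0 = 0)"


subsection \<open>Centerings\<close>

definition mu_L :: "real \<Rightarrow> nat \<Rightarrow> real" where
  "mu_L \<beta> n = (1 / 2 - 1 / \<beta>) * ln (real n) - real n + real n * ln (\<beta> * real n)"

definition mu_G :: "real \<Rightarrow> nat \<Rightarrow> real" where
  "mu_G \<beta> n = (1 / 2 - 1 / \<beta>) * ln (real n) - real n + 1 / \<beta>"

definition epsilon :: "real \<Rightarrow> real \<Rightarrow> real" where
  "epsilon x y = x * ln (1 + y / x)"

definition n_floor :: "real \<Rightarrow> nat \<Rightarrow> nat" where
  "n_floor \<tau> n = nat \<lfloor>real n * \<tau>\<rfloor>"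

definition mu_J :: "real \<Rightarrow> real \<Rightarrow> real \<Rightarrow> nat \<Rightarrow> real" where
  "mu_J \<beta> \<tau>1 \<tau>2 n =
     (1 / 2 - 1 / \<beta>) * ln (real n) + (1 / 2 - 1 / \<beta>) * ln (\<tau>1 * \<tau>2 / (\<tau>1 + \<tau>2))
     - epsilon (real (n_floor \<tau>1 n)) (real (n_floor \<tau>2 n))
     - epsilon (real (n_floor \<tau>2 n)) (real (n_floor \<tau>1 n))"

end

theory Submission
  imports Defs "HOL-Complex_Analysis.Complex_Analysis" "HOL-Real_Asymp.Real_Asymp"
    "HOL-Probability.Infinite_Product_Measure"
begin

text \<open>
  In each of the three ensembles the Mellin transform of the determinant is a finite product of
  Gamma functions.  With $c = \beta / 2$ and $F_n(z) = \sum_{k \le n} (\ln\Gamma(ck + z) -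
  \ln\Gamma(ck))$ (the function \<open>ln_Gamma_sum\<close>), the logarithm of the transform is
  $F_n(z) + nz \ln 2$ for Laguerre, $F_n(z) - n(\ln\Gamma(cn + z) - \ln\Gamma(cn))$ for Gram and
  $F_{n_1}(z) + F_{n_2}(z) - F_{n_1 + n_2}(z)$ for Jacobi.  The theorem thus follows from an
  expansion of $F_n$ and of one increment of $\ln\Gamma$.

  The Gram determinant is a product of independent Beta variables.  For the other two ensembles
  the product formula is Selberg's integral, and Aomoto's argument gives all that is needed of it.
  The integral of a partial derivative of (a polynomial times the density) vanishes; the terms of
  the derivative that are singular on the diagonals are evaluated by exchanging two coordinates,
  because the density is symmetric.  The result is a recurrence for the mean of a product of $k$
  coordinates (\<open>moment_recurrence\<close>), and hence an equation $S(a+1) = R(a) S(a)$ for the Selberg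
  integral as a function of the exponent of the coordinates.  Young's inequality adds
  $S(a + x) \le R(a)^x S(a)$ for $0 \le x \le 1$, and as in the theorem of Bohr and Mollerup the
  two properties determine $S$ up to a factor (\<open>gamma_like_unique\<close>); quotients of Gamma functions
  solve the same problem.  So the transform is known at real exponents, and by analytic continuation
  everywhere (\<open>mellin_eq_of_real\<close>).

  The expansion of $F_n$ starts from Binet's formula $\ln\Gamma(w) = (w - \frac12) \ln w - w +
  \frac12 \ln(2\pi) + \int_0^\infty \varphi(s) e^{-sw} ds$ (\<open>binet_formula\<close>).  Summed over
  $w = ck + z$, the integrals form a geometric series whose sum is the integral in $\Upsilon$; the
  terms $(k + u) \ln(k + u)$ with $u = z / c$ form a partial sum of the logarithm of the Weierstrass
  product of the Barnes function, together with values of $\ln\Gamma$.  The identity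
  \<open>ln_Gamma_sum_eq\<close> is exact, and each of its remainders vanishes as $n \to \infty$ and
  $z \to z_0$ jointly.  By compactness such joint limits are locally uniform
  (\<open>locally_uniform_limit_0I\<close>).
\<close>


section \<open>Integrals on the real line\<close>

text \<open>
  The derivative may fail to exist at finitely many points, because the density below is not
  smooth on the diagonals.  Integrability of \<open>f'\<close> is not assumed: otherwise its integral is $0$ by
  convention.  This spares an almost-everywhere argument when the lemma is applied to all
  one-dimensional fibres of an integrable function.
\<close>

lemma integral_derivative_eq_0:
  fixes f f' :: "real \<Rightarrow> real"
  assumes S: "finite S" and deriv: "\<And>x. x \<notin> S \<Longrightarrow> (f has_real_derivative f' x) (at x)"
    and cont: "continuous_on UNIV f"
    and top: "(f \<longlongrightarrow> 0) at_top" and bot: "(f \<longlongrightarrow> 0) at_bot"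
  shows "(LINT x|lborel. f' x) = 0"
proof (cases "integrable lborel f'")
  case True
  have set_int: "set_integrable lborel A f'" if "A \<in> sets lborel" for A
    using True that unfolding set_integrable_def by (rule integrable_mult_indicator[rotated])
  have eq: "(LINT x:{-real n..real n}|lborel. f' x) = f (real n) - f (- real n)" for n
  proof -
    have "(f' has_integral (f (real n) - f (- real n))) {-real n..real n}"
      using S deriv cont
      by (intro fundamental_theorem_of_calculus_interior_strong[of S])
         (auto simp: has_real_derivative_iff_has_vector_derivative intro: continuous_on_subset)
    moreover have "(LINT x:{-real n..real n}|lborel. f' x) = integral {-real n..real n} f'"
      by (rule set_borel_integral_eq_integral) (rule set_int, simp)
    ultimately show ?thesis by (simp add: integral_unique)
  qed
  have "(\<lambda>n. LINT x:{-real n..real n}|lborel. f' x) \<longlonglongrightarrow> (LINT x|lborel. f' x)"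
    unfolding set_lebesgue_integral_def
  proof (rule integral_dominated_convergence[where w = "\<lambda>x. \<bar>f' x\<bar>"])
    show "AE x in lborel. (\<lambda>n. indicator {- real n..real n} x *\<^sub>R f' x) \<longlonglongrightarrow> f' x"
    proof (rule AE_I2)
      fix x :: real
      have "eventually (\<lambda>n. indicator {- real n..real n} x *\<^sub>R f' x = f' x) sequentially"
        using eventually_ge_at_top[of "nat \<lceil>\<bar>x\<bar>\<rceil>"]
        by eventually_elim (auto simp: indicator_def split: if_splits; linarith)
      thus "(\<lambda>n. indicator {- real n..real n} x *\<^sub>R f' x) \<longlonglongrightarrow> f' x"
        by (rule tendsto_eventually)
    qed
  qed (use True in \<open>auto simp: indicator_def\<close>)
  moreover have "(\<lambda>n. f (real n) - f (- real n)) \<longlonglongrightarrow> 0 - 0"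
    by (intro tendsto_diff filterlim_compose[OF top] filterlim_compose[OF bot]
          filterlim_real_sequentially filterlim_compose[OF filterlim_uminus_at_bot_at_top])
  ultimately show ?thesis using LIMSEQ_unique unfolding eq by fastforce
qed (rule not_integrable_integral_eq)

lemma set_integrable_exp_decay:
  assumes "0 < x"
  shows "set_integrable lborel {0<..} (\<lambda>s::real. exp (- (s * x)))"
    and "(LINT s:{0<..}|lborel. exp (- (s * x))) = 1 / x"
proof -
  have eq: "einterval 0 \<infinity> = {0<..}" by (auto simp: einterval_def)
  have "((\<lambda>s. - exp (- (s * x)) / x) \<longlongrightarrow> - exp (- (0 * x)) / x) (at_right 0)"
    using assms by (intro tendsto_intros) auto
  moreover have "((\<lambda>s. - exp (- (s * x)) / x) \<longlongrightarrow> 0) at_top"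
    using assms by real_asymp
  moreover have "((\<lambda>s. - exp (- (s * x)) / x) has_real_derivative exp (- (t * x))) (at t)" for t
    using assms by (auto intro!: derivative_eq_intros)
  ultimately have *: "set_integrable lborel (einterval 0 \<infinity>) (\<lambda>s. exp (- (s * x)))"
    "(LBINT s=0..\<infinity>. exp (- (s * x))) = 0 - (- exp (- (0 * x)) / x)"
    by (intro interval_integral_FTC_nonneg[where F = "\<lambda>s. - exp (- (s * x)) / x"];
        auto simp: zero_ereal_def ereal_tendsto_simps)+
  show "set_integrable lborel {0<..} (\<lambda>s::real. exp (- (s * x)))"
    using *(1) by (simp only: eq)
  show "(LINT s:{0<..}|lborel. exp (- (s * x))) = 1 / x"
    using *(2) by (simp add: interval_lebesgue_integral_def eq)
qed

lemma integrable_powr_near_0: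
  fixes p :: real
  assumes "p > 0"
  shows "integrable lborel (\<lambda>u. indicator {0<..<1} u * u powr (p - 1))"
proof -
  have "integrable lborel (\<lambda>u. indicator {0..1} u *\<^sub>R (u powr (p - 1) * (1 - u) powr (1 - 1)))"
    using integrable_Beta[OF assms, of 1] by (simp add: set_integrable_def)
  also have "(\<lambda>u. indicator {0..1} u *\<^sub>R (u powr (p - 1) * (1 - u) powr (1 - 1)))
      = (\<lambda>u. indicator {0<..<1} u * u powr (p - 1))"
    by (auto simp: fun_eq_iff indicator_def)
  finally show ?thesis .
qed

text \<open>
  The factors are described by their logarithmic derivatives \<open>q j\<close>, so that the derivative of
  the product is the product times a sum; this is the form of the interaction term of the density.
\<close>

lemma has_real_derivative_prod_log:
  fixes f f' :: "'i \<Rightarrow> real \<Rightarrow> real"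
  assumes "finite J" "\<And>j. j \<in> J \<Longrightarrow> (f j has_real_derivative f j y * q j) (at y)"
  shows "((\<lambda>y. \<Prod>j\<in>J. f j y) has_real_derivative (\<Prod>j\<in>J. f j y) * (\<Sum>j\<in>J. q j)) (at y)"
  using assms
proof (induction J rule: finite_induct)
  case (insert i J)
  have "((\<lambda>y. f i y * (\<Prod>j\<in>J. f j y)) has_real_derivative
      (f i y * q i) * (\<Prod>j\<in>J. f j y) + (\<Prod>j\<in>J. f j y) * (\<Sum>j\<in>J. q j) * f i y) (at y)"
    using insert by (intro DERIV_mult) auto
  thus ?case using insert by (simp add: algebra_simps)
qed simp

lemma has_real_derivative_abs_powr:
  fixes y b p :: real
  assumes "y \<noteq> b"
  shows "((\<lambda>y. \<bar>y - b\<bar> powr p) has_real_derivative \<bar>y - b\<bar> powr p * (p / (y - b))) (at y)"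
proof (cases "y > b")
  case True
  have "((\<lambda>y. (y - b) powr p) has_real_derivative (y - b) powr p * (p / (y - b))) (at y)"
    using True by (auto intro!: derivative_eq_intros simp: powr_diff field_simps)
  moreover have "\<forall>\<^sub>F x in nhds y. (x - b) powr p = \<bar>x - b\<bar> powr p"
    using eventually_nhds_in_open[of "{b<..}" y] True by (auto elim!: eventually_mono)
  ultimately show ?thesis
    by (subst (asm) DERIV_cong_ev[OF refl _ refl]) (use True in auto)
next
  case False
  hence "y < b" using assms by auto
  have "((\<lambda>y. (b - y) powr p) has_real_derivative (b - y) powr p * (p / (y - b))) (at y)"
    using \<open>y < b\<close> by (auto intro!: derivative_eq_intros simp: powr_diff divide_simps)
       (simp add: algebra_simps)
  moreover have "\<forall>\<^sub>F x in nhds y. (b - x) powr p = \<bar>x - b\<bar> powr p"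
    using eventually_nhds_in_open[of "{..<b}" y] \<open>y < b\<close> by (auto elim!: eventually_mono)
  ultimately show ?thesis
    by (subst (asm) DERIV_cong_ev[OF refl _ refl]) (use \<open>y < b\<close> in auto)
qed


section \<open>Symmetric integrals and powers of the Vandermonde determinant\<close>

abbreviation lborel_pow :: "'i set \<Rightarrow> ('i \<Rightarrow> real) measure" where
  "lborel_pow I \<equiv> Pi\<^sub>M I (\<lambda>_. lborel)"

lemma product_sigma_finite_lborel: "product_sigma_finite (\<lambda>_. lborel :: real measure)"
  by standard

lemma measurable_comp_permutes:
  assumes "p permutes I"
  shows "(\<lambda>x. x \<circ> p) \<in> measurable (lborel_pow I) (lborel_pow I)"
proof -
  have "(\<lambda>x i. x (p i)) \<in> measurable (lborel_pow I) (lborel_pow I)"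
  proof (rule measurable_PiM_single')
    fix i assume "i \<in> I"
    hence "p i \<in> I" using assms by (simp add: permutes_in_image)
    thus "(\<lambda>x. x (p i)) \<in> measurable (lborel_pow I) lborel"
      by simp
  next
    show "(\<lambda>x i. x (p i)) \<in> space (lborel_pow I) \<rightarrow> (\<Pi>\<^sub>E i\<in>I. space lborel)"
      using assms by (auto simp: space_PiM PiE_def extensional_def permutes_not_in)
  qed
  thus ?thesis by (simp add: o_def)
qed

text \<open>
  A box is mapped to the box with permuted sides, which has the same volume.
\<close>

lemma distr_comp_permutes:
  assumes I: "finite I" and p: "p permutes I"
  shows "distr (lborel_pow I) (lborel_pow I) (\<lambda>x. x \<circ> p) = lborel_pow I"
proof -
  interpret product_sigma_finite "\<lambda>_. lborel :: real measure" by (rule product_sigma_finite_lborel)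
  show ?thesis
  proof (rule PiM_eqI[OF I])
    fix A :: "'a \<Rightarrow> real set" assume A: "\<And>i. i \<in> I \<Longrightarrow> A i \<in> sets lborel"
    have inv: "inv p permutes I" using p by (rule permutes_inv)
    have vim: "(\<lambda>x. x \<circ> p) -` Pi\<^sub>E I A \<inter> space (lborel_pow I) = Pi\<^sub>E I (\<lambda>i. A (inv p i))"
    proof (intro set_eqI iffI)
      fix x assume x: "x \<in> (\<lambda>x. x \<circ> p) -` Pi\<^sub>E I A \<inter> space (lborel_pow I)"
      have "x i \<in> A (inv p i)" if "i \<in> I" for i
      proof -
        have "inv p i \<in> I" using inv that by (simp add: permutes_in_image)
        hence "(x \<circ> p) (inv p i) \<in> A (inv p i)" using x by blast
        thus ?thesis using permutes_inverses(1)[OF p] by simp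
      qed
      thus "x \<in> Pi\<^sub>E I (\<lambda>i. A (inv p i))" using x by (auto simp: space_PiM PiE_def)
    next
      fix x assume x: "x \<in> Pi\<^sub>E I (\<lambda>i. A (inv p i))"
      have "(x \<circ> p) i \<in> A i" if "i \<in> I" for i
      proof -
        have "p i \<in> I" using p that by (simp add: permutes_in_image)
        hence "x (p i) \<in> A (inv p (p i))" using x by blast
        thus ?thesis using permutes_inverses(2)[OF p] by simp
      qed
      thus "x \<in> (\<lambda>x. x \<circ> p) -` Pi\<^sub>E I A \<inter> space (lborel_pow I)"
        using x p by (auto simp: space_PiM PiE_def extensional_def permutes_not_in)
    qed
    have A': "A (inv p i) \<in> sets lborel" if "i \<in> I" for i
      using A inv that by (simp add: permutes_in_image)
    have "emeasure (distr (lborel_pow I) (lborel_pow I) (\<lambda>x. x \<circ> p)) (Pi\<^sub>E I A)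
        = emeasure (lborel_pow I) (Pi\<^sub>E I (\<lambda>i. A (inv p i)))"
      by (subst emeasure_distr) (use A I in \<open>auto intro!: measurable_comp_permutes[OF p] sets_PiM_I_finite simp: vim\<close>)
    also have "\<dots> = (\<Prod>i\<in>I. emeasure lborel (A (inv p i)))"
      by (rule emeasure_PiM) (use I A' in auto)
    also have "\<dots> = (\<Prod>i\<in>I. emeasure lborel (A i))"
      by (rule prod.reindex_bij_betw) (rule permutes_imp_bij[OF inv])
    finally show "emeasure (distr (lborel_pow I) (lborel_pow I) (\<lambda>x. x \<circ> p)) (Pi\<^sub>E I A)
        = (\<Prod>i\<in>I. emeasure lborel (A i))" .
  qed simp
qed

lemma integral_comp_permutes:
  fixes f :: "('i \<Rightarrow> real) \<Rightarrow> real"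
  assumes I: "finite I" and p: "p permutes I" and f: "f \<in> borel_measurable (lborel_pow I)"
  shows "integral\<^sup>L (lborel_pow I) (\<lambda>x. f (x \<circ> p)) = integral\<^sup>L (lborel_pow I) f"
  using integral_distr[OF measurable_comp_permutes[OF p] f] by (simp add: distr_comp_permutes[OF I p])

lemma integrable_comp_permutes:
  fixes f :: "('i \<Rightarrow> real) \<Rightarrow> real"
  assumes I: "finite I" and p: "p permutes I" and f: "f \<in> borel_measurable (lborel_pow I)"
  shows "integrable (lborel_pow I) (\<lambda>x. f (x \<circ> p)) = integrable (lborel_pow I) f"
  using integrable_distr_eq[OF measurable_comp_permutes[OF p] f] by (simp add: distr_comp_permutes[OF I p])

text \<open>
  The power $|\Delta|^{2\gamma}$ of the Vandermonde determinant.  The product over ordered pairs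
  with exponent \<open>\<gamma>\<close>, in place of \<open>i < j\<close> with exponent \<open>2 * \<gamma>\<close>, makes the symmetry evident.
\<close>

definition vdm :: "real \<Rightarrow> 'i set \<Rightarrow> ('i \<Rightarrow> real) \<Rightarrow> real" where
  "vdm \<gamma> I x = (\<Prod>i\<in>I. \<Prod>j\<in>I - {i}. \<bar>x i - x j\<bar> powr \<gamma>)"

lemma vdm_nonneg: "0 \<le> vdm \<gamma> I x"
  by (simp add: vdm_def prod_nonneg)

lemma vdm_insert:
  assumes "finite J" "i \<notin> J"
  shows "vdm \<gamma> (insert i J) x = (\<Prod>j\<in>J. \<bar>x i - x j\<bar> powr (2 * \<gamma>)) * vdm \<gamma> J x"
proof -
  have "(\<Prod>j\<in>insert i J - {k}. \<bar>x k - x j\<bar> powr \<gamma>)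
      = \<bar>x i - x k\<bar> powr \<gamma> * (\<Prod>j\<in>J - {k}. \<bar>x k - x j\<bar> powr \<gamma>)" if "k \<in> J" for k
  proof -
    have "insert i J - {k} = insert i (J - {k})" using that assms by auto
    thus ?thesis using assms by (simp add: abs_minus_commute)
  qed
  hence "vdm \<gamma> (insert i J) x = (\<Prod>j\<in>J. \<bar>x i - x j\<bar> powr \<gamma>) *
      ((\<Prod>k\<in>J. \<bar>x i - x k\<bar> powr \<gamma>) * vdm \<gamma> J x)"
    using assms by (simp add: vdm_def prod.distrib)
  also have "(\<Prod>j\<in>J. \<bar>x i - x j\<bar> powr \<gamma>) * ((\<Prod>k\<in>J. \<bar>x i - x k\<bar> powr \<gamma>) * vdm \<gamma> J x)
      = (\<Prod>j\<in>J. \<bar>x i - x j\<bar> powr (2 * \<gamma>)) * vdm \<gamma> J x"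
  proof -
    have "2 * \<gamma> = \<gamma> + \<gamma>" by simp
    thus ?thesis by (simp only: powr_add prod.distrib mult.assoc)
  qed
  finally show ?thesis .
qed

lemma vdm_comp_permutes:
  assumes "p permutes I"
  shows "vdm \<gamma> I (x \<circ> p) = vdm \<gamma> I x"
proof -
  have "(\<Prod>j\<in>I - {i}. \<bar>x (p i) - x (p j)\<bar> powr \<gamma>) = (\<Prod>j\<in>I - {p i}. \<bar>x (p i) - x j\<bar> powr \<gamma>)"
    if "i \<in> I" for i
  proof (rule prod.reindex_bij_betw[of p "I - {i}" "I - {p i}" "\<lambda>j. \<bar>x (p i) - x j\<bar> powr \<gamma>"])
    have "p ` (I - {i}) = p ` I - {p i}"
      using permutes_inj[OF assms] by (subst image_set_diff) auto
    thus "bij_betw p (I - {i}) (I - {p i})"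
      using permutes_inj[OF assms] permutes_image[OF assms]
      by (auto simp: bij_betw_def intro: inj_on_subset)
  qed
  thus ?thesis
    unfolding vdm_def o_def
    using prod.reindex_bij_betw[OF permutes_imp_bij[OF assms],
        of "\<lambda>i. \<Prod>j\<in>I - {i}. \<bar>x i - x j\<bar> powr \<gamma>"] by simp
qed

text \<open>
  Quotients by \<open>x i - x j\<close> are always multiplied by this function, so that division by zero
  on the diagonals is harmless.
\<close>

lemma vdm_eq_0:
  assumes "finite I" "i \<in> I" "j \<in> I" "i \<noteq> j" "x i = x j"
  shows "vdm \<gamma> I x = 0"
proof -
  have "(\<Prod>j\<in>I - {i}. \<bar>x i - x j\<bar> powr \<gamma>) = 0"
    using assms by (intro prod_zero) (auto intro!: bexI[of _ j])
  thus ?thesis unfolding vdm_def using assms by (intro prod_zero) blast+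
qed

lemma borel_measurable_vdm [measurable]:
  assumes "J \<subseteq> I"
  shows "vdm \<gamma> J \<in> borel_measurable (lborel_pow I)"
proof -
  have "(\<lambda>x. \<bar>x i - x j\<bar> powr \<gamma>) \<in> borel_measurable (lborel_pow I)" if "i \<in> J" "j \<in> J" for i j
  proof -
    have [measurable]: "i \<in> I" "j \<in> I" using that assms by auto
    show ?thesis by measurable
  qed
  thus ?thesis unfolding vdm_def by (intro borel_measurable_prod) auto
qed

lemma powr_diff_le:
  fixes s t p :: real
  assumes "0 \<le> p"
  shows "\<bar>s - t\<bar> powr p \<le> (1 + \<bar>s\<bar>) ^ nat \<lceil>p\<rceil> * (1 + \<bar>t\<bar>) ^ nat \<lceil>p\<rceil>"
proof -
  have le: "\<bar>s - t\<bar> \<le> (1 + \<bar>s\<bar>) * (1 + \<bar>t\<bar>)"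
  proof -
    have "0 \<le> \<bar>s\<bar> * \<bar>t\<bar>" by simp
    moreover have "(1 + \<bar>s\<bar>) * (1 + \<bar>t\<bar>) = 1 + \<bar>s\<bar> + \<bar>t\<bar> + \<bar>s\<bar> * \<bar>t\<bar>"
      by (simp add: algebra_simps)
    ultimately show ?thesis using abs_triangle_ineq4[of s t] by linarith
  qed
  have one: "1 \<le> (1 + \<bar>s\<bar>) * (1 + \<bar>t\<bar>)"
    by (simp add: algebra_simps)
  have "\<bar>s - t\<bar> powr p \<le> ((1 + \<bar>s\<bar>) * (1 + \<bar>t\<bar>)) powr p"
    using le assms by (intro powr_mono2) auto
  also have "\<dots> \<le> ((1 + \<bar>s\<bar>) * (1 + \<bar>t\<bar>)) powr real (nat \<lceil>p\<rceil>)"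
    using one assms by (intro powr_mono) (auto simp: of_nat_nat)
  also have "\<dots> = ((1 + \<bar>s\<bar>) * (1 + \<bar>t\<bar>)) ^ nat \<lceil>p\<rceil>"
    using one by (intro powr_realpow) auto
  finally show ?thesis by (simp add: power_mult_distrib)
qed

lemma vdm_le_polynomial:
  assumes "finite I" "0 \<le> \<gamma>"
  shows "\<exists>N. \<forall>x. vdm \<gamma> I x \<le> (\<Prod>i\<in>I. (1 + \<bar>x i\<bar>) ^ N)"
  using assms(1)
proof (induction I rule: finite_induct)
  case empty
  thus ?case by (simp add: vdm_def)
next
  case (insert i J)
  then obtain N where N: "\<And>x. vdm \<gamma> J x \<le> (\<Prod>i\<in>J. (1 + \<bar>x i\<bar>) ^ N)" by blast
  define m where "m = nat \<lceil>2 * \<gamma>\<rceil>"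
  define N' where "N' = m * card J + m + N"
  have "vdm \<gamma> (insert i J) x \<le> (\<Prod>i\<in>insert i J. (1 + \<bar>x i\<bar>) ^ N')" for x
  proof -
    have "vdm \<gamma> (insert i J) x
        \<le> (\<Prod>j\<in>J. (1 + \<bar>x i\<bar>) ^ m * (1 + \<bar>x j\<bar>) ^ m) * (\<Prod>i\<in>J. (1 + \<bar>x i\<bar>) ^ N)"
      unfolding vdm_insert[OF insert.hyps] m_def
      using assms by (intro mult_mono N prod_mono conjI powr_diff_le prod_nonneg vdm_nonneg) auto
    also have "\<dots> = (1 + \<bar>x i\<bar>) ^ (m * card J) * (\<Prod>j\<in>J. (1 + \<bar>x j\<bar>) ^ (m + N))"
      by (simp add: prod.distrib power_mult power_add mult.assoc)
    also have "\<dots> \<le> (1 + \<bar>x i\<bar>) ^ N' * (\<Prod>j\<in>J. (1 + \<bar>x j\<bar>) ^ N')"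
      unfolding N'_def
      by (intro mult_mono prod_mono conjI power_increasing prod_nonneg) auto
    finally show ?thesis using insert by simp
  qed
  thus ?case by blast
qed

text \<open>
  The dominating function for a singularity at \<open>x i = x j\<close>: in the variable \<open>x i\<close> it is a
  translate of \<open>h\<close>, whose integral does not depend on the other coordinates.
\<close>

lemma integrable_shift_prod:
  fixes h q :: "real \<Rightarrow> real"
  assumes J: "finite J" "i \<notin> J" "j \<in> J"
    and h: "integrable lborel h" "\<And>u. 0 \<le> h u" and q: "integrable lborel q" "\<And>u. 0 \<le> q u"
  shows "integrable (lborel_pow (insert i J)) (\<lambda>x. h (x i - x j) * (\<Prod>k\<in>J. q (x k)))"
proof -
  interpret product_sigma_finite "\<lambda>_. lborel :: real measure" by (rule product_sigma_finite_lborel)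
  note [measurable] = borel_measurable_integrable[OF h(1)] borel_measurable_integrable[OF q(1)]
  have fin: "(\<integral>\<^sup>+ u. ennreal (h u) \<partial>lborel) < \<infinity>" "(\<integral>\<^sup>+ u. ennreal (q u) \<partial>lborel) < \<infinity>"
    using h q by (auto simp: integrable_iff_bounded)
  have meas [measurable]: "(\<lambda>x. h (x i - x j) * (\<Prod>k\<in>J. q (x k))) \<in> borel_measurable (lborel_pow (insert i J))"
    using J by (intro borel_measurable_times borel_measurable_prod) auto
  have "(\<integral>\<^sup>+ x. ennreal (norm (h (x i - x j) * (\<Prod>k\<in>J. q (x k)))) \<partial>lborel_pow (insert i J))
      = (\<integral>\<^sup>+ x. (\<integral>\<^sup>+ y. ennreal (h (y - x j)) * (\<Prod>k\<in>J. ennreal (q (x k))) \<partial>lborel) \<partial>lborel_pow J)"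
  proof (subst product_nn_integral_insert[OF J(1,2)])
    have "(\<Prod>k\<in>J. q (if k = i then y else x k)) = (\<Prod>k\<in>J. q (x k))" for x y
      using J by (intro prod.cong) auto
    thus "(\<integral>\<^sup>+x. \<integral>\<^sup>+y. ennreal (norm (h ((x(i := y)) i - (x(i := y)) j) * (\<Prod>k\<in>J. q ((x(i := y)) k)))) \<partial>lborel \<partial>lborel_pow J)
       = (\<integral>\<^sup>+ x. (\<integral>\<^sup>+ y. ennreal (h (y - x j)) * (\<Prod>k\<in>J. ennreal (q (x k))) \<partial>lborel) \<partial>lborel_pow J)"
      using J h(2) q(2)
      by (intro nn_integral_cong)
         (auto simp: ennreal_mult prod_nonneg prod_ennreal abs_mult)
  qed measurable
  also have "\<dots> = (\<integral>\<^sup>+ x. (\<integral>\<^sup>+ u. ennreal (h u) \<partial>lborel) * (\<Prod>k\<in>J. ennreal (q (x k))) \<partial>lborel_pow J)"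
  proof (rule nn_integral_cong)
    fix x :: "'a \<Rightarrow> real"
    have "(\<integral>\<^sup>+ u. ennreal (h u) \<partial>lborel) = (\<integral>\<^sup>+ y. ennreal (h (y - x j)) \<partial>lborel)"
      by (subst nn_integral_real_affine[where c = 1 and t = "- x j"]) (auto simp: algebra_simps)
    thus "(\<integral>\<^sup>+ y. ennreal (h (y - x j)) * (\<Prod>k\<in>J. ennreal (q (x k))) \<partial>lborel)
        = (\<integral>\<^sup>+ u. ennreal (h u) \<partial>lborel) * (\<Prod>k\<in>J. ennreal (q (x k)))"
      by (simp add: nn_integral_multc)
  qed
  also have "\<dots> = (\<integral>\<^sup>+ u. ennreal (h u) \<partial>lborel) * (\<Prod>k\<in>J. \<integral>\<^sup>+ u. ennreal (q u) \<partial>lborel)"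
    using J product_nn_integral_prod[of J "\<lambda>_ t. ennreal (q t)"]
    by (subst nn_integral_cmult) (auto simp del: prod_constant)
  also have "\<dots> < \<infinity>"
    using fin by (simp add: ennreal_mult_less_top power_less_top_ennreal)
  finally show ?thesis by (simp add: integrable_iff_bounded)
qed


section \<open>Aomoto's recurrence\<close>

text \<open>
  One-dimensional weights with the Pearson equation $(\sigma w)' = (a - dt) w$ for
  $\sigma(t) = t(1 - ct)$.  The weight $t^{a-1} e^{-t/2}$ is the case $c = 0$, $d = 1/2$, the weight
  $t^{a-1} (1-t)^{b-1}$ on the unit interval the case $c = 1$, $d = a + b$; in this way the Laguerre
  and Jacobi ensembles share one proof.
\<close>

locale selberg_weight =
  fixes w :: "real \<Rightarrow> real" and a d c :: real
  assumes w_measurable [measurable]: "w \<in> borel_measurable borel"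
    and w_nonneg: "0 \<le> w t"
    and w_moments: "integrable lborel (\<lambda>t. w t * (1 + \<bar>t\<bar>) ^ p)"
    and pearson: "\<exists>E. finite E \<and> (\<forall>t. t \<notin> E \<longrightarrow>
        ((\<lambda>t. t * (1 - c * t) * w t) has_real_derivative (a - d * t) * w t) (at t))"
    and pearson_continuous: "continuous_on UNIV (\<lambda>t. t * (1 - c * t) * w t)"
    and pearson_bounded: "\<exists>K. \<forall>t. \<bar>t * (1 - c * t) * w t\<bar> * (1 + \<bar>t\<bar>) ^ p \<le> K"
begin

definition dens :: "real \<Rightarrow> 'i set \<Rightarrow> ('i \<Rightarrow> real) \<Rightarrow> real" where
  "dens \<gamma> I x = (\<Prod>i\<in>I. w (x i)) * vdm \<gamma> I x"

lemma dens_nonneg: "0 \<le> dens \<gamma> I x"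
  by (simp add: dens_def prod_nonneg w_nonneg vdm_nonneg)

lemma borel_measurable_dens [measurable]: "dens \<gamma> I \<in> borel_measurable (lborel_pow I)"
  unfolding dens_def by measurable

lemma dens_comp_permutes:
  assumes "p permutes I"
  shows "dens \<gamma> I (x \<circ> p) = dens \<gamma> I x"
  unfolding dens_def vdm_comp_permutes[OF assms]
  using prod.reindex_bij_betw[OF permutes_imp_bij[OF assms], of "\<lambda>i. w (x i)"] by (simp add: o_def)

lemma integrable_dens:
  assumes I: "finite I" and \<gamma>: "0 \<le> \<gamma>" and g [measurable]: "g \<in> borel_measurable (lborel_pow I)"
    and le: "\<And>x. \<bar>g x\<bar> \<le> (\<Prod>i\<in>I. (1 + \<bar>x i\<bar>) ^ p)"
  shows "integrable (lborel_pow I) (\<lambda>x. g x * dens \<gamma> I x)"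
proof -
  interpret product_sigma_finite "\<lambda>_. lborel :: real measure" by (rule product_sigma_finite_lborel)
  obtain N where N: "\<And>x. vdm \<gamma> I x \<le> (\<Prod>i\<in>I. (1 + \<bar>x i\<bar>) ^ N)"
    using vdm_le_polynomial[OF I \<gamma>] by blast
  have "integrable (lborel_pow I) (\<lambda>x. \<Prod>i\<in>I. w (x i) * (1 + \<bar>x i\<bar>) ^ (p + N))"
    by (intro product_integrable_prod w_moments I)
  thus ?thesis
  proof (rule Bochner_Integration.integrable_bound)
    show "AE x in lborel_pow I. norm (g x * dens \<gamma> I x) \<le> norm (\<Prod>i\<in>I. w (x i) * (1 + \<bar>x i\<bar>) ^ (p + N))"
    proof (rule AE_I2)
      fix x :: "'a \<Rightarrow> real"
      have "\<bar>g x\<bar> * dens \<gamma> I x \<le>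
          (\<Prod>i\<in>I. (1 + \<bar>x i\<bar>) ^ p) * ((\<Prod>i\<in>I. w (x i)) * (\<Prod>i\<in>I. (1 + \<bar>x i\<bar>) ^ N))"
        unfolding dens_def
        by (intro mult_mono mult_left_mono le N prod_nonneg mult_nonneg_nonneg vdm_nonneg) (auto simp: w_nonneg)
      also have "\<dots> = (\<Prod>i\<in>I. w (x i) * (1 + \<bar>x i\<bar>) ^ (p + N))"
        by (simp add: power_add prod.distrib)
      finally show "norm (g x * dens \<gamma> I x) \<le> norm (\<Prod>i\<in>I. w (x i) * (1 + \<bar>x i\<bar>) ^ (p + N))"
        by (simp add: abs_mult abs_of_nonneg[OF dens_nonneg] prod_nonneg w_nonneg)
    qed
  qed measurable
qed

text \<open>
  The integrand is singular on a diagonal when \<open>2 * \<gamma> < 1\<close>, like $|x_i - x_j|^{2\gamma - 1}$.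
  That is integrable in \<open>x i\<close> as \<open>\<gamma> > 0\<close>, provided that the remaining factor is bounded in \<open>x i\<close>.
  The weight itself may be unbounded near $0$, but $\sigma w$ is bounded.
\<close>

lemma integrable_dens_singular:
  assumes J: "finite J" "i \<notin> J" "j \<in> J" and \<gamma>: "0 < \<gamma>"
    and g [measurable]: "g \<in> borel_measurable (lborel_pow (insert i J))"
    and le: "\<And>x. \<bar>g x\<bar> \<le> (\<Prod>k\<in>insert i J. (1 + \<bar>x k\<bar>) ^ p)"
  shows "integrable (lborel_pow (insert i J))
           (\<lambda>x. g x * (x i * (1 - c * x i) / (x i - x j)) * dens \<gamma> (insert i J) x)"
proof -
  interpret product_sigma_finite "\<lambda>_. lborel :: real measure" by (rule product_sigma_finite_lborel)
  define \<sigma> where "\<sigma> = (\<lambda>t::real. t * (1 - c * t))"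
  obtain N where N: "\<And>x. vdm \<gamma> J x \<le> (\<Prod>i\<in>J. (1 + \<bar>x i\<bar>) ^ N)"
    using vdm_le_polynomial[OF J(1), of \<gamma>] \<gamma> by auto
  define m where "m = nat \<lceil>2 * \<gamma>\<rceil>"
  define r where "r = p + m * card (J - {j})"
  define r' where "r' = p + m + N"
  define q where "q = (\<lambda>t. w t * (1 + \<bar>t\<bar>) ^ (r' + m))"
  \<comment> \<open>the possibly negative power is kept only near 0; elsewhere the exponent is raised to \<open>2 * \<gamma>\<close>\<close>
  define k where "k = (\<lambda>u::real. indicator {0<..<1} u * u powr (2 * \<gamma> - 1))"
  define h where "h = (\<lambda>u. k u + k (- u))"
  obtain K where K: "\<And>t. \<bar>\<sigma> t * w t\<bar> * (1 + \<bar>t\<bar>) ^ r \<le> K"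
    using pearson_bounded[of r] unfolding \<sigma>_def by auto
  have K0: "0 \<le> K" by (rule order_trans[OF _ K[of 0]]) simp
  have k: "integrable lborel k" "\<And>u. 0 \<le> k u"
    using \<gamma> integrable_powr_near_0[of "2 * \<gamma>"] by (auto simp: k_def)
  have h: "integrable lborel h" "\<And>u. 0 \<le> h u"
    unfolding h_def using k lborel_integrable_real_affine[OF k(1), of "-1" 0] by auto
  have h_bound: "\<bar>u\<bar> powr (2 * \<gamma> - 1) \<le> h u + \<bar>u\<bar> powr (2 * \<gamma>)" for u
  proof (cases "\<bar>u\<bar> < 1")
    case True
    thus ?thesis using \<gamma> by (cases "u = 0") (auto simp: h_def k_def indicator_def abs_if)
  next
    case False
    hence "\<bar>u\<bar> powr (2 * \<gamma> - 1) \<le> \<bar>u\<bar> powr (2 * \<gamma>)" by (intro powr_mono) auto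
    thus ?thesis using h(2)[of u] by linarith
  qed
  have q: "integrable lborel q" "\<And>u. 0 \<le> q u"
    using w_moments by (auto simp: q_def w_nonneg)
  have \<sigma>_le: "\<bar>\<sigma> t\<bar> \<le> (1 + \<bar>c\<bar>) * (1 + \<bar>t\<bar>) ^ 2" for t
  proof -
    have "\<bar>\<sigma> t\<bar> \<le> \<bar>t\<bar> * (1 + \<bar>c\<bar> * \<bar>t\<bar>)"
      unfolding \<sigma>_def abs_mult by (intro mult_left_mono) (auto simp: abs_mult intro: order_trans[OF abs_triangle_ineq4])
    also have "\<dots> \<le> (1 + \<bar>c\<bar>) * (1 + \<bar>t\<bar>) ^ 2"
      by (simp add: power2_eq_square algebra_simps)
    finally show ?thesis .
  qed
  have \<sigma>w: "integrable lborel (\<lambda>t. \<bar>\<sigma> t * w t\<bar> * (1 + \<bar>t\<bar>) ^ (r + m))"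
  proof (rule Bochner_Integration.integrable_bound)
    show "integrable lborel (\<lambda>t. (1 + \<bar>c\<bar>) * (w t * (1 + \<bar>t\<bar>) ^ (r + m + 2)))"
      by (intro integrable_mult_right w_moments)
    show "AE t in lborel. norm (\<bar>\<sigma> t * w t\<bar> * (1 + \<bar>t\<bar>) ^ (r + m)) \<le> norm ((1 + \<bar>c\<bar>) * (w t * (1 + \<bar>t\<bar>) ^ (r + m + 2)))"
    proof (rule AE_I2)
      fix t
      have "\<bar>\<sigma> t\<bar> * (w t * (1 + \<bar>t\<bar>) ^ (r + m)) \<le> ((1 + \<bar>c\<bar>) * (1 + \<bar>t\<bar>) ^ 2) * (w t * (1 + \<bar>t\<bar>) ^ (r + m))"
        by (intro mult_right_mono \<sigma>_le) (simp add: w_nonneg)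
      thus "norm (\<bar>\<sigma> t * w t\<bar> * (1 + \<bar>t\<bar>) ^ (r + m)) \<le> norm ((1 + \<bar>c\<bar>) * (w t * (1 + \<bar>t\<bar>) ^ (r + m + 2)))"
        by (simp add: abs_mult w_nonneg power_add power2_eq_square mult_ac)
    qed
  qed (auto simp: \<sigma>_def)
  define B where "B = (\<lambda>x. K * (h (x i - x j) * (\<Prod>k\<in>J. q (x k)))
     + (\<Prod>k\<in>insert i J. if k = i then \<bar>\<sigma> (x k) * w (x k)\<bar> * (1 + \<bar>x k\<bar>) ^ (r + m) else q (x k)))"
  have B: "integrable (lborel_pow (insert i J)) B"
    unfolding B_def
  proof (intro Bochner_Integration.integrable_add integrable_mult_right integrable_shift_prod J h q)
    have "integrable (lborel_pow (insert i J)) (\<lambda>x. \<Prod>k\<in>insert i J.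
       (\<lambda>t. if k = i then \<bar>\<sigma> t * w t\<bar> * (1 + \<bar>t\<bar>) ^ (r + m) else q t) (x k))"
    proof (rule product_integrable_prod)
      show "integrable lborel (\<lambda>t. if k = i then \<bar>\<sigma> t * w t\<bar> * (1 + \<bar>t\<bar>) ^ (r + m) else q t)" for k
        using \<sigma>w q by (cases "k = i") auto
    qed (use J in auto)
    thus "integrable (lborel_pow (insert i J)) (\<lambda>x. \<Prod>k\<in>insert i J.
       if k = i then \<bar>\<sigma> (x k) * w (x k)\<bar> * (1 + \<bar>x k\<bar>) ^ (r + m) else q (x k))" by simp
  qed
  show ?thesis
  proof (rule Bochner_Integration.integrable_bound[OF B])
    show "(\<lambda>x. g x * (x i * (1 - c * x i) / (x i - x j)) * dens \<gamma> (insert i J) x)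
        \<in> borel_measurable (lborel_pow (insert i J))"
      using J by (intro borel_measurable_times borel_measurable_dens borel_measurable_divide borel_measurable_diff g) auto
    show "AE x in lborel_pow (insert i J). norm (g x * (x i * (1 - c * x i) / (x i - x j)) * dens \<gamma> (insert i J) x) \<le> norm (B x)"
    proof (rule AE_I2)
      fix x :: "'a \<Rightarrow> real"
      let ?W = "\<Prod>k\<in>J. w (x k)"
      let ?u = "x i - x j"
      have W0: "0 \<le> ?W" by (simp add: prod_nonneg w_nonneg)
      have split: "(\<Prod>k\<in>J. \<bar>x i - x k\<bar> powr (2 * \<gamma>)) / \<bar>?u\<bar>
          = \<bar>?u\<bar> powr (2 * \<gamma> - 1) * (\<Prod>k\<in>J - {j}. \<bar>x i - x k\<bar> powr (2 * \<gamma>))"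
        using J by (subst prod.remove[of _ j]) (auto simp: powr_diff)
      have rest: "(\<Prod>k\<in>J - {j}. \<bar>x i - x k\<bar> powr (2 * \<gamma>))
          \<le> (1 + \<bar>x i\<bar>) ^ (m * card (J - {j})) * (\<Prod>k\<in>J. (1 + \<bar>x k\<bar>) ^ m)"
      proof -
        have "(\<Prod>k\<in>J - {j}. \<bar>x i - x k\<bar> powr (2 * \<gamma>)) \<le> (\<Prod>k\<in>J - {j}. (1 + \<bar>x i\<bar>) ^ m * (1 + \<bar>x k\<bar>) ^ m)"
          unfolding m_def using \<gamma> by (intro prod_mono conjI powr_diff_le) auto
        also have "\<dots> = (1 + \<bar>x i\<bar>) ^ (m * card (J - {j})) * (\<Prod>k\<in>J - {j}. (1 + \<bar>x k\<bar>) ^ m)"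
          by (simp add: prod.distrib power_mult)
        also have "\<dots> \<le> (1 + \<bar>x i\<bar>) ^ (m * card (J - {j})) * (\<Prod>k\<in>J. (1 + \<bar>x k\<bar>) ^ m)"
          using J by (intro mult_left_mono prod_mono2) auto
        finally show ?thesis .
      qed
      have "norm (g x * (x i * (1 - c * x i) / ?u) * dens \<gamma> (insert i J) x)
          = \<bar>g x\<bar> * (\<bar>\<sigma> (x i) * w (x i)\<bar> * ?W *
              ((\<Prod>k\<in>J. \<bar>x i - x k\<bar> powr (2 * \<gamma>)) / \<bar>?u\<bar>) * vdm \<gamma> J x)"
        using J W0
        by (simp add: dens_def vdm_insert abs_mult \<sigma>_def w_nonneg abs_of_nonneg[OF vdm_nonneg] abs_prod)
      also have "\<dots> \<le> (\<Prod>k\<in>insert i J. (1 + \<bar>x k\<bar>) ^ p) * (\<bar>\<sigma> (x i) * w (x i)\<bar> * ?W *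
              (\<bar>?u\<bar> powr (2 * \<gamma> - 1) * ((1 + \<bar>x i\<bar>) ^ (m * card (J - {j})) * (\<Prod>k\<in>J. (1 + \<bar>x k\<bar>) ^ m)))
               * (\<Prod>k\<in>J. (1 + \<bar>x k\<bar>) ^ N))"
        unfolding split using W0
        by (intro mult_mono le N rest order_refl mult_nonneg_nonneg prod_nonneg vdm_nonneg) (auto simp: w_nonneg)
      also have "\<dots> = (\<bar>\<sigma> (x i) * w (x i)\<bar> * (1 + \<bar>x i\<bar>) ^ r) * \<bar>?u\<bar> powr (2 * \<gamma> - 1) *
             (\<Prod>k\<in>J. w (x k) * (1 + \<bar>x k\<bar>) ^ r')"
        using J by (simp add: r_def r'_def power_add prod.distrib mult_ac)
      also have "\<dots> \<le> (\<bar>\<sigma> (x i) * w (x i)\<bar> * (1 + \<bar>x i\<bar>) ^ r) *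
             (h ?u + (1 + \<bar>x i\<bar>) ^ m * (1 + \<bar>x j\<bar>) ^ m) * (\<Prod>k\<in>J. w (x k) * (1 + \<bar>x k\<bar>) ^ r')"
        using \<gamma> unfolding m_def
        by (intro mult_right_mono mult_left_mono order_trans[OF h_bound] add_left_mono powr_diff_le prod_nonneg)
           (auto simp: w_nonneg)
      also have "\<dots> = (\<bar>\<sigma> (x i) * w (x i)\<bar> * (1 + \<bar>x i\<bar>) ^ r) * (h ?u * (\<Prod>k\<in>J. w (x k) * (1 + \<bar>x k\<bar>) ^ r'))
            + (\<bar>\<sigma> (x i) * w (x i)\<bar> * (1 + \<bar>x i\<bar>) ^ (r + m)) *
              ((1 + \<bar>x j\<bar>) ^ m * (\<Prod>k\<in>J. w (x k) * (1 + \<bar>x k\<bar>) ^ r'))"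
        by (simp add: algebra_simps power_add)
      also have "\<dots> \<le> K * (h ?u * (\<Prod>k\<in>J. q (x k)))
            + (\<bar>\<sigma> (x i) * w (x i)\<bar> * (1 + \<bar>x i\<bar>) ^ (r + m)) * (\<Prod>k\<in>J. q (x k))"
      proof (intro add_mono mult_mono K order_refl)
        show *: "(\<Prod>k\<in>J. w (x k) * (1 + \<bar>x k\<bar>) ^ r') \<le> (\<Prod>k\<in>J. q (x k))"
          unfolding q_def by (intro prod_mono conjI mult_left_mono power_increasing) (auto simp: w_nonneg)
        have "(1 + \<bar>x j\<bar>) ^ m * (\<Prod>k\<in>J. w (x k) * (1 + \<bar>x k\<bar>) ^ r')
            \<le> (\<Prod>k\<in>J. (1 + \<bar>x k\<bar>) ^ m) * (\<Prod>k\<in>J. w (x k) * (1 + \<bar>x k\<bar>) ^ r')"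
        proof (rule mult_right_mono)
          show "(1 + \<bar>x j\<bar>) ^ m \<le> (\<Prod>k\<in>J. (1 + \<bar>x k\<bar>) ^ m)"
            using prod_mono2[of J "{j}" "\<lambda>k. (1 + \<bar>x k\<bar>) ^ m"] J by auto
        qed (simp add: prod_nonneg w_nonneg)
        also have "\<dots> = (\<Prod>k\<in>J. q (x k))"
          by (simp add: q_def prod.distrib power_add mult_ac)
        finally show "(1 + \<bar>x j\<bar>) ^ m * (\<Prod>k\<in>J. w (x k) * (1 + \<bar>x k\<bar>) ^ r') \<le> (\<Prod>k\<in>J. q (x k))" .
      qed (auto simp: K0 h(2) w_nonneg prod_nonneg)
      also have "\<dots> = B x"
      proof -
        have "(\<Prod>k\<in>J. if k = i then \<bar>\<sigma> (x k) * w (x k)\<bar> * (1 + \<bar>x k\<bar>) ^ (r + m) else q (x k)) = (\<Prod>k\<in>J. q (x k))"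
          using J by (intro prod.cong) auto
        thus ?thesis using J by (simp add: B_def)
      qed
      finally show "norm (g x * (x i * (1 - c * x i) / ?u) * dens \<gamma> (insert i J) x) \<le> norm (B x)"
        by simp
    qed
  qed
qed

end

context selberg_weight
begin

text \<open>
  The mean of $\prod_{k \in A} x_k$, not normalised; it depends only on the cardinality of \<open>A\<close>.
\<close>

definition moment :: "real \<Rightarrow> 'i set \<Rightarrow> 'i set \<Rightarrow> real" where
  "moment \<gamma> I A = (LINT x|lborel_pow I. (\<Prod>k\<in>A. x k) * dens \<gamma> I x)"

lemma borel_measurable_prod_coords:
  "A \<subseteq> I \<Longrightarrow> (\<lambda>x. \<Prod>k\<in>A. x k) \<in> borel_measurable (lborel_pow I)"
  for I :: "'i set"
  by (intro borel_measurable_prod) auto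

lemma abs_prod_coords_le:
  fixes x :: "'i \<Rightarrow> real"
  assumes "finite I" "A \<subseteq> I"
  shows "\<bar>\<Prod>k\<in>A. x k\<bar> \<le> (\<Prod>k\<in>I. (1 + \<bar>x k\<bar>) ^ 1)"
proof -
  have "\<bar>\<Prod>k\<in>A. x k\<bar> \<le> (\<Prod>k\<in>A. 1 + \<bar>x k\<bar>)"
    unfolding abs_prod by (intro prod_mono) auto
  also have "\<dots> \<le> (\<Prod>k\<in>I. 1 + \<bar>x k\<bar>)"
    using assms by (intro prod_mono2) auto
  finally show ?thesis by simp
qed

lemma integrable_moment:
  assumes "finite I" "A \<subseteq> I" "0 \<le> \<gamma>"
  shows "integrable (lborel_pow I) (\<lambda>x. (\<Prod>k\<in>A. x k) * dens \<gamma> I x)"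
  using assms by (intro integrable_dens[where p = 1] borel_measurable_prod_coords abs_prod_coords_le)

lemma moment_swap:
  assumes "finite I" "A \<subseteq> I" "i \<in> A" "j \<in> I" "j \<notin> A"
  shows "moment \<gamma> I (insert j (A - {i})) = moment \<gamma> I A"
proof -
  let ?p = "Transposition.transpose i j"
  have p: "?p permutes I" using assms by (intro permutes_swap_id) auto
  have "moment \<gamma> I A = (LINT x|lborel_pow I. (\<Prod>k\<in>A. (x \<circ> ?p) k) * dens \<gamma> I (x \<circ> ?p))"
    unfolding moment_def
    by (subst integral_comp_permutes[OF \<open>finite I\<close> p, symmetric])
       (use assms in \<open>auto intro!: borel_measurable_times borel_measurable_prod_coords borel_measurable_dens\<close>)
  also have "\<dots> = moment \<gamma> I (insert j (A - {i}))"
    unfolding moment_def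
  proof (intro Bochner_Integration.integral_cong refl arg_cong2[where f = "(*)"])
    fix x :: "'a \<Rightarrow> real"
    have A: "A = insert i (A - {i})" "finite (A - {i})" "j \<notin> A - {i}" using assms finite_subset by auto
    have "(\<Prod>k\<in>A. (x \<circ> ?p) k) = x j * (\<Prod>k\<in>A - {i}. (x \<circ> ?p) k)"
      by (subst A(1), subst prod.insert) (use A in auto)
    also have "(\<Prod>k\<in>A - {i}. (x \<circ> ?p) k) = (\<Prod>k\<in>A - {i}. x k)"
      using assms by (intro prod.cong) (auto simp: Transposition.transpose_def)
    finally show "(\<Prod>k\<in>A. (x \<circ> ?p) k) = (\<Prod>k\<in>insert j (A - {i}). x k)" using A by simp
    show "dens \<gamma> I (x \<circ> ?p) = dens \<gamma> I x" by (rule dens_comp_permutes[OF p])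
  qed
  finally show ?thesis by simp
qed

lemma dens_insert:
  assumes "finite J" "i \<notin> J"
  shows "dens \<gamma> (insert i J) (x(i := y)) =
           w y * (\<Prod>j\<in>J. \<bar>y - x j\<bar> powr (2 * \<gamma>)) * dens \<gamma> J x"
proof -
  have "(\<Prod>j\<in>J. w ((x(i := y)) j)) = (\<Prod>j\<in>J. w (x j))"
       "(\<Prod>j\<in>J. \<bar>y - (x(i := y)) j\<bar> powr (2 * \<gamma>)) = (\<Prod>j\<in>J. \<bar>y - x j\<bar> powr (2 * \<gamma>))"
    using assms by (auto intro!: prod.cong)
  moreover have "vdm \<gamma> J (x(i := y)) = vdm \<gamma> J x"
    using assms unfolding vdm_def by (intro prod.cong refl) auto
  ultimately show ?thesis using assms unfolding dens_def vdm_insert[OF assms] by simp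
qed

text \<open>
  The integrand is the derivative of $\sigma(y) w(y) \prod_j |y - b_j|^{2\gamma}$, which vanishes
  at infinity.
\<close>

lemma integral_pearson_prod:
  fixes b :: "'i \<Rightarrow> real"
  assumes J: "finite J" and \<gamma>: "0 < \<gamma>"
  shows "(LINT y|lborel. ((a - d * y) + 2 * \<gamma> * (\<Sum>j\<in>J. y * (1 - c * y) / (y - b j))) *
            (w y * (\<Prod>j\<in>J. \<bar>y - b j\<bar> powr (2 * \<gamma>)))) = 0"
proof -
  obtain E where E: "finite E" "\<And>t. t \<notin> E \<Longrightarrow>
      ((\<lambda>t. t * (1 - c * t) * w t) has_real_derivative (a - d * t) * w t) (at t)"
    using pearson by blast
  define f where "f = (\<lambda>y. (y * (1 - c * y) * w y) * (\<Prod>j\<in>J. \<bar>y - b j\<bar> powr (2 * \<gamma>)))"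
  define m where "m = nat \<lceil>2 * \<gamma>\<rceil>"
  define C where "C = (\<Prod>j\<in>J. (1 + \<bar>b j\<bar>) ^ m)"
  obtain K where K: "\<And>t. \<bar>t * (1 - c * t) * w t\<bar> * (1 + \<bar>t\<bar>) ^ (m * card J + 1) \<le> K"
    using pearson_bounded by blast
  have f_le: "norm (f y) \<le> K * C / (1 + \<bar>y\<bar>)" for y
  proof -
    have "norm (f y) \<le> \<bar>y * (1 - c * y) * w y\<bar> * (\<Prod>j\<in>J. (1 + \<bar>y\<bar>) ^ m * (1 + \<bar>b j\<bar>) ^ m)"
      unfolding f_def norm_mult prod_norm[symmetric] m_def
      using \<gamma> by (intro mult_mono prod_mono conjI) (auto intro!: prod_nonneg powr_diff_le)
    also have "\<dots> = \<bar>y * (1 - c * y) * w y\<bar> * (1 + \<bar>y\<bar>) ^ (m * card J) * C"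
      by (simp add: prod.distrib C_def power_mult)
    also have "\<dots> = (\<bar>y * (1 - c * y) * w y\<bar> * (1 + \<bar>y\<bar>) ^ (m * card J + 1)) * C / (1 + \<bar>y\<bar>)"
      by simp
    also have "\<dots> \<le> K * C / (1 + \<bar>y\<bar>)"
      by (intro divide_right_mono mult_right_mono K) (auto simp: C_def prod_nonneg)
    finally show ?thesis .
  qed
  show ?thesis
  proof (rule integral_derivative_eq_0[where f = f and S = "E \<union> b ` J"])
    fix y assume y: "y \<notin> E \<union> b ` J"
    let ?p = "\<Prod>j\<in>J. \<bar>y - b j\<bar> powr (2 * \<gamma>)"
    have deriv: "(f has_real_derivative (a - d * y) * w y * ?p +
        ?p * (\<Sum>j\<in>J. 2 * \<gamma> / (y - b j)) * (y * (1 - c * y) * w y)) (at y)"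
      unfolding f_def using y J
      by (intro DERIV_mult E has_real_derivative_prod_log has_real_derivative_abs_powr) auto
    have sum: "(\<Sum>j\<in>J. 2 * \<gamma> / (y - b j)) * (y * (1 - c * y) * w y)
        = w y * (2 * \<gamma> * (\<Sum>j\<in>J. y * (1 - c * y) / (y - b j)))"
      by (simp add: sum_distrib_left sum_distrib_right mult_ac)
    have "A * w y * p + p * S * Q = (A + S') * (w y * p)" if "S * Q = w y * S'" for A p S Q S' :: real
      using that by (simp add: algebra_simps)
    from deriv[unfolded this[OF sum]] show "(f has_real_derivative ((a - d * y) + 2 * \<gamma> * (\<Sum>j\<in>J. y * (1 - c * y) / (y - b j))) *
            (w y * ?p)) (at y)" .
  next
    show "continuous_on UNIV f"
      unfolding f_def using \<gamma>
      by (intro continuous_on_mult pearson_continuous continuous_on_prod continuous_on_powr' continuous_intros) auto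
    have f_lim: "(f \<longlongrightarrow> 0) F" if "((\<lambda>y. K * C / (1 + \<bar>y\<bar>)) \<longlongrightarrow> 0) F" for F
      by (rule Lim_null_comparison[OF always_eventually that]) (use f_le in blast)
    show "(f \<longlongrightarrow> 0) at_top" by (rule f_lim) real_asymp
    show "(f \<longlongrightarrow> 0) at_bot" by (rule f_lim) real_asymp
  qed (use E J in auto)
qed

text \<open>
  Aomoto's recurrence.  The integral of $\partial_i (\sigma(x_i) \prod_{k \in A - \{i\}} x_k \cdot
  \mathrm{density})$ is zero.  Besides two moments the derivative contains the terms $T_j$ with
  $\sigma(x_i) / (x_i - x_j)$; the mean of such a term and of its image under the exchange of $x_i$ and
  $x_j$ has no singularity and is again a combination of moments.
\<close>

lemma moment_recurrence:
  assumes I: "finite I" and A: "A \<subseteq> I" and i: "i \<in> A" and \<gamma>: "0 < \<gamma>"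
  shows "(d + c * \<gamma> * (2 * real (card I) - real (card A) - 1)) * moment \<gamma> I A
       = (a + \<gamma> * (real (card I) - real (card A))) * moment \<gamma> I (A - {i})"
proof -
  interpret product_sigma_finite "\<lambda>_. lborel :: real measure" by (rule product_sigma_finite_lborel)
  define J where "J = I - {i}"
  have J: "finite J" "i \<notin> J" "I = insert i J" "A - {i} \<subseteq> J" using I A i by (auto simp: J_def)
  define P where "P = (\<lambda>x::'a \<Rightarrow> real. \<Prod>k\<in>A - {i}. x k)"
  define D where "D = (\<lambda>x. dens \<gamma> I x)"
  define s where "s = (\<lambda>t::real. t * (1 - c * t))"
  define T where "T = (\<lambda>j. LINT x|lborel_pow I. P x * (s (x i) / (x i - x j)) * D x)"
  have A': "A = insert i (A - {i})" "finite (A - {i})" using i I A finite_subset by auto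
  have P_i: "(\<Prod>k\<in>A. x k) = x i * P x" for x
    unfolding P_def by (subst A'(1), subst prod.insert) (use A' in auto)
  have meas: "(\<lambda>x. x k) \<in> borel_measurable (lborel_pow I)" if "k \<in> I" for k
    using that by simp
  note [measurable] = meas[OF subsetD[OF A i]]
  have P_meas [measurable]: "P \<in> borel_measurable (lborel_pow I)"
    unfolding P_def using A by (intro borel_measurable_prod_coords) auto
  have D_meas [measurable]: "D \<in> borel_measurable (lborel_pow I)"
    unfolding D_def by simp
  have int_P: "integrable (lborel_pow I) (\<lambda>x. P x * D x)"
    unfolding P_def D_def using I A \<gamma> by (intro integrable_moment) auto
  have int_xP: "integrable (lborel_pow I) (\<lambda>x. x i * P x * D x)"
    using integrable_moment[OF I A] \<gamma> unfolding D_def P_i by auto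
  have int_T: "integrable (lborel_pow I) (\<lambda>x. P x * (s (x i) / (x i - x j)) * D x)" if "j \<in> J" for j
  proof -
    have "\<bar>P x\<bar> \<le> (\<Prod>k\<in>insert i J. (1 + \<bar>x k\<bar>) ^ 1)" for x
      unfolding P_def using I A J(3) by (intro abs_prod_coords_le) auto
    thus ?thesis
      unfolding s_def D_def J(3) using J that \<gamma> P_meas
      by (intro integrable_dens_singular[where p = 1]) auto
  qed
  \<comment> \<open>the partial derivative, whose integral over each line in direction \<open>i\<close> vanishes\<close>
  define G where "G = (\<lambda>x. P x * ((a - d * x i) + 2 * \<gamma> * (\<Sum>j\<in>J. s (x i) / (x i - x j))) * D x)"
  have G_eq: "G = (\<lambda>x. a * (P x * D x) - d * (x i * P x * D x) + 2 * \<gamma> * (\<Sum>j\<in>J. P x * (s (x i) / (x i - x j)) * D x))"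
    by (simp add: G_def fun_eq_iff algebra_simps sum_distrib_left sum_distrib_right)
  have int_G: "integrable (lborel_pow I) G"
    unfolding G_eq using int_P int_xP int_T
    by (intro Bochner_Integration.integrable_add Bochner_Integration.integrable_diff
          integrable_mult_right Bochner_Integration.integrable_sum) auto
  have "integral\<^sup>L (lborel_pow I) G = a * moment \<gamma> I (A - {i}) - d * moment \<gamma> I A + 2 * \<gamma> * (\<Sum>j\<in>J. T j)"
    unfolding G_eq moment_def T_def P_i
    using int_P int_xP int_T
    by (subst Bochner_Integration.integral_add Bochner_Integration.integral_diff;
        (intro Bochner_Integration.integrable_diff integrable_mult_right Bochner_Integration.integrable_sum)?;
        simp add: P_def D_def Bochner_Integration.integral_sum)
  moreover have "integral\<^sup>L (lborel_pow I) G = 0"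
  proof -
    have "integral\<^sup>L (lborel_pow I) G = (LINT x|lborel_pow J. LINT y|lborel. G (x(i := y)))"
      unfolding J(3) using int_G J by (intro product_integral_insert) auto
    also have "\<dots> = (LINT x|lborel_pow J. 0)"
    proof (intro Bochner_Integration.integral_cong refl)
      fix x :: "'a \<Rightarrow> real"
      have G_y: "G (x(i := y)) = P x * dens \<gamma> J x *
          (((a - d * y) + 2 * \<gamma> * (\<Sum>j\<in>J. y * (1 - c * y) / (y - x j))) *
            (w y * (\<Prod>j\<in>J. \<bar>y - x j\<bar> powr (2 * \<gamma>))))" for y
      proof -
        have "P (x(i := y)) = P x" unfolding P_def by (intro prod.cong) auto
        moreover have "(\<Sum>j\<in>J. s ((x(i := y)) i) / ((x(i := y)) i - (x(i := y)) j)) = (\<Sum>j\<in>J. y * (1 - c * y) / (y - x j))"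
          using J(2) unfolding s_def by (intro sum.cong) auto
        ultimately show ?thesis
          unfolding G_def D_def using dens_insert[OF J(1,2), of \<gamma> x y] J(3) by simp
      qed
      show "(LINT y|lborel. G (x(i := y))) = 0"
        unfolding G_y using integral_pearson_prod[OF J(1) \<gamma>, of x] by simp
    qed
    finally show ?thesis by simp
  qed
  ultimately have ibp: "a * moment \<gamma> I (A - {i}) - d * moment \<gamma> I A + 2 * \<gamma> * (\<Sum>j\<in>J. T j) = 0"
    by simp
  \<comment> \<open>the mean over the exchange of \<open>x i\<close> and \<open>x j\<close>\<close>
  have T: "2 * T j = (if j \<in> A then - c * moment \<gamma> I A
                      else moment \<gamma> I (A - {i}) - 2 * c * moment \<gamma> I A)" if j: "j \<in> J" for j
  proof -
    let ?p = "Transposition.transpose i j"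
    have ij: "i \<in> I" "j \<in> I" "i \<noteq> j" using j J by auto
    note [measurable] = meas[OF ij(2)]
    have p: "?p permutes I" using ij by (intro permutes_swap_id) auto
    have f_meas: "(\<lambda>x. P x * (s (x i) / (x i - x j)) * D x) \<in> borel_measurable (lborel_pow I)"
      unfolding s_def by measurable
    have D_p: "D (x \<circ> ?p) = D x" for x unfolding D_def by (rule dens_comp_permutes[OF p])
    have swap: "T j = (LINT x|lborel_pow I. P (x \<circ> ?p) * (s (x j) / (x j - x i)) * D x)"
      unfolding T_def by (subst integral_comp_permutes[OF I p f_meas, symmetric]) (simp add: D_p)
    have int_swap: "integrable (lborel_pow I) (\<lambda>x. P (x \<circ> ?p) * (s (x j) / (x j - x i)) * D x)"
      using integrable_comp_permutes[OF I p f_meas] int_T[OF j] by (simp add: D_p)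
    have "2 * T j = (LINT x|lborel_pow I. P x * (s (x i) / (x i - x j)) * D x)
         + (LINT x|lborel_pow I. P (x \<circ> ?p) * (s (x j) / (x j - x i)) * D x)"
      using swap unfolding T_def by simp
    also have "\<dots> = (LINT x|lborel_pow I. P x * (s (x i) / (x i - x j)) * D x
         + P (x \<circ> ?p) * (s (x j) / (x j - x i)) * D x)"
      using int_T[OF j] int_swap by simp
    also have "\<dots> = (LINT x|lborel_pow I. (P x * s (x i) - P (x \<circ> ?p) * s (x j)) / (x i - x j) * D x)"
    proof (intro Bochner_Integration.integral_cong refl)
      fix x :: "'a \<Rightarrow> real"
      have "P x * (s (x i) / (x i - x j)) + P (x \<circ> ?p) * (s (x j) / (x j - x i))
          = (P x * s (x i) - P (x \<circ> ?p) * s (x j)) / (x i - x j)"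
        by (simp add: diff_divide_distrib) (metis minus_diff_eq minus_divide_right)
      thus "P x * (s (x i) / (x i - x j)) * D x + P (x \<circ> ?p) * (s (x j) / (x j - x i)) * D x
          = (P x * s (x i) - P (x \<circ> ?p) * s (x j)) / (x i - x j) * D x"
        by (metis distrib_right)
    qed
    also have "\<dots> = (LINT x|lborel_pow I. (if j \<in> A then - c * (x i * P x)
         else P x - c * (x i * P x) - c * (\<Prod>k\<in>insert j (A - {i}). x k)) * D x)"
    proof (intro Bochner_Integration.integral_cong refl)
      fix x :: "'a \<Rightarrow> real"
      show "(P x * s (x i) - P (x \<circ> ?p) * s (x j)) / (x i - x j) * D x
          = (if j \<in> A then - c * (x i * P x)
             else P x - c * (x i * P x) - c * (\<Prod>k\<in>insert j (A - {i}). x k)) * D x"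
      proof (cases "x i = x j")
        case True
        hence "D x = 0"
          unfolding D_def dens_def using vdm_eq_0[OF I ij, of x \<gamma>] by simp
        thus ?thesis by simp
      next
        case ne: False
        show ?thesis
        proof (cases "j \<in> A")
          case True
          define Q where "Q = (\<Prod>k\<in>A - {i} - {j}. x k)"
          have P1: "P x = x j * Q"
            unfolding P_def Q_def using A' True ij by (subst prod.remove[of _ j]) auto
          have "P (x \<circ> ?p) = x i * (\<Prod>k\<in>A - {i} - {j}. (x \<circ> ?p) k)"
            unfolding P_def using A' True ij by (subst prod.remove[of _ j]) auto
          also have "(\<Prod>k\<in>A - {i} - {j}. (x \<circ> ?p) k) = Q"
            unfolding Q_def by (intro prod.cong) (auto simp: Transposition.transpose_def)
          finally have P2: "P (x \<circ> ?p) = x i * Q" .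
          have "P x * s (x i) - P (x \<circ> ?p) * s (x j) = (x i - x j) * (- c * (x i * P x))"
            unfolding P1 P2 s_def by (simp add: algebra_simps)
          thus ?thesis using ne True by simp
        next
          case False
          have "P (x \<circ> ?p) = P x"
            unfolding P_def using False by (intro prod.cong) (auto simp: Transposition.transpose_def)
          moreover have "(\<Prod>k\<in>insert j (A - {i}). x k) = x j * P x"
            using A' False by (simp add: P_def)
          ultimately have "P x * s (x i) - P (x \<circ> ?p) * s (x j)
              = (x i - x j) * (P x - c * (x i * P x) - c * (\<Prod>k\<in>insert j (A - {i}). x k))"
            unfolding s_def by (simp add: algebra_simps)
          thus ?thesis using ne False by simp
        qed
      qed
    qed
    also have "\<dots> = (if j \<in> A then - c * moment \<gamma> I A
                      else moment \<gamma> I (A - {i}) - 2 * c * moment \<gamma> I A)"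
    proof (cases "j \<in> A")
      case True
      thus ?thesis unfolding moment_def P_i D_def by (simp add: mult.assoc)
    next
      case False
      let ?B = "insert j (A - {i})"
      have B: "?B \<subseteq> I" using A ij by auto
      have int_B: "integrable (lborel_pow I) (\<lambda>x. (\<Prod>k\<in>?B. x k) * D x)"
        unfolding D_def using I B \<gamma> by (intro integrable_moment) auto
      have "(LINT x|lborel_pow I. (P x - c * (x i * P x) - c * (\<Prod>k\<in>?B. x k)) * D x)
          = (LINT x|lborel_pow I. P x * D x - c * (x i * P x * D x) - c * ((\<Prod>k\<in>?B. x k) * D x))"
        by (simp add: algebra_simps)
      also have "\<dots> = (LINT x|lborel_pow I. P x * D x) - c * (LINT x|lborel_pow I. x i * P x * D x)
          - c * (LINT x|lborel_pow I. (\<Prod>k\<in>?B. x k) * D x)"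
        using int_P int_xP int_B
        by (subst Bochner_Integration.integral_diff;
            (intro Bochner_Integration.integrable_diff integrable_mult_right)?; simp)
      also have "\<dots> = moment \<gamma> I (A - {i}) - c * moment \<gamma> I A - c * moment \<gamma> I ?B"
        unfolding moment_def P_i D_def P_def by simp
      also have "moment \<gamma> I ?B = moment \<gamma> I A"
        using I A i ij False by (intro moment_swap) auto
      finally show ?thesis using False by simp
    qed
    finally show ?thesis .
  qed
  define C where "C = moment \<gamma> I A"
  define C' where "C' = moment \<gamma> I (A - {i})"
  have cards: "real (card (A - {i})) = real (card A) - 1" "real (card (I - A)) = real (card I) - real (card A)"
  proof -
    have "card A > 0" using i A I finite_subset by (auto simp: card_gt_0_iff)
    thus "real (card (A - {i})) = real (card A) - 1" using i by (simp add: card_Diff_singleton of_nat_diff)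
    show "real (card (I - A)) = real (card I) - real (card A)"
      using I A by (subst card_Diff_subset) (auto simp: finite_subset of_nat_diff card_mono)
  qed
  have "2 * (\<Sum>j\<in>J. T j) = (\<Sum>j\<in>J. if j \<in> A then - c * C else C' - 2 * c * C)"
    unfolding sum_distrib_left C_def C'_def by (intro sum.cong T refl)
  also have "\<dots> = (\<Sum>j\<in>A - {i}. - c * C) + (\<Sum>j\<in>I - A. C' - 2 * c * C)"
  proof -
    have "J \<inter> {j. j \<in> A} = A - {i}" "J \<inter> - {j. j \<in> A} = I - A" using A i by (auto simp: J_def)
    thus ?thesis using J(1) by (subst sum.If_cases) auto
  qed
  also have "\<dots> = - (real (card A) - 1) * (c * C) + (real (card I) - real (card A)) * (C' - 2 * c * C)"
    by (simp add: cards algebra_simps)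
  finally have sumT: "2 * (\<Sum>j\<in>J. T j) = \<dots>" .
  have "a * C' - d * C + \<gamma> * (2 * (\<Sum>j\<in>J. T j)) = 0"
    using ibp unfolding C_def C'_def by (simp add: algebra_simps)
  thus ?thesis
    unfolding sumT C_def[symmetric] C'_def[symmetric] by (simp add: algebra_simps)
qed

end

context selberg_weight
begin

text \<open>
  The coordinates are added to the product one at a time.
\<close>

lemma moment_full:
  fixes I :: "'i set"
  assumes I: "finite I" and pos: "0 < \<gamma>" "0 < a" "0 < d" "0 \<le> c"
  shows "moment \<gamma> I I = (\<Prod>k<card I. (a + \<gamma> * real k) / (d + c * \<gamma> * (real (card I) - 1 + real k))) * moment \<gamma> I {}"
proof -
  define n where "n = card I"
  define q where "q = (\<lambda>k. (a + \<gamma> * real k) / (d + c * \<gamma> * (real n - 1 + real k)))"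
  have "moment \<gamma> I A = (\<Prod>k<card A. q (n - Suc k)) * moment \<gamma> I {}" if "finite A" "A \<subseteq> I" for A
    using that
  proof (induction A rule: finite_induct)
    case (insert i A)
    have card: "card (insert i A) \<le> n" using insert I unfolding n_def by (intro card_mono) auto
    hence lt: "card A < n" using insert by simp
    have nz: "0 < d + c * \<gamma> * (real n - 1 + real (n - Suc (card A)))"
      using pos lt by (intro add_pos_nonneg mult_nonneg_nonneg) auto
    have "(d + c * \<gamma> * (2 * real n - real (card (insert i A)) - 1)) * moment \<gamma> I (insert i A)
        = (a + \<gamma> * (real n - real (card (insert i A)))) * moment \<gamma> I (insert i A - {i})"
      unfolding n_def using insert pos I by (intro moment_recurrence) auto
    moreover have "d + c * \<gamma> * (2 * real n - real (card (insert i A)) - 1) = d + c * \<gamma> * (real n - 1 + real (n - Suc (card A)))"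
      "a + \<gamma> * (real n - real (card (insert i A))) = a + \<gamma> * real (n - Suc (card A))"
      using insert lt by (auto simp: of_nat_diff)
    moreover have "insert i A - {i} = A" using insert by auto
    moreover have "m' = y / x * m" if "x * m' = y * m" "0 < x" for x y m m' :: real
      using that by (simp add: field_simps)
    ultimately have "moment \<gamma> I (insert i A) = q (n - Suc (card A)) * moment \<gamma> I A"
      using nz unfolding q_def by metis
    thus ?case using insert by simp
  qed simp
  from this[OF I order_refl] have "moment \<gamma> I I = (\<Prod>k<n. q k) * moment \<gamma> I {}"
    using prod.nat_diff_reindex[of q n] by (simp add: n_def[symmetric])
  thus ?thesis unfolding q_def n_def .
qed

text \<open>
  The density is positive on a product of disjoint intervals, a set of positive measure.
\<close>

lemma moment_empty_pos:
  fixes I :: "nat set"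
  assumes I: "finite I" and \<gamma>: "0 < \<gamma>" and r: "0 < r" "\<And>t. 0 < t \<Longrightarrow> t < r \<Longrightarrow> 0 < w t"
  shows "0 < moment \<gamma> I {}"
proof -
  interpret product_sigma_finite "\<lambda>_. lborel :: real measure" by (rule product_sigma_finite_lborel)
  have int: "integrable (lborel_pow I) (dens \<gamma> I)"
    using integrable_moment[OF I, of "{}" \<gamma>] \<gamma> by simp
  have eq: "moment \<gamma> I {} = integral\<^sup>L (lborel_pow I) (dens \<gamma> I)" by (simp add: moment_def)
  have "0 \<le> moment \<gamma> I {}" unfolding eq by (intro integral_nonneg_AE) (simp add: dens_nonneg)
  moreover have "moment \<gamma> I {} \<noteq> 0"
  proof
    assume "moment \<gamma> I {} = 0"
    hence AE: "AE x in lborel_pow I. dens \<gamma> I x = 0"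
      unfolding eq using int by (subst (asm) integral_nonneg_eq_0_iff_AE) (auto simp: dens_nonneg)
    \<comment> \<open>coordinate \<open>k\<close> is confined to the interval with index \<open>k\<close> of an equidistant partition of \<open>(0, r)\<close>\<close>
    define N where "N = real (Max I) + 1"
    define A where "A = (\<lambda>k::nat. {r * real k / N <..< r * (real k + 1) / N})"
    have N: "0 < N" "real k + 1 \<le> N" if "k \<in> I" for k
      using that I by (auto simp: N_def)
    define B where "B = Pi\<^sub>E I A"
    have B_sets: "B \<in> sets (lborel_pow I)"
      unfolding B_def by (intro sets_PiM_I_finite I) (simp add: A_def)
    have dens_pos: "dens \<gamma> I x > 0" if x: "x \<in> B" for x
    proof -
      have xk: "r * real k / N < x k" "x k < r * (real k + 1) / N" if "k \<in> I" for k
        using x that by (auto simp: B_def A_def PiE_iff)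
      have "0 < w (x k)" if k: "k \<in> I" for k
      proof (rule r(2))
        have "0 \<le> r * real k / N" using r N[OF k] by simp
        also note xk(1)[OF k] finally show "0 < x k" .
        note xk(2)[OF k]
        also have "r * (real k + 1) / N \<le> r"
          using r N[OF k] mult_left_mono[of "real k + 1" N r] by (simp add: pos_divide_le_eq)
        finally show "x k < r" .
      qed
      moreover have less: "x i < x j" if "i \<in> I" "j \<in> I" "i < j" for i j
      proof -
        have "x i < r * (real i + 1) / N" by (rule xk) fact
        also have "\<dots> \<le> r * real j / N" using that r N[of i] by (intro divide_right_mono mult_left_mono) auto
        also have "\<dots> < x j" by (rule xk) fact
        finally show ?thesis .
      qed
      have "0 < \<bar>x i - x j\<bar> powr \<gamma>" if "i \<in> I" "j \<in> I - {i}" for i j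
        using less[of i j] less[of j i] that by (cases i j rule: linorder_cases) auto
      ultimately show ?thesis unfolding dens_def vdm_def by (intro mult_pos_pos prod_pos) auto
    qed
    from AE have "AE x in lborel_pow I. x \<notin> B" by eventually_elim (use dens_pos in force)
    hence "emeasure (lborel_pow I) B = 0"
    proof -
      have "{x \<in> space (lborel_pow I). \<not> x \<notin> B} = B" using sets.sets_into_space[OF B_sets] by auto
      thus ?thesis
        using \<open>AE x in lborel_pow I. x \<notin> B\<close> AE_iff_measurable[OF B_sets, of "\<lambda>x. x \<notin> B"] by simp
    qed
    moreover have "emeasure (lborel_pow I) B = (\<Prod>k\<in>I. emeasure lborel (A k))"
      unfolding B_def by (intro emeasure_PiM I) (simp add: A_def)
    ultimately obtain k where k: "k \<in> I" "emeasure lborel (A k) = 0" using I by (auto simp: prod_zero_iff)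
    have "r * real k / N < r * (real k + 1) / N" using r N[OF k(1)] by (intro divide_strict_right_mono) auto
    thus False using k(2) r N[OF k(1)] by (simp add: A_def)
  qed
  ultimately show ?thesis by simp
qed

end


section \<open>A uniqueness theorem of Bohr-Mollerup type\<close>

text \<open>
  The growth condition of the Bohr-Mollerup theorem in its asymptotic form, for a general
  factor \<open>R\<close> in the functional equation.  In contrast to log-convexity it is preserved by
  quotients.
\<close>

definition gamma_like :: "(real \<Rightarrow> real) \<Rightarrow> (real \<Rightarrow> real) \<Rightarrow> bool" where
  "gamma_like f R \<longleftrightarrow> (\<forall>a>0. 0 < f a \<and> 0 < R a \<and> f (a + 1) = R a * f a \<and>
     (\<forall>x\<in>{0..1}. (\<lambda>N. f (a + real N + x) / (f (a + real N) * R (a + real N) powr x)) \<longlonglongrightarrow> 1))"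

text \<open>
  The quotient \<open>f / g\<close> has period 1, and by the growth condition its values at \<open>a\<close> and \<open>a + x\<close> agree
  in the limit of many periods.
\<close>

lemma gamma_like_unique:
  assumes f: "gamma_like f R" and g: "gamma_like g R" and ab: "0 < a" "0 < b"
  shows "f a / g a = f b / g b"
proof -
  have le: "f a / g a = f b / g b" if "0 < a" "a \<le> b" for a b
  proof -
    define h where "h = (\<lambda>a. f a / g a)"
    have h_Suc: "h (a + 1) = h a" if "0 < a" for a
    proof -
      have "0 < R a" "f (a + 1) = R a * f a" "g (a + 1) = R a * g a"
        using f g that by (auto simp: gamma_like_def)
      thus ?thesis by (simp add: h_def)
    qed
    have h_N: "h (a + real N) = h a" if "0 < a" for a N
    proof (induction N)
      case (Suc N)
      have "h (a + real N + 1) = h (a + real N)" using that by (intro h_Suc) auto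
      thus ?case using Suc by (simp add: add_ac)
    qed simp
    define x where "x = frac (b - a)"
    define n where "n = nat \<lfloor>b - a\<rfloor>"
    have x: "0 \<le> x" "x \<le> 1" and b: "b = (a + x) + real n"
      using that frac_lt_1[of "b - a"] by (auto simp: x_def n_def frac_def)
    have "(\<lambda>N. (f (a + real N + x) / (f (a + real N) * R (a + real N) powr x)) /
               (g (a + real N + x) / (g (a + real N) * R (a + real N) powr x))) \<longlonglongrightarrow> 1 / 1"
      using f g that x by (intro tendsto_divide) (auto simp: gamma_like_def)
    moreover have "(f (a + real N + x) / (f (a + real N) * R (a + real N) powr x)) /
               (g (a + real N + x) / (g (a + real N) * R (a + real N) powr x)) = h (a + x) / h a" for N
    proof -
      have "R (a + real N) > 0" "f (a + real N) > 0" "g (a + real N) > 0" "g (a + real N + x) > 0"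
        using f g that x unfolding gamma_like_def by (auto simp: add_pos_nonneg)
      hence "(f (a + real N + x) / (f (a + real N) * R (a + real N) powr x)) /
               (g (a + real N + x) / (g (a + real N) * R (a + real N) powr x))
          = h (a + x + real N) / h (a + real N)"
        by (simp add: h_def field_simps add_ac)
      also have "\<dots> = h (a + x) / h a" using that x by (simp add: h_N)
      finally show ?thesis .
    qed
    ultimately have "(\<lambda>_::nat. h (a + x) / h a) \<longlonglongrightarrow> 1" by simp
    hence "h (a + x) / h a = 1" by (simp add: LIMSEQ_const_iff)
    hence "h (a + x) = h a" by (cases "h a = 0") auto
    thus ?thesis using h_N[of "a + x" n] b that x by (simp add: h_def)
  qed
  show ?thesis
  proof (cases "a \<le> b")
    case True thus ?thesis using le ab by simp
  next
    case False thus ?thesis using le[of b a] ab by simp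
  qed
qed

text \<open>
  One inequality suffices: its instance at \<open>a + x\<close> with step \<open>1 - x\<close> bounds \<open>f (a + 1)\<close>, which
  is \<open>R a * f a\<close>, and so bounds \<open>f (a + x)\<close> from below.
\<close>

lemma gamma_likeI:
  assumes pos: "\<And>a. 0 < a \<Longrightarrow> 0 < f a" "\<And>a. 0 < a \<Longrightarrow> 0 < R a"
    and rec: "\<And>a. 0 < a \<Longrightarrow> f (a + 1) = R a * f a"
    and le: "\<And>a x. 0 < a \<Longrightarrow> 0 \<le> x \<Longrightarrow> x \<le> 1 \<Longrightarrow> f (a + x) \<le> R a powr x * f a"
    and lim: "\<And>x. 0 \<le> x \<Longrightarrow> x \<le> 1 \<Longrightarrow> ((\<lambda>a. R (a + x) / R a) \<longlongrightarrow> 1) at_top"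
  shows "gamma_like f R"
  unfolding gamma_like_def
proof (intro allI impI conjI ballI pos rec)
  fix a x :: real assume a: "0 < a" and x: "x \<in> {0..1}"
  have limN: "filterlim (\<lambda>N. a + real N) at_top sequentially"
    by (intro filterlim_tendsto_add_at_top[OF tendsto_const] filterlim_real_sequentially)
  show "(\<lambda>N. f (a + real N + x) / (f (a + real N) * R (a + real N) powr x)) \<longlonglongrightarrow> 1"
  proof (rule tendsto_sandwich[OF always_eventually always_eventually])
    show "\<forall>N. (R (a + real N + x) / R (a + real N)) powr (x - 1)
        \<le> f (a + real N + x) / (f (a + real N) * R (a + real N) powr x)"
    proof
      fix N
      define y where "y = a + real N"
      have y: "0 < y" "0 < y + x" using a x by (auto simp: y_def add_pos_nonneg)
      note p = pos(1)[OF y(1)] pos(1)[OF y(2)] pos(2)[OF y(1)] pos(2)[OF y(2)]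
      have "R y * f y = f ((y + x) + (1 - x))" using rec[OF y(1)] by simp
      also have "\<dots> \<le> R (y + x) powr (1 - x) * f (y + x)" using y x by (intro le) auto
      finally have "R y * f y \<le> R (y + x) powr (1 - x) * f (y + x)" .
      hence "R (y + x) powr (x - 1) * (R y * f y) \<le> R (y + x) powr (x - 1) * (R (y + x) powr (1 - x) * f (y + x))"
        by (intro mult_left_mono) auto
      also have "\<dots> = f (y + x)" using p by (simp add: mult.assoc[symmetric] powr_add[symmetric])
      finally have "R (y + x) powr (x - 1) * (R y * f y) / (f y * R y powr x) \<le> f (y + x) / (f y * R y powr x)"
        using p by (intro divide_right_mono) auto
      also have "R (y + x) powr (x - 1) * (R y * f y) / (f y * R y powr x) = (R (y + x) / R y) powr (x - 1)"
        using p by (simp add: powr_divide powr_diff field_simps)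
      finally show "(R (y + x) / R y) powr (x - 1) \<le> f (y + x) / (f y * R y powr x)" .
    qed
    show "\<forall>N. f (a + real N + x) / (f (a + real N) * R (a + real N) powr x) \<le> 1"
    proof
      fix N
      have y: "0 < a + real N" using a by simp
      show "f (a + real N + x) / (f (a + real N) * R (a + real N) powr x) \<le> 1"
        using le[OF y, of x] pos[OF y] x by (simp add: mult.commute)
    qed
    have "(\<lambda>N. (R (a + real N + x) / R (a + real N)) powr (x - 1)) \<longlonglongrightarrow> 1 powr (x - 1)"
      by (intro tendsto_powr tendsto_const filterlim_compose[OF lim limN]) (use x in auto)
    thus "(\<lambda>N. (R (a + real N + x) / R (a + real N)) powr (x - 1)) \<longlonglongrightarrow> 1" by simp
  qed auto
qed

lemma gamma_like_mult:
  assumes "gamma_like f R" "gamma_like g S"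
  shows "gamma_like (\<lambda>a. f a * g a) (\<lambda>a. R a * S a)"
  unfolding gamma_like_def
proof (intro allI impI conjI ballI)
  fix a x :: real assume a: "0 < a" and x: "x \<in> {0..1}"
  have "(\<lambda>N. (f (a + real N + x) / (f (a + real N) * R (a + real N) powr x)) *
     (g (a + real N + x) / (g (a + real N) * S (a + real N) powr x))) \<longlonglongrightarrow> 1 * 1"
    using assms a x by (intro tendsto_mult) (auto simp: gamma_like_def)
  moreover have eq: "(f (a + real N + x) / (f (a + real N) * R (a + real N) powr x)) *
     (g (a + real N + x) / (g (a + real N) * S (a + real N) powr x))
     = f (a + real N + x) * g (a + real N + x) /
       (f (a + real N) * g (a + real N) * (R (a + real N) * S (a + real N)) powr x)" for N
  proof -
    have "0 < R (a + real N)" "0 < S (a + real N)" using assms a by (auto simp: gamma_like_def)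
    thus ?thesis by (simp add: powr_mult mult_ac)
  qed
  ultimately show "(\<lambda>N. f (a + real N + x) * g (a + real N + x) /
       (f (a + real N) * g (a + real N) * (R (a + real N) * S (a + real N)) powr x)) \<longlonglongrightarrow> 1"
    unfolding eq by simp
qed (use assms in \<open>auto simp: gamma_like_def\<close>)

lemma gamma_like_inverse:
  assumes "gamma_like f R"
  shows "gamma_like (\<lambda>a. inverse (f a)) (\<lambda>a. inverse (R a))"
  unfolding gamma_like_def
proof (intro allI impI conjI ballI)
  fix a x :: real assume a: "0 < a" and x: "x \<in> {0..1}"
  have "(\<lambda>N. inverse (f (a + real N + x) / (f (a + real N) * R (a + real N) powr x))) \<longlonglongrightarrow> inverse 1"
    using assms a x by (intro tendsto_inverse) (auto simp: gamma_like_def)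
  moreover have eq: "inverse (f (a + real N + x) / (f (a + real N) * R (a + real N) powr x))
     = inverse (f (a + real N + x)) / (inverse (f (a + real N)) * inverse (R (a + real N)) powr x)" for N
  proof -
    have "0 < R (a + real N)" using assms a by (auto simp: gamma_like_def)
    hence "inverse (R (a + real N)) powr x = inverse (R (a + real N) powr x)"
      by (simp add: inverse_eq_divide powr_divide)
    thus ?thesis by (simp add: divide_inverse mult_ac)
  qed
  ultimately show "(\<lambda>N. inverse (f (a + real N + x)) / (inverse (f (a + real N)) * inverse (R (a + real N)) powr x)) \<longlonglongrightarrow> 1"
    unfolding eq by simp
qed (use assms in \<open>auto simp: gamma_like_def field_simps\<close>)

lemma gamma_like_one: "gamma_like (\<lambda>_. 1) (\<lambda>_. 1)"
  by (simp add: gamma_like_def)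

lemma gamma_like_powr: "0 < b \<Longrightarrow> gamma_like (\<lambda>a. b powr a) (\<lambda>_. b)"
  by (simp add: gamma_like_def powr_add)

lemma gamma_like_prod:
  assumes "finite K" "\<And>k. k \<in> K \<Longrightarrow> gamma_like (f k) (R k)"
  shows "gamma_like (\<lambda>a. \<Prod>k\<in>K. f k a) (\<lambda>a. \<Prod>k\<in>K. R k a)"
  using assms by (induction K rule: finite_induct) (auto simp: gamma_like_one gamma_like_mult)

lemma gamma_like_Gamma:
  assumes s: "0 \<le> s"
  shows "gamma_like (\<lambda>a. Gamma (a + s)) (\<lambda>a. a + s)"
proof (rule gamma_likeI)
  fix a :: real assume a: "0 < a"
  show "0 < Gamma (a + s)" "0 < a + s" using a s by auto
  have "Gamma ((a + s) + 1) = (a + s) * Gamma (a + s)"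
    using a s by (intro Gamma_plus1) (auto elim!: nonpos_Ints_cases)
  thus rec: "Gamma (a + 1 + s) = (a + s) * Gamma (a + s)" by (simp add: add_ac)
  fix x :: real assume x: "0 \<le> x" "x \<le> 1"
  define y where "y = a + s"
  have y: "0 < y" using a s by (simp add: y_def)
  have G1: "Gamma (y + 1) = y * Gamma y" using rec by (simp add: y_def add_ac)
  have "(ln \<circ> Gamma) ((1 - x) *\<^sub>R y + x *\<^sub>R (y + 1)) \<le> (1 - x) * (ln \<circ> Gamma) y + x * (ln \<circ> Gamma) (y + 1)"
    using y x by (intro convex_onD[OF log_convex_Gamma_real]) auto
  moreover have "(1 - x) *\<^sub>R y + x *\<^sub>R (y + 1) = y + x" by (simp add: algebra_simps)
  ultimately have "ln (Gamma (y + x)) \<le> (1 - x) * ln (Gamma y) + x * ln (Gamma (y + 1))" by simp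
  also have "ln (Gamma (y + 1)) = ln y + ln (Gamma y)" unfolding G1 using y Gamma_real_pos[OF y] ln_mult_pos[of y "Gamma y"] by blast
  finally have "ln (Gamma (y + x)) \<le> x * ln y + ln (Gamma y)" by (simp add: algebra_simps)
  also have "\<dots> = ln (y powr x * Gamma y)"
    using y Gamma_real_pos[OF y] ln_mult_pos[of "y powr x" "Gamma y"] by (simp add: ln_powr)
  finally have "Gamma (y + x) \<le> y powr x * Gamma y"
    using y x by (subst (asm) ln_le_cancel_iff) (auto intro!: mult_pos_pos)
  thus "Gamma (a + x + s) \<le> (a + s) powr x * Gamma (a + s)" by (simp add: y_def add_ac)
next
  fix x :: real
  show "((\<lambda>a. (a + x + s) / (a + s)) \<longlongrightarrow> 1) at_top" by real_asymp
qed


section \<open>The Selberg integral as a function of the exponent\<close>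

text \<open>
  The exponent \<open>a\<close> is separated from the rest \<open>v\<close> of the weight, since multiplication by a power of
  the determinant only shifts \<open>a\<close>.
\<close>

definition power_weight :: "(real \<Rightarrow> real) \<Rightarrow> real \<Rightarrow> real \<Rightarrow> real" where
  "power_weight v a t = (if 0 < t then t powr (a - 1) * v t else 0)"

locale selberg_family =
  fixes v :: "real \<Rightarrow> real" and d :: "real \<Rightarrow> real" and c r :: real
  assumes weight: "0 < a \<Longrightarrow> selberg_weight (power_weight v a) a (d a) c"
    and d_pos: "0 < a \<Longrightarrow> 0 < d a" and c_nonneg: "0 \<le> c"
    and v_pos: "0 < r" "\<And>t. 0 < t \<Longrightarrow> t < r \<Longrightarrow> 0 < v t"
begin

definition fdens :: "real \<Rightarrow> nat set \<Rightarrow> real \<Rightarrow> (nat \<Rightarrow> real) \<Rightarrow> real" where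
  "fdens \<gamma> I a x = (\<Prod>i\<in>I. power_weight v a (x i)) * vdm \<gamma> I x"

definition selberg_integral :: "real \<Rightarrow> nat set \<Rightarrow> real \<Rightarrow> real" where
  "selberg_integral \<gamma> I a = integral\<^sup>L (lborel_pow I) (fdens \<gamma> I a)"

text \<open>
  The factor in the functional equation of the Selberg integral.
\<close>

definition ratio :: "real \<Rightarrow> nat \<Rightarrow> real \<Rightarrow> real" where
  "ratio \<gamma> n a = (\<Prod>k<n. (a + \<gamma> * real k) / (d a + c * \<gamma> * (real n - 1 + real k)))"

lemma fdens_eq: "0 < a \<Longrightarrow> fdens \<gamma> I a = selberg_weight.dens (power_weight v a) \<gamma> I"
  by (simp add: fdens_def fun_eq_iff selberg_weight.dens_def[OF weight])

lemma fdens_eq_0: "finite I \<Longrightarrow> i \<in> I \<Longrightarrow> x i \<le> 0 \<Longrightarrow> fdens \<gamma> I a x = 0"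
  by (auto simp: fdens_def power_weight_def prod_zero_iff intro!: bexI[of _ i])

lemma fdens_nonneg: "0 < a \<Longrightarrow> 0 \<le> fdens \<gamma> I a x"
  using selberg_weight.dens_nonneg[OF weight] by (simp add: fdens_eq)

lemma borel_measurable_fdens: "0 < a \<Longrightarrow> fdens \<gamma> I a \<in> borel_measurable (lborel_pow I)"
  using selberg_weight.borel_measurable_dens[OF weight] by (simp add: fdens_eq)

lemma integrable_fdens:
  assumes "finite I" "0 < \<gamma>" "0 < a"
  shows "integrable (lborel_pow I) (fdens \<gamma> I a)"
  using selberg_weight.integrable_moment[OF weight[OF assms(3)] assms(1), of "{}" \<gamma>] assms
  by (simp add: fdens_eq)

lemma fdens_shift:
  assumes I: "finite I"
  shows "fdens \<gamma> I (a + x) y = (\<Prod>i\<in>I. y i) powr x * fdens \<gamma> I a y"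
proof (cases "\<forall>i\<in>I. 0 < y i")
  case True
  have "(\<Prod>i\<in>I. power_weight v (a + x) (y i)) = (\<Prod>i\<in>I. y i powr x * power_weight v a (y i))"
  proof (intro prod.cong refl)
    fix i assume "i \<in> I"
    hence "0 < y i" using True by blast
    hence "y i powr (a + x - 1) = y i powr x * y i powr (a - 1)"
      by (simp add: powr_add[symmetric] algebra_simps)
    thus "power_weight v (a + x) (y i) = y i powr x * power_weight v a (y i)"
      using \<open>0 < y i\<close> by (simp add: power_weight_def)
  qed
  also have "\<dots> = (\<Prod>i\<in>I. y i) powr x * (\<Prod>i\<in>I. power_weight v a (y i))"
    using True by (simp add: prod.distrib prod_powr_distrib less_imp_le)
  finally show ?thesis by (simp add: fdens_def)
next
  case False
  then obtain i where "i \<in> I" "y i \<le> 0" by fastforce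
  thus ?thesis using fdens_eq_0[OF I] by simp
qed

lemma selberg_integral_pos:
  assumes "finite I" "0 < \<gamma>" "0 < a"
  shows "0 < selberg_integral \<gamma> I a"
proof -
  interpret selberg_weight "power_weight v a" a "d a" c by (rule weight) fact
  have "0 < moment \<gamma> I {}"
    using assms v_pos by (intro moment_empty_pos[of _ _ r]) (auto simp: power_weight_def)
  thus ?thesis using assms by (simp add: moment_def selberg_integral_def fdens_eq)
qed

lemma selberg_integral_Suc:
  assumes "finite I" "0 < \<gamma>" "0 < a"
  shows "selberg_integral \<gamma> I (a + 1) = ratio \<gamma> (card I) a * selberg_integral \<gamma> I a"
proof -
  interpret selberg_weight "power_weight v a" a "d a" c by (rule weight) fact
  have "selberg_integral \<gamma> I (a + 1) = moment \<gamma> I I"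
    unfolding selberg_integral_def moment_def
  proof (intro Bochner_Integration.integral_cong refl)
    fix x :: "nat \<Rightarrow> real"
    show "fdens \<gamma> I (a + 1) x = (\<Prod>k\<in>I. x k) * dens \<gamma> I x"
    proof (cases "\<forall>i\<in>I. 0 < x i")
      case True
      thus ?thesis
        using fdens_shift[OF assms(1), of \<gamma> a 1 x] assms(3) by (simp add: prod_nonneg less_imp_le fdens_eq)
    next
      case False
      then obtain i where i: "i \<in> I" "x i \<le> 0" by fastforce
      thus ?thesis using fdens_eq_0[where x = x and i = i, OF assms(1) i, of \<gamma>] assms(3) by (simp add: fdens_eq[symmetric])
    qed
  qed
  also have "\<dots> = ratio \<gamma> (card I) a * moment \<gamma> I {}"
    unfolding ratio_def using assms d_pos c_nonneg by (intro moment_full) auto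
  also have "moment \<gamma> I {} = selberg_integral \<gamma> I a"
    using assms by (simp add: moment_def selberg_integral_def fdens_eq)
  finally show ?thesis .
qed

lemma ratio_pos:
  assumes "0 < \<gamma>" "0 < a"
  shows "0 < ratio \<gamma> n a"
  unfolding ratio_def
  using assms d_pos c_nonneg
  by (intro prod_pos divide_pos_pos add_pos_nonneg mult_nonneg_nonneg) auto

text \<open>
  The pointwise inequality $D^x \le R^x (1 - x + x D / R)$ for the determinant $D$ is integrated;
  with $R = S(a+1) / S(a)$ the right-hand side becomes $R^x S(a)$.
\<close>

lemma selberg_integral_le:
  assumes I: "finite I" and \<gamma>: "0 < \<gamma>" and a: "0 < a" and x: "0 \<le> x" "x \<le> 1"
  shows "selberg_integral \<gamma> I (a + x) \<le> ratio \<gamma> (card I) a powr x * selberg_integral \<gamma> I a"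
proof -
  define R where "R = ratio \<gamma> (card I) a"
  have R: "0 < R" unfolding R_def using \<gamma> a by (rule ratio_pos)
  have pw: "fdens \<gamma> I (a + x) y \<le> R powr x * ((1 - x) * fdens \<gamma> I a y + x / R * fdens \<gamma> I (a + 1) y)" for y
  proof (cases "\<forall>i\<in>I. 0 < y i")
    case True
    define D where "D = (\<Prod>i\<in>I. y i)"
    have D: "0 < D" unfolding D_def using True by (intro prod_pos) auto
    have "(D / R) powr x * 1 powr (1 - x) \<le> x * (D / R) + (1 - x) * 1"
      using x D R by (intro Youngs_inequality_0) auto
    hence "D powr x \<le> R powr x * ((1 - x) + x / R * D)"
      using D R by (simp add: powr_divide field_simps)
    hence "D powr x * fdens \<gamma> I a y \<le> R powr x * ((1 - x) + x / R * D) * fdens \<gamma> I a y"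
      by (rule mult_right_mono) (rule fdens_nonneg[OF a])
    thus ?thesis
      unfolding fdens_shift[OF I] D_def[symmetric] using D by (simp add: algebra_simps)
  next
    case False
    then obtain i where i: "i \<in> I" "y i \<le> 0" by fastforce
    thus ?thesis using fdens_eq_0[where x = y and i = i, OF I i] by simp
  qed
  have int: "integrable (lborel_pow I) (fdens \<gamma> I a')" if "0 < a'" for a'
    using that by (intro integrable_fdens I \<gamma>)
  have "selberg_integral \<gamma> I (a + x) \<le> (LINT y|lborel_pow I. R powr x * ((1 - x) * fdens \<gamma> I a y + x / R * fdens \<gamma> I (a + 1) y))"
    unfolding selberg_integral_def using a x pw by (intro integral_mono int integrable_mult_right Bochner_Integration.integrable_add) auto
  also have "\<dots> = R powr x * ((1 - x) * selberg_integral \<gamma> I a + x / R * selberg_integral \<gamma> I (a + 1))"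
    using int[OF a] int[of "a + 1"] a unfolding selberg_integral_def by simp
  also have "selberg_integral \<gamma> I (a + 1) = R * selberg_integral \<gamma> I a" unfolding R_def by (rule selberg_integral_Suc) fact+
  finally show ?thesis using R by (simp add: R_def[symmetric] algebra_simps)
qed

lemma gamma_like_selberg_integral:
  assumes "finite I" "0 < \<gamma>"
    and lim: "\<And>x. 0 \<le> x \<Longrightarrow> x \<le> 1 \<Longrightarrow> ((\<lambda>a. ratio \<gamma> (card I) (a + x) / ratio \<gamma> (card I) a) \<longlongrightarrow> 1) at_top"
  shows "gamma_like (selberg_integral \<gamma> I) (ratio \<gamma> (card I))"
  using assms by (intro gamma_likeI selberg_integral_pos ratio_pos selberg_integral_Suc selberg_integral_le)

end

text \<open>
  The inequality $1 + t / q \le e^{t / q}$ is raised to the power \<open>p\<close>, with \<open>q\<close> so large that $p / q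
  \le 1/4$.
\<close>

lemma polynomial_times_exp_bounded:
  fixes p :: nat
  shows "\<exists>K\<ge>0. \<forall>t\<ge>0. (1 + t) ^ p * exp (- t / 4) \<le> (K :: real)"
proof -
  define q where "q = 4 * real (Suc p)"
  have "(1 + t) ^ p * exp (- t / 4) \<le> q ^ p" if t: "0 \<le> t" for t
  proof -
    have "1 + t \<le> q * (1 + t / q)" using t by (simp add: q_def field_simps)
    also have "\<dots> \<le> q * exp (t / q)"
      using exp_ge_add_one_self[of "t / q"] by (intro mult_left_mono) (auto simp: q_def)
    finally have "(1 + t) ^ p \<le> (q * exp (t / q)) ^ p" using t by (intro power_mono) auto
    also have "\<dots> = q ^ p * exp (real p * (t / q))" by (simp only: power_mult_distrib exp_of_nat_mult)
    also have "\<dots> \<le> q ^ p * exp (t / 4)"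
      using t by (intro mult_left_mono) (auto simp: q_def field_simps)
    finally have "(1 + t) ^ p * exp (- t / 4) \<le> q ^ p * exp (t / 4) * exp (- t / 4)"
      by (intro mult_right_mono) auto
    also have "\<dots> = q ^ p" by (simp add: mult.assoc mult_exp_exp)
    finally show ?thesis .
  qed
  thus ?thesis by (intro exI[of _ "q ^ p"]) (auto simp: q_def)
qed

lemma laguerre_family: "selberg_family (\<lambda>t. exp (- t / 2)) (\<lambda>_. 1 / 2) 0 1"
proof (rule selberg_family.intro)
  fix a :: real assume a: "0 < a"
  let ?w = "power_weight (\<lambda>t. exp (- t / 2)) a"
  have meas: "?w \<in> borel_measurable borel"
    unfolding power_weight_def by measurable
  have bd: "\<exists>K\<ge>0. \<forall>t>0. t * ?w t * (1 + t) ^ p \<le> K * exp (- (t * (1 / 4)))" for p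
  proof -
    obtain K :: real where K: "0 \<le> K" "\<And>t. 0 \<le> t \<Longrightarrow> (1 + t) ^ (nat \<lceil>a\<rceil> + p) * exp (- t / 4) \<le> K"
      using polynomial_times_exp_bounded[of "nat \<lceil>a\<rceil> + p"] by blast
    have "t * ?w t * (1 + t) ^ p \<le> K * exp (- (t * (1 / 4)))" if t: "0 < t" for t
    proof -
      have "t powr a \<le> (1 + t) ^ nat \<lceil>a\<rceil>" using powr_diff_le[of a t 0] a t by simp
      hence "t powr a * (1 + t) ^ p \<le> (1 + t) ^ nat \<lceil>a\<rceil> * (1 + t) ^ p"
        using t by (intro mult_right_mono) auto
      hence "(t powr a * (1 + t) ^ p) * exp (- t / 4) \<le> (1 + t) ^ (nat \<lceil>a\<rceil> + p) * exp (- t / 4)"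
        unfolding power_add by (rule mult_right_mono) simp
      also have "\<dots> \<le> K" using t by (intro K) auto
      finally have "(t powr a * (1 + t) ^ p) * exp (- t / 4) * exp (- t / 4) \<le> K * exp (- t / 4)"
        by (rule mult_right_mono) simp
      also have "(t powr a * (1 + t) ^ p) * exp (- t / 4) * exp (- t / 4) = t * ?w t * (1 + t) ^ p"
      proof -
        have "exp (- t / 2) = exp (- t / 4) * exp (- t / 4)" by (simp add: mult_exp_exp)
        thus ?thesis using t by (simp add: power_weight_def powr_diff)
      qed
      finally show ?thesis by simp
    qed
    thus ?thesis using K(1) by blast
  qed
  show "selberg_weight ?w a (1 / 2) 0"
  proof
    show "?w \<in> borel_measurable borel" by (rule meas)
    show "0 \<le> ?w t" for t by (simp add: power_weight_def)
    show "\<exists>K. \<forall>t. \<bar>t * (1 - 0 * t) * ?w t\<bar> * (1 + \<bar>t\<bar>) ^ p \<le> K" for p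
    proof -
      obtain K where K: "0 \<le> K" "\<And>t. 0 < t \<Longrightarrow> t * ?w t * (1 + t) ^ p \<le> K * exp (- (t * (1 / 4)))"
        using bd[of p] by auto
      have "\<bar>t * (1 - 0 * t) * ?w t\<bar> * (1 + \<bar>t\<bar>) ^ p \<le> K" for t
      proof (cases "0 < t")
        case True
        have "K * exp (- (t * (1 / 4))) \<le> K * 1" using K(1) True by (intro mult_left_mono) auto
        thus ?thesis using K(2)[OF True] True by (simp add: power_weight_def abs_mult)
      qed (use K(1) in \<open>simp add: power_weight_def\<close>)
      thus ?thesis by blast
    qed
    show "integrable lborel (\<lambda>t. ?w t * (1 + \<bar>t\<bar>) ^ p)" for p
    proof -
      obtain K where K: "0 \<le> K" "\<And>t. 0 < t \<Longrightarrow> t * ?w t * (1 + t) ^ p \<le> K * exp (- (t * (1 / 4)))"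
        using bd[of p] by auto
      define B where "B = (\<lambda>t. 2 ^ p * (indicator {0<..<1} t * t powr (a - 1)) + K * (indicator {0<..} t *\<^sub>R exp (- (t * (1 / 4)))))"
      have "integrable lborel B"
        unfolding B_def using set_integrable_exp_decay(1)[of "1 / 4"] integrable_powr_near_0[OF a]
        by (intro Bochner_Integration.integrable_add integrable_mult_right) (auto simp: set_integrable_def)
      thus ?thesis
      proof (rule Bochner_Integration.integrable_bound)
        show "AE t in lborel. norm (?w t * (1 + \<bar>t\<bar>) ^ p) \<le> norm (B t)"
        proof (rule AE_I2)
          fix t :: real
          have B1: "0 \<le> K * (indicator {0<..} t *\<^sub>R exp (- (t * (1 / 4))))"
            "0 \<le> 2 ^ p * (indicator {0<..<1} t * t powr (a - 1))" using K(1) by auto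
          consider "t \<le> 0" | "0 < t" "t < 1" | "1 \<le> t" by linarith
          hence "?w t * (1 + \<bar>t\<bar>) ^ p \<le> B t"
          proof cases
            case 2
            have "t powr (a - 1) * exp (- t / 2) * (1 + t) ^ p \<le> t powr (a - 1) * 1 * 2 ^ p"
              using 2 by (intro mult_mono power_mono) auto
            hence "?w t * (1 + \<bar>t\<bar>) ^ p \<le> 2 ^ p * (indicator {0<..<1} t * t powr (a - 1))"
              using 2 by (simp add: power_weight_def)
            thus ?thesis unfolding B_def using B1 by linarith
          next
            case 3
            hence "1 * (?w t * (1 + t) ^ p) \<le> t * (?w t * (1 + t) ^ p)"
              by (intro mult_right_mono) (auto simp: power_weight_def)
            also have "\<dots> \<le> K * exp (- (t * (1 / 4)))" using K(2)[of t] 3 by (simp add: mult.assoc)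
            finally show ?thesis using 3 by (simp add: B_def)
          qed (auto simp: power_weight_def B_def)
          moreover have "0 \<le> ?w t * (1 + \<bar>t\<bar>) ^ p" by (simp add: power_weight_def)
          ultimately show "norm (?w t * (1 + \<bar>t\<bar>) ^ p) \<le> norm (B t)" by simp
        qed
      qed (use meas in measurable)
    qed
    show "continuous_on UNIV (\<lambda>t. t * (1 - 0 * t) * ?w t)"
    proof -
      have "(\<lambda>t. t * (1 - 0 * t) * ?w t) = (\<lambda>t. max 0 t powr a * exp (- t / 2))"
        using a by (auto simp: fun_eq_iff power_weight_def powr_diff max_def)
      moreover have "continuous_on UNIV (\<lambda>t::real. max 0 t powr a * exp (- t / 2))"
        using a by (intro continuous_intros continuous_on_powr') auto
      ultimately show ?thesis by (simp only:)
    qed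
    show "\<exists>E. finite E \<and> (\<forall>t. t \<notin> E \<longrightarrow>
        ((\<lambda>t. t * (1 - 0 * t) * ?w t) has_real_derivative (a - 1 / 2 * t) * ?w t) (at t))"
    proof (intro exI[of _ "{0}"] conjI allI impI)
      fix t :: real assume "t \<notin> {0}"
      then consider "t < 0" | "0 < t" by force
      thus "((\<lambda>t. t * (1 - 0 * t) * ?w t) has_real_derivative (a - 1 / 2 * t) * ?w t) (at t)"
      proof cases
        case 1
        have "((\<lambda>t. t * (1 - 0 * t) * ?w t) has_real_derivative 0) (at t)"
          by (rule has_field_derivative_transform_within_open[where S = "{..<0}", OF DERIV_const])
             (use 1 in \<open>auto simp: power_weight_def\<close>)
        thus ?thesis using 1 by (simp add: power_weight_def)
      next
        case 2
        have "((\<lambda>t. t powr a * exp (- t / 2)) has_real_derivative (a - 1 / 2 * t) * ?w t) (at t)"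
          using 2 by (auto intro!: derivative_eq_intros simp: power_weight_def powr_diff field_simps)
        thus ?thesis
          by (rule has_field_derivative_transform_within_open[of _ _ _ "{0<..}"])
             (use 2 in \<open>auto simp: power_weight_def powr_diff\<close>)
      qed
    qed simp
  qed
qed auto

lemma jacobi_family:
  assumes b: "0 < b"
  shows "selberg_family (\<lambda>t. if t < 1 then (1 - t) powr (b - 1) else 0) (\<lambda>a. a + b) 1 1"
proof (rule selberg_family.intro)
  fix a :: real assume a: "0 < a"
  let ?w = "power_weight (\<lambda>t. if t < 1 then (1 - t) powr (b - 1) else 0) a"
  have meas: "?w \<in> borel_measurable borel"
    unfolding power_weight_def by measurable
  have eq: "t * (1 - 1 * t) * ?w t = (if 0 < t \<and> t < 1 then t powr a * (1 - t) powr b else 0)" for t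
    by (auto simp: power_weight_def powr_diff)
  have nonneg: "0 \<le> ?w t" for t by (simp add: power_weight_def)
  have le: "t powr a * (1 - t) powr b \<le> 1 * 1" if "0 < t" "t < 1" for t
    using that a b by (intro mult_mono powr_le1) auto
  show "selberg_weight ?w a (a + b) 1"
  proof
    show "?w \<in> borel_measurable borel" by (rule meas)
    show "0 \<le> ?w t" for t by (rule nonneg)
    show "\<exists>K. \<forall>t. \<bar>t * (1 - 1 * t) * ?w t\<bar> * (1 + \<bar>t\<bar>) ^ p \<le> K" for p
    proof (intro exI[of _ "2 ^ p"] allI)
      fix t :: real
      show "\<bar>t * (1 - 1 * t) * ?w t\<bar> * (1 + \<bar>t\<bar>) ^ p \<le> 2 ^ p"
      proof (cases "0 < t \<and> t < 1")
        case True
        have "\<bar>t * (1 - 1 * t) * ?w t\<bar> * (1 + \<bar>t\<bar>) ^ p \<le> 1 * 2 ^ p"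
          unfolding eq using True le[of t] by (intro mult_mono power_mono) auto
        thus ?thesis by simp
      qed (use eq[of t] in auto)
    qed
    show "integrable lborel (\<lambda>t. ?w t * (1 + \<bar>t\<bar>) ^ p)" for p
    proof -
      define B where "B = (\<lambda>t. 2 ^ p * (indicator {0..1} t *\<^sub>R (t powr (a - 1) * (1 - t) powr (b - 1))))"
      have "integrable lborel B"
        unfolding B_def using integrable_Beta[OF a b]
        by (intro integrable_mult_right) (simp add: set_integrable_def)
      thus ?thesis
      proof (rule Bochner_Integration.integrable_bound)
        show "AE t in lborel. norm (?w t * (1 + \<bar>t\<bar>) ^ p) \<le> norm (B t)"
        proof (rule AE_I2)
          fix t :: real
          show "norm (?w t * (1 + \<bar>t\<bar>) ^ p) \<le> norm (B t)"
          proof (cases "0 < t \<and> t < 1")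
            case True
            have "(t powr (a - 1) * (1 - t) powr (b - 1)) * (1 + t) ^ p
                \<le> (t powr (a - 1) * (1 - t) powr (b - 1)) * 2 ^ p"
              using True by (intro mult_left_mono power_mono) auto
            thus ?thesis using True by (simp add: power_weight_def B_def abs_mult mult_ac)
          qed (auto simp: power_weight_def)
        qed
      qed (use meas in measurable)
    qed
    show "continuous_on UNIV (\<lambda>t. t * (1 - 1 * t) * ?w t)"
    proof -
      have "(\<lambda>t. t * (1 - 1 * t) * ?w t) = (\<lambda>t. max 0 t powr a * max 0 (1 - t) powr b)"
        unfolding eq using a b by (auto simp: fun_eq_iff max_def)
      moreover have "continuous_on UNIV (\<lambda>t::real. max 0 t powr a * max 0 (1 - t) powr b)"
        using a b by (intro continuous_intros continuous_on_powr') auto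
      ultimately show ?thesis by (simp only:)
    qed
    show "\<exists>E. finite E \<and> (\<forall>t. t \<notin> E \<longrightarrow>
        ((\<lambda>t. t * (1 - 1 * t) * ?w t) has_real_derivative (a - (a + b) * t) * ?w t) (at t))"
    proof (intro exI[of _ "{0, 1}"] conjI allI impI)
      fix t :: real assume "t \<notin> {0, 1}"
      then consider "t \<in> {..<0} \<union> {1<..}" | "0 < t" "t < 1" by force
      thus "((\<lambda>t. t * (1 - 1 * t) * ?w t) has_real_derivative (a - (a + b) * t) * ?w t) (at t)"
      proof cases
        case 1
        have "((\<lambda>t. t * (1 - 1 * t) * ?w t) has_real_derivative 0) (at t)"
          by (rule has_field_derivative_transform_within_open[where S = "{..<0} \<union> {1<..}", OF DERIV_const])
             (use 1 in \<open>auto simp: power_weight_def\<close>)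
        thus ?thesis using 1 by (auto simp: power_weight_def)
      next
        case 2
        have "((\<lambda>t. t powr a * (1 - t) powr b) has_real_derivative (a - (a + b) * t) * ?w t) (at t)"
          using 2 by (auto intro!: derivative_eq_intros simp: power_weight_def powr_diff field_simps)
        thus ?thesis
          by (rule has_field_derivative_transform_within_open[of _ _ _ "{0<..<1}"]) (use 2 in \<open>simp_all only: eq, auto\<close>)
      qed
    qed simp
  qed
qed (use b in auto)


section \<open>Mellin transforms and analytic continuation\<close>

lemma norm_exp_minus_1_le: "norm (exp w - 1 :: complex) \<le> norm w * exp (norm w)"
  using Taylor_exp_field[of w 0] by (simp add: mult.commute)

lemma open_half_plane: "open (half_plane c)"
  unfolding half_plane_def by (rule open_halfspace_Re_gt)

lemma connected_half_plane: "connected (half_plane c)"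
  unfolding half_plane_def by (intro convex_connected convex_halfspace_Re_gt)

text \<open>
  Differentiation under the integral.  On a small disc around $z$ the difference quotients are
  dominated by two exponentials with real exponents on either side of the real part of $z$.
\<close>

lemma holomorphic_exponential_integral:
  fixes X :: "'a \<Rightarrow> real"
  assumes X [measurable]: "X \<in> borel_measurable M"
    and int: "\<And>x. - c < x \<Longrightarrow> integrable M (\<lambda>\<omega>. exp (x * X \<omega>))"
  shows "(\<lambda>z. LINT \<omega>|M. exp (z * of_real (X \<omega>))) holomorphic_on half_plane c"
proof (rule holomorphic_onI)
  let ?M = "\<lambda>z. LINT \<omega>|M. exp (z * of_real (X \<omega>)) :: complex"
  have int_c: "integrable M (\<lambda>\<omega>. exp (z * of_real (X \<omega>)) :: complex)" if "- c < Re z" for z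
    by (rule Bochner_Integration.integrable_bound[OF int[OF that]]) (auto intro!: AE_I2)
  fix z assume "z \<in> half_plane c"
  hence z: "- c < Re z" by (simp add: half_plane_def)
  \<comment> \<open>small enough that both dominating exponents stay above \<open>- c\<close>\<close>
  define \<delta> where "\<delta> = (Re z + c) / 4"
  have \<delta>: "0 < \<delta>" using z by (simp add: \<delta>_def)
  have lo: "- c < Re z - 2 * \<delta>" using z by (simp add: \<delta>_def field_simps)
  define w where "w = (\<lambda>\<omega>. (exp ((Re z + 2 * \<delta>) * X \<omega>) + exp ((Re z - 2 * \<delta>) * X \<omega>)) / \<delta>)"
  have w: "integrable M w"
    unfolding w_def using lo \<delta> by (intro integrable_divide Bochner_Integration.integrable_add int) auto
  define D where "D = (LINT \<omega>|M. of_real (X \<omega>) * exp (z * of_real (X \<omega>)))"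
  have "((\<lambda>y. (?M y - ?M z) / (y - z)) \<longlongrightarrow> D) (at z)"
    unfolding tendsto_at_iff_sequentially
  proof (intro allI impI)
    fix y :: "nat \<Rightarrow> complex" assume y: "\<forall>i. y i \<in> UNIV - {z}" "y \<longlonglongrightarrow> z"
    from y(2) \<delta> obtain N where N: "\<And>n. n \<ge> N \<Longrightarrow> norm (y n - z) < \<delta>"
      unfolding LIMSEQ_iff by blast
    define q where "q = (\<lambda>n \<omega>. (exp (y (n + N) * of_real (X \<omega>)) - exp (z * of_real (X \<omega>))) / (y (n + N) - z))"
    have "(\<lambda>n. integral\<^sup>L M (q n)) \<longlonglongrightarrow> D"
      unfolding D_def
    proof (rule integral_dominated_convergence[where w = w])
      show "q n \<in> borel_measurable M" for n unfolding q_def by measurable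
      show "(\<lambda>\<omega>. of_real (X \<omega>) * exp (z * of_real (X \<omega>)) :: complex) \<in> borel_measurable M" by measurable
      show "integrable M w" by (rule w)
      show "AE \<omega> in M. (\<lambda>n. q n \<omega>) \<longlonglongrightarrow> of_real (X \<omega>) * exp (z * of_real (X \<omega>))"
      proof (rule AE_I2)
        fix \<omega>
        have "((\<lambda>y. exp (y * of_real (X \<omega>))) has_field_derivative of_real (X \<omega>) * exp (z * of_real (X \<omega>))) (at z)"
          by (auto intro!: derivative_eq_intros)
        hence "((\<lambda>y. (exp (y * of_real (X \<omega>)) - exp (z * of_real (X \<omega>))) / (y - z)) \<longlongrightarrow> of_real (X \<omega>) * exp (z * of_real (X \<omega>))) (at z)"
          by (simp add: has_field_derivative_iff)
        thus "(\<lambda>n. q n \<omega>) \<longlonglongrightarrow> of_real (X \<omega>) * exp (z * of_real (X \<omega>))"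
          unfolding q_def using y
          by (auto simp: tendsto_at_iff_sequentially o_def elim!: allE[of _ "\<lambda>n. y (n + N)"] intro: LIMSEQ_ignore_initial_segment)
      qed
      show "AE \<omega> in M. norm (q n \<omega>) \<le> w \<omega>" for n
      proof (rule AE_I2)
        fix \<omega>
        define h where "h = y (n + N) - z"
        have h: "h \<noteq> 0" "norm h \<le> \<delta>" using y(1) N[of "n + N"] by (auto simp: h_def)
        have "exp (y (n + N) * of_real (X \<omega>)) = exp (z * of_real (X \<omega>)) * exp (h * of_real (X \<omega>))"
          by (simp add: h_def mult_exp_exp algebra_simps)
        hence "q n \<omega> = exp (z * of_real (X \<omega>)) * ((exp (h * of_real (X \<omega>)) - 1) / h)"
          by (simp add: q_def h_def[symmetric] right_diff_distrib)
        hence "norm (q n \<omega>) = exp (Re z * X \<omega>) * (norm (exp (h * of_real (X \<omega>)) - 1) / norm h)"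
          by (simp add: norm_mult norm_divide)
        also have "\<dots> \<le> exp (Re z * X \<omega>) * ((norm h * \<bar>X \<omega>\<bar> * exp (norm h * \<bar>X \<omega>\<bar>)) / norm h)"
          using norm_exp_minus_1_le[of "h * of_real (X \<omega>)"]
          by (intro mult_left_mono divide_right_mono) (auto simp: norm_mult)
        also have "\<dots> = exp (Re z * X \<omega>) * (\<bar>X \<omega>\<bar> * exp (norm h * \<bar>X \<omega>\<bar>))" using h by simp
        also have "\<dots> \<le> exp (Re z * X \<omega>) * ((exp (\<delta> * \<bar>X \<omega>\<bar>) / \<delta>) * exp (\<delta> * \<bar>X \<omega>\<bar>))"
        proof (intro mult_left_mono mult_mono)
          have "\<delta> * \<bar>X \<omega>\<bar> \<le> exp (\<delta> * \<bar>X \<omega>\<bar>)" using exp_ge_add_one_self[of "\<delta> * \<bar>X \<omega>\<bar>"] by linarith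
          thus "\<bar>X \<omega>\<bar> \<le> exp (\<delta> * \<bar>X \<omega>\<bar>) / \<delta>" using \<delta> by (simp add: field_simps)
          show "exp (norm h * \<bar>X \<omega>\<bar>) \<le> exp (\<delta> * \<bar>X \<omega>\<bar>)" using h by (simp add: mult_right_mono)
        qed (use \<delta> in auto)
        also have "\<dots> = exp (Re z * X \<omega> + 2 * \<delta> * \<bar>X \<omega>\<bar>) / \<delta>"
        proof -
          have "Re z * X \<omega> + 2 * \<delta> * \<bar>X \<omega>\<bar> = Re z * X \<omega> + (\<delta> * \<bar>X \<omega>\<bar> + \<delta> * \<bar>X \<omega>\<bar>)" by simp
          thus ?thesis by (simp only: exp_add) simp
        qed
        also have "\<dots> \<le> w \<omega>"
          unfolding w_def
        proof (rule divide_right_mono)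
          show "exp (Re z * X \<omega> + 2 * \<delta> * \<bar>X \<omega>\<bar>) \<le> exp ((Re z + 2 * \<delta>) * X \<omega>) + exp ((Re z - 2 * \<delta>) * X \<omega>)"
            by (cases "0 \<le> X \<omega>") (simp_all add: algebra_simps)
        qed (use \<delta> in simp)
        finally show "norm (q n \<omega>) \<le> w \<omega>" .
      qed
    qed
    moreover have "integral\<^sup>L M (q n) = (?M (y (n + N)) - ?M z) / (y (n + N) - z)" for n
    proof -
      have "- c < Re (y (n + N))"
        using abs_Re_le_cmod[of "y (n + N) - z"] N[of "n + N"] lo \<delta> by simp
      thus ?thesis unfolding q_def using int_c z by simp
    qed
    ultimately have "(\<lambda>n. (?M (y (n + N)) - ?M z) / (y (n + N) - z)) \<longlonglongrightarrow> D" by simp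
    thus "((\<lambda>y. (?M y - ?M z) / (y - z)) \<circ> y) \<longlonglongrightarrow> D"
      unfolding o_def by (rule LIMSEQ_offset)
  qed
  hence "(?M has_field_derivative D) (at z)" by (simp add: has_field_derivative_iff)
  thus "?M field_differentiable (at z within half_plane c)"
    using field_differentiable_def field_differentiable_at_within by blast
qed

text \<open>
  Both sides are holomorphic and agree on the positive real axis, which has a limit point in the
  half-plane.
\<close>

lemma mellin_eq_of_real:
  fixes D :: "'a \<Rightarrow> real"
  assumes D [measurable]: "D \<in> borel_measurable P" and pos: "AE \<omega> in P. 0 < D \<omega>" and c: "0 < c"
    and int: "\<And>x. - c < x \<Longrightarrow> integrable P (\<lambda>\<omega>. D \<omega> powr x)"
    and H: "H holomorphic_on half_plane c"
    and eq: "\<And>x. - c < x \<Longrightarrow> H (of_real x) = of_real (LINT \<omega>|P. D \<omega> powr x)"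
    and z: "z \<in> half_plane c"
  shows "(LINT \<omega>|P. exp (z * of_real (ln (D \<omega>)))) = H z"
proof -
  let ?M = "\<lambda>z. LINT \<omega>|P. exp (z * of_real (ln (D \<omega>))) :: complex"
  have AE_eq: "AE \<omega> in P. D \<omega> powr x = exp (x * ln (D \<omega>))" for x
    using pos by eventually_elim (simp add: powr_def)
  have hol: "?M holomorphic_on half_plane c"
  proof (rule holomorphic_exponential_integral)
    fix x assume "- c < x"
    thus "integrable P (\<lambda>\<omega>. exp (x * ln (D \<omega>)))"
      using int[of x] AE_eq[of x] by (subst integrable_cong_AE[symmetric]) auto
  qed measurable
  have real: "?M (of_real x) = H (of_real x)" if "- c < x" for x
  proof -
    have "?M (of_real x) = (LINT \<omega>|P. of_real (D \<omega> powr x))"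
      using AE_eq[of x] by (intro integral_cong_AE) (auto simp: exp_of_real[symmetric])
    also have "\<dots> = of_real (LINT \<omega>|P. D \<omega> powr x)" by simp
    finally show ?thesis using eq[OF that] by simp
  qed
  have "?M z - H z = 0"
  proof (rule analytic_continuation[of "\<lambda>z. ?M z - H z" "half_plane c" "of_real ` {0<..}" 0])
    show "(\<lambda>z. ?M z - H z) holomorphic_on half_plane c" by (intro holomorphic_intros hol H)
    show "of_real ` {0<..} \<subseteq> half_plane c" "(0::complex) \<in> half_plane c"
      using c by (auto simp: half_plane_def)
    show "(0::complex) islimpt of_real ` {0<..}"
      unfolding islimpt_approachable
    proof (intro allI impI)
      fix e :: real assume "0 < e"
      thus "\<exists>x'\<in>complex_of_real ` {0<..}. x' \<noteq> 0 \<and> dist x' 0 < e"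
        by (intro bexI[of _ "of_real (e / 2)"] imageI) auto
    qed
  qed (use real c z in \<open>auto simp: open_half_plane connected_half_plane\<close>)
  thus ?thesis by simp
qed

lemma log_mellin_eq:
  fixes D :: "'a \<Rightarrow> real"
  assumes \<beta>: "0 < \<beta>" and D: "D \<in> borel_measurable P" and pos: "AE \<omega> in P. 0 < D \<omega>"
    and int: "\<And>x. - (\<beta> / 2) < x \<Longrightarrow> integrable P (\<lambda>\<omega>. D \<omega> powr x)"
    and L: "L holomorphic_on half_plane (\<beta> / 2)" "L 0 = 0"
    and eq: "\<And>x. - (\<beta> / 2) < x \<Longrightarrow> exp (L (of_real x)) = of_real (LINT \<omega>|P. D \<omega> powr x)"
    and z: "z \<in> half_plane (\<beta> / 2)"
  shows "log_mellin \<beta> P D z = L z"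
proof -
  let ?S = "half_plane (\<beta> / 2)"
  let ?B = "\<lambda>L. log_branch ?S (\<lambda>z. LINT x|P. exp (z * of_real (ln (D x)))) L \<and> L 0 = 0"
  have "(LINT \<omega>|P. exp (z * of_real (ln (D \<omega>)))) = exp (L z)" if "z \<in> ?S" for z
    using \<beta> that holomorphic_on_compose[OF L(1) holomorphic_on_exp]
    by (intro mellin_eq_of_real[OF D pos _ int _ eq]) (auto simp: o_def)
  hence B: "?B L" using L by (simp add: log_branch_def)
  hence "?B (log_mellin \<beta> P D)" unfolding log_mellin_def by (rule someI[where P = ?B])
  moreover have "0 \<in> ?S" using \<beta> by (simp add: half_plane_def)
  ultimately show ?thesis
    using B log_branch_unique[of ?S _ "log_mellin \<beta> P D" L 0 z] connected_half_plane z by metis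
qed

lemma normalized_density_eq:
  assumes w: "integrable M w" "\<And>x. 0 \<le> w x" "0 < integral\<^sup>L M w"
  shows "normalized_density M w = density M (\<lambda>x. ennreal (w x / integral\<^sup>L M w))"
proof -
  have "(\<integral>\<^sup>+y. ennreal (w y) \<partial>M) = ennreal (integral\<^sup>L M w)"
    using w by (intro nn_integral_eq_integral) auto
  thus ?thesis unfolding normalized_density_def using w by (simp add: divide_ennreal)
qed


section \<open>The Mellin transforms of the three determinants\<close>

context selberg_family
begin

lemma normalized_fdens:
  fixes I :: "nat set"
  assumes I: "finite I" and \<gamma>: "0 < \<gamma>" and a: "0 < a"
  defines "P \<equiv> normalized_density (lborel_pow I) (fdens \<gamma> I a)"
  shows prod_measurable: "(\<lambda>y. \<Prod>i\<in>I. y i) \<in> borel_measurable P"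
    and AE_prod_pos: "AE y in P. 0 < (\<Prod>i\<in>I. y i)"
    and integrable_prod_powr: "- a < x \<Longrightarrow> integrable P (\<lambda>y. (\<Prod>i\<in>I. y i) powr x)"
    and integral_prod_powr: "- a < x \<Longrightarrow> (LINT y|P. (\<Prod>i\<in>I. y i) powr x) = selberg_integral \<gamma> I (a + x) / selberg_integral \<gamma> I a"
proof -
  note int = integrable_fdens[OF I \<gamma>]
  have P: "P = density (lborel_pow I) (\<lambda>y. ennreal (fdens \<gamma> I a y / selberg_integral \<gamma> I a))"
    unfolding P_def selberg_integral_def using int[OF a] fdens_nonneg[OF a] selberg_integral_pos[OF I \<gamma> a]
    by (intro normalized_density_eq) (auto simp: selberg_integral_def)
  note [measurable] = borel_measurable_fdens[OF a, of \<gamma> I]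
  have meas: "(\<lambda>y. \<Prod>i\<in>I. y i) \<in> borel_measurable (lborel_pow I)"
    by (intro borel_measurable_prod) auto
  thus "(\<lambda>y. \<Prod>i\<in>I. y i) \<in> borel_measurable P" by (simp add: P)
  show "AE y in P. 0 < (\<Prod>i\<in>I. y i)"
    unfolding P
  proof (subst AE_density, measurable, rule AE_I2, rule impI)
    fix y assume "0 < ennreal (fdens \<gamma> I a y / selberg_integral \<gamma> I a)"
    hence nz: "fdens \<gamma> I a y \<noteq> 0" by auto
    have "0 < y i" if "i \<in> I" for i
      using nz fdens_eq_0[where x = y and i = i, OF I that] by force
    thus "0 < (\<Prod>i\<in>I. y i)" by (intro prod_pos) auto
  qed
  assume x: "- a < x"
  have nn: "AE y in lborel_pow I. 0 \<le> fdens \<gamma> I a y / selberg_integral \<gamma> I a"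
    using fdens_nonneg[OF a] selberg_integral_pos[OF I \<gamma> a] by simp
  have powr_meas: "(\<lambda>y. (\<Prod>i\<in>I. y i) powr x) \<in> borel_measurable (lborel_pow I)"
    using meas by measurable
  have eq: "(fdens \<gamma> I a y / selberg_integral \<gamma> I a) *\<^sub>R (\<Prod>i\<in>I. y i) powr x = fdens \<gamma> I (a + x) y / selberg_integral \<gamma> I a" for y
    by (simp add: fdens_shift[OF I])
  show "integrable P (\<lambda>y. (\<Prod>i\<in>I. y i) powr x)"
    unfolding P using int[of "a + x"] x
    by (subst integrable_density[OF powr_meas _ nn]) (simp_all only: eq, auto)
  show "(LINT y|P. (\<Prod>i\<in>I. y i) powr x) = selberg_integral \<gamma> I (a + x) / selberg_integral \<gamma> I a"
    unfolding P by (subst integral_density[OF powr_meas _ nn]) (simp_all only: eq, auto simp: selberg_integral_def)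
qed

text \<open>
  The quotient of Selberg integrals at exponents \<open>c + x\<close> and \<open>c\<close> is the real Mellin transform;
  it equals the corresponding quotient of any explicit solution \<open>g\<close> of the functional equation that
  has the right growth.
\<close>

lemma log_mellin_normalized_fdens:
  assumes \<beta>: "0 < \<beta>" and I: "finite I"
    and lim: "\<And>x. 0 \<le> x \<Longrightarrow> x \<le> 1 \<Longrightarrow>
        ((\<lambda>a. ratio (\<beta> / 2) (card I) (a + x) / ratio (\<beta> / 2) (card I) a) \<longlongrightarrow> 1) at_top"
    and g: "gamma_like g (ratio (\<beta> / 2) (card I))"
    and L: "L holomorphic_on half_plane (\<beta> / 2)" "L 0 = 0"
    and eq: "\<And>x. - (\<beta> / 2) < x \<Longrightarrow> exp (L (of_real x)) = of_real (g (\<beta> / 2 + x) / g (\<beta> / 2))"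
    and z: "z \<in> half_plane (\<beta> / 2)"
  shows "log_mellin \<beta> (normalized_density (lborel_pow I) (fdens (\<beta> / 2) I (\<beta> / 2)))
           (\<lambda>y. \<Prod>i\<in>I. y i) z = L z"
proof -
  define c where "c = \<beta> / 2"
  have c: "0 < c" using \<beta> by (simp add: c_def)
  have S: "gamma_like (selberg_integral c I) (ratio c (card I))"
    unfolding c_def by (rule gamma_like_selberg_integral[OF I _ lim]) (use \<beta> in auto)
  show ?thesis
  proof (rule log_mellin_eq[OF \<beta> _ _ _ L _ z])
    fix x assume "- (\<beta> / 2) < x"
    hence x: "- c < x" by (simp add: c_def)
    show "integrable (normalized_density (lborel_pow I) (fdens (\<beta> / 2) I (\<beta> / 2))) (\<lambda>y. (\<Prod>i\<in>I. y i) powr x)"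
      unfolding c_def[symmetric] by (rule integrable_prod_powr[OF I c c x])
    have "(LINT y|normalized_density (lborel_pow I) (fdens c I c). (\<Prod>i\<in>I. y i) powr x) = selberg_integral c I (c + x) / selberg_integral c I c"
      by (rule integral_prod_powr[OF I c c x])
    also have "\<dots> = g (c + x) / g c"
    proof -
      have "0 < selberg_integral c I c" "0 < g (c + x)" "0 < g c"
        using S g c x by (auto simp: gamma_like_def c_def)
      thus ?thesis using gamma_like_unique[OF S g[folded c_def], of "c + x" c] c x by (simp add: field_simps)
    qed
    finally show "exp (L (of_real x)) = of_real (LINT y|normalized_density (lborel_pow I) (fdens (\<beta> / 2) I (\<beta> / 2)).
        (\<Prod>i\<in>I. y i) powr x)"
      using eq[of x] x by (simp add: c_def)
  qed (use \<beta> prod_measurable[OF I] AE_prod_pos[OF I] in auto)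
qed

end

lemma vdm_atLeastAtMost:
  fixes x :: "nat \<Rightarrow> real"
  shows "vdm (\<beta> / 2) {1..n} x = (\<Prod>k=1..n. \<Prod>j=1..<k. \<bar>x k - x j\<bar> powr \<beta>)"
proof (induction n)
  case (Suc n)
  have "{1..Suc n} = insert (Suc n) {1..n}" "{1..<Suc n} = {1..n}" by auto
  thus ?case using Suc by (simp add: vdm_insert)
qed (simp add: vdm_def)

definition ln_Gamma_sum :: "real \<Rightarrow> nat \<Rightarrow> complex \<Rightarrow> complex" where
  "ln_Gamma_sum c n z = (\<Sum>k=1..n. ln_Gamma (of_real (c * real k) + z) - ln_Gamma (of_real (c * real k)))"

definition ln_Gamma_shifts :: "'k set \<Rightarrow> ('k \<Rightarrow> real) \<Rightarrow> complex \<Rightarrow> complex" where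
  "ln_Gamma_shifts K s z = (\<Sum>k\<in>K. ln_Gamma (of_real (s k) + z) - ln_Gamma (of_real (s k)))"

lemma ln_Gamma_sum_eq_shifts: "ln_Gamma_sum c n = ln_Gamma_shifts {..<n} (\<lambda>k. c * real (Suc k))"
proof
  show "ln_Gamma_sum c n z = ln_Gamma_shifts {..<n} (\<lambda>k. c * real (Suc k)) z" for z
    by (induction n) (simp_all add: ln_Gamma_sum_def ln_Gamma_shifts_def del: of_nat_Suc of_real_mult)
qed

lemma ln_Gamma_shifts_0 [simp]: "ln_Gamma_shifts K s 0 = 0"
  by (simp add: ln_Gamma_shifts_def)

lemma holomorphic_ln_Gamma_shifts:
  assumes "\<And>k. k \<in> K \<Longrightarrow> c \<le> s k"
  shows "ln_Gamma_shifts K s holomorphic_on half_plane c"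
proof -
  have "(\<lambda>z. ln_Gamma (of_real (s k) + z)) holomorphic_on half_plane c" if "k \<in> K" for k
  proof -
    have "ln_Gamma \<circ> (\<lambda>z. of_real (s k) + z) holomorphic_on half_plane c"
    proof (rule holomorphic_on_compose)
      show "ln_Gamma holomorphic_on (\<lambda>z. of_real (s k) + z) ` half_plane c"
        by (rule holomorphic_ln_Gamma)
           (use assms[OF that] in \<open>auto simp: half_plane_def complex_nonpos_Reals_iff\<close>)
    qed (intro holomorphic_intros)
    thus ?thesis by (simp add: o_def)
  qed
  thus ?thesis unfolding ln_Gamma_shifts_def by (intro holomorphic_intros)
qed

lemma exp_ln_Gamma_shifts_of_real:
  assumes K: "finite K" "\<And>k. k \<in> K \<Longrightarrow> c \<le> s k" and c: "0 < c" and x: "- c < x"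
  shows "exp (ln_Gamma_shifts K s (of_real x)) = of_real (\<Prod>k\<in>K. Gamma (s k + x) / Gamma (s k))"
proof -
  have G: "exp (ln_Gamma (complex_of_real y)) = of_real (Gamma y)" if "0 < y" for y
  proof -
    have "complex_of_real y \<notin> \<int>\<^sub>\<le>\<^sub>0" using that by (auto elim!: nonpos_Ints_cases simp: complex_eq_iff)
    thus ?thesis using Gamma_complex_of_real[of y] Gamma_complex_altdef[of "of_real y"] by simp
  qed
  have "exp (ln_Gamma (of_real (s k) + of_real x) - ln_Gamma (of_real (s k)) :: complex)
      = of_real (Gamma (s k + x) / Gamma (s k))" if "k \<in> K" for k
    using G[of "s k"] G[of "s k + x"] K(2)[OF that] c x by (simp add: exp_diff)
  thus ?thesis unfolding ln_Gamma_shifts_def exp_sum[OF K(1)] of_real_prod by (intro prod.cong refl)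
qed

lemma log_mellin_laguerre:
  assumes \<beta>: "0 < \<beta>" and z: "z \<in> half_plane (\<beta> / 2)"
  shows "log_mellin \<beta> (laguerre_ensemble \<beta> n) (laguerre_det n) z
       = of_real (real n * ln 2) * z + ln_Gamma_sum (\<beta> / 2) n z"
proof -
  define c where "c = \<beta> / 2"
  have c: "0 < c" using \<beta> by (simp add: c_def)
  interpret selberg_family "\<lambda>t. exp (- t / 2)" "\<lambda>_. 1 / 2" 0 1 by (rule laguerre_family)
  let ?I = "{1..n}"
  have dens: "(\<lambda>x. if \<forall>k\<in>{1..n}. 0 < x k then
            (\<Prod>k=1..n. \<Prod>j=1..<k. \<bar>x k - x j\<bar> powr \<beta>) *
            (\<Prod>k=1..n. x k powr (\<beta> / 2 - 1) * exp (- x k / 2)) else 0) = fdens c ?I c"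
  proof
    fix x :: "nat \<Rightarrow> real"
    show "(if \<forall>k\<in>{1..n}. 0 < x k then
            (\<Prod>k=1..n. \<Prod>j=1..<k. \<bar>x k - x j\<bar> powr \<beta>) *
            (\<Prod>k=1..n. x k powr (\<beta> / 2 - 1) * exp (- x k / 2)) else 0) = fdens c ?I c x"
    proof (cases "\<forall>k\<in>{1..n}. 0 < x k")
      case True
      hence "(\<Prod>k=1..n. power_weight (\<lambda>t. exp (- t / 2)) c (x k)) = (\<Prod>k=1..n. x k powr (\<beta> / 2 - 1) * exp (- x k / 2))"
        by (intro prod.cong) (auto simp: power_weight_def c_def)
      moreover have "vdm c ?I x = (\<Prod>k=1..n. \<Prod>j=1..<k. \<bar>x k - x j\<bar> powr \<beta>)"
        unfolding c_def by (rule vdm_atLeastAtMost)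
      ultimately show ?thesis unfolding fdens_def if_P[OF True] by (simp only: mult.commute)
    next
      case False
      then obtain k where "k \<in> ?I" "x k \<le> 0" by fastforce
      thus ?thesis using fdens_eq_0[of ?I k x] False by auto
    qed
  qed
  have P: "laguerre_ensemble \<beta> n = normalized_density (lborel_pow ?I) (fdens c ?I c)"
    unfolding laguerre_ensemble_def dens ..
  have D: "laguerre_det n = (\<lambda>y. \<Prod>i\<in>?I. y i)" by (simp add: laguerre_det_def fun_eq_iff)
  \<comment> \<open>the power of 2 accounts for the rate 1/2 of the exponential weight\<close>
  define g where "g = (\<lambda>a. \<Prod>k<n. 2 powr a * Gamma (a + c * real k))"
  have g: "gamma_like g (ratio c (card ?I))"
  proof -
    have "gamma_like g (\<lambda>a. \<Prod>k<n. 2 * (a + c * real k))"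
      unfolding g_def using c by (intro gamma_like_prod gamma_like_mult gamma_like_powr gamma_like_Gamma) auto
    also have "(\<lambda>a. \<Prod>k<n. 2 * (a + c * real k)) = ratio c (card ?I)"
      by (simp add: ratio_def fun_eq_iff mult.commute)
    finally show ?thesis .
  qed
  have lim: "((\<lambda>a. ratio c (card ?I) (a + x) / ratio c (card ?I) a) \<longlongrightarrow> 1) at_top" for x
  proof -
    have R: "ratio c (card ?I) a = (\<Prod>k<n. (a + c * real k) * 2)" for a
      by (simp add: ratio_def)
    have "((\<lambda>a. \<Prod>k<n. ((a + x + c * real k) * 2) / ((a + c * real k) * 2)) \<longlongrightarrow> (\<Prod>k<n. 1)) at_top"
      by (intro tendsto_prod) real_asymp
    thus ?thesis
      unfolding R prod_dividef by (simp only: prod.neutral_const)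
  qed
  define s where "s = (\<lambda>k. c * real (Suc k))"
  have s: "c \<le> s k" for k using c by (simp add: s_def algebra_simps)
  define L where "L = (\<lambda>z. of_real (real n * ln 2) * z + ln_Gamma_shifts {..<n} s z)"
  have "log_mellin \<beta> (laguerre_ensemble \<beta> n) (laguerre_det n) z = L z"
    unfolding P D c_def
  proof (rule log_mellin_normalized_fdens[OF \<beta> _ lim[unfolded c_def] g[unfolded c_def] _ _ _ z])
    show "L holomorphic_on half_plane (\<beta> / 2)"
      unfolding L_def using s by (intro holomorphic_intros holomorphic_ln_Gamma_shifts) (auto simp: c_def)
    show "L 0 = 0" by (simp add: L_def)
    fix x assume "- (\<beta> / 2) < x"
    hence x: "- c < x" by (simp add: c_def)
    have "exp (of_real (real n * ln 2) * of_real x) = complex_of_real (\<Prod>k<n. 2 powr x)"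
      by (simp add: powr_def exp_of_nat_mult[symmetric] exp_of_real[symmetric] mult_ac)
    hence "exp (L (of_real x)) = of_real ((\<Prod>k<n. 2 powr x) * (\<Prod>k<n. Gamma (s k + x) / Gamma (s k)))"
      unfolding L_def exp_add exp_ln_Gamma_shifts_of_real[OF finite_lessThan s c x] by (simp only: of_real_mult)
    also have "(\<Prod>k<n. 2 powr x) * (\<Prod>k<n. Gamma (s k + x) / Gamma (s k)) = g (c + x) / g c"
      unfolding g_def prod_dividef[symmetric] prod.distrib[symmetric] s_def
      by (intro prod.cong) (auto simp: powr_add algebra_simps)
    finally show "exp (L (of_real x)) = of_real (g (\<beta> / 2 + x) / g (\<beta> / 2))" by (simp only: c_def)
  qed simp
  thus ?thesis by (simp add: L_def s_def c_def ln_Gamma_sum_eq_shifts)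
qed

lemma log_mellin_jacobi:
  assumes \<beta>: "0 < \<beta>" and z: "z \<in> half_plane (\<beta> / 2)"
  shows "log_mellin \<beta> (jacobi_ensemble \<beta> n1 n2) (jacobi_det n1 n2) z
       = ln_Gamma_sum (\<beta> / 2) n1 z + ln_Gamma_sum (\<beta> / 2) n2 z - ln_Gamma_sum (\<beta> / 2) (n1 + n2) z"
proof -
  define c where "c = \<beta> / 2"
  have c: "0 < c" using \<beta> by (simp add: c_def)
  define m where "m = min n1 n2"
  define M where "M = max n1 n2"
  have mM: "m \<le> M" by (simp add: m_def M_def)
  define b where "b = c * (real M - real m + 1)"
  have b: "0 < b" using c mM by (simp add: b_def)
  interpret selberg_family "\<lambda>t. if t < 1 then (1 - t) powr (b - 1) else 0" "\<lambda>a. a + b" 1 1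
    using b by (rule jacobi_family)
  let ?I = "{1..m}"
  have dens: "(\<lambda>x. if \<forall>k\<in>{1..m}. 0 < x k \<and> x k < 1 then
            (\<Prod>k=1..m. \<Prod>j=1..<k. \<bar>x k - x j\<bar> powr \<beta>) *
            (\<Prod>k=1..m. x k powr (\<beta> / 2 - 1) * (1 - x k) powr (\<beta> / 2 * (real M - real m + 1) - 1))
            else 0) = fdens c ?I c"
  proof
    fix x :: "nat \<Rightarrow> real"
    show "(if \<forall>k\<in>{1..m}. 0 < x k \<and> x k < 1 then
            (\<Prod>k=1..m. \<Prod>j=1..<k. \<bar>x k - x j\<bar> powr \<beta>) *
            (\<Prod>k=1..m. x k powr (\<beta> / 2 - 1) * (1 - x k) powr (\<beta> / 2 * (real M - real m + 1) - 1))
            else 0) = fdens c ?I c x"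
    proof (cases "\<forall>k\<in>{1..m}. 0 < x k \<and> x k < 1")
      case True
      hence "(\<Prod>k=1..m. power_weight (\<lambda>t. if t < 1 then (1 - t) powr (b - 1) else 0) c (x k))
          = (\<Prod>k=1..m. x k powr (\<beta> / 2 - 1) * (1 - x k) powr (\<beta> / 2 * (real M - real m + 1) - 1))"
        by (intro prod.cong) (auto simp: power_weight_def c_def b_def)
      moreover have "vdm c ?I x = (\<Prod>k=1..m. \<Prod>j=1..<k. \<bar>x k - x j\<bar> powr \<beta>)"
        unfolding c_def by (rule vdm_atLeastAtMost)
      ultimately show ?thesis unfolding fdens_def if_P[OF True] by (simp only: mult.commute)
    next
      case False
      then obtain k where k: "k \<in> ?I" "x k \<le> 0 \<or> 1 \<le> x k" by fastforce
      have "power_weight (\<lambda>t. if t < 1 then (1 - t) powr (b - 1) else 0) c (x k) = 0"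
        using k by (auto simp: power_weight_def)
      hence "(\<Prod>k=1..m. power_weight (\<lambda>t. if t < 1 then (1 - t) powr (b - 1) else 0) c (x k)) = 0"
        using k by (intro prod_zero) blast+
      thus ?thesis using False by (auto simp: fdens_def)
    qed
  qed
  have P: "jacobi_ensemble \<beta> n1 n2 = normalized_density (lborel_pow ?I) (fdens c ?I c)"
    unfolding jacobi_ensemble_def Let_def m_def[symmetric] M_def[symmetric] dens ..
  have D: "jacobi_det n1 n2 = (\<lambda>y. \<Prod>i\<in>?I. y i)" by (simp add: jacobi_det_def fun_eq_iff m_def)
  define g where "g = (\<lambda>a. \<Prod>k<m. Gamma (a + c * real k) * inverse (Gamma (a + (b + c * (real m - 1 + real k)))))"
  have g: "gamma_like g (ratio c (card ?I))"
  proof -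
    have "gamma_like g (\<lambda>a. \<Prod>k<m. (a + c * real k) * inverse (a + (b + c * (real m - 1 + real k))))"
      unfolding g_def using c b
      by (intro gamma_like_prod gamma_like_mult gamma_like_inverse gamma_like_Gamma add_nonneg_nonneg mult_nonneg_nonneg) auto
    also have "(\<lambda>a. \<Prod>k<m. (a + c * real k) * inverse (a + (b + c * (real m - 1 + real k)))) = ratio c (card ?I)"
      by (simp add: ratio_def fun_eq_iff divide_inverse add.assoc)
    finally show ?thesis .
  qed
  have lim: "((\<lambda>a. ratio c (card ?I) (a + x) / ratio c (card ?I) a) \<longlongrightarrow> 1) at_top" for x
  proof -
    have R: "ratio c (card ?I) a = (\<Prod>k<m. (a + c * real k) / (a + b + c * (real m - 1 + real k)))" for a
      by (simp add: ratio_def)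
    have "((\<lambda>a. \<Prod>k<m. ((a + x + c * real k) / (a + x + b + c * (real m - 1 + real k))) /
        ((a + c * real k) / (a + b + c * (real m - 1 + real k)))) \<longlongrightarrow> (\<Prod>k<m. 1)) at_top"
      by (intro tendsto_prod) real_asymp
    thus ?thesis
      unfolding R prod_dividef by (simp only: prod.neutral_const)
  qed
  define s where "s = (\<lambda>k. c * real (Suc k))"
  define t where "t = (\<lambda>k. c * real (M + Suc k))"
  have st: "c \<le> s k" "c \<le> t k" for k using c by (auto simp: s_def t_def algebra_simps)
  define L where "L = (\<lambda>z. ln_Gamma_shifts {..<m} s z - ln_Gamma_shifts {..<m} t z)"
  have L_eq: "L z = ln_Gamma_sum c n1 z + ln_Gamma_sum c n2 z - ln_Gamma_sum c (n1 + n2) z" for z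
  proof -
    have "ln_Gamma_shifts {..<M + k} s z = ln_Gamma_shifts {..<M} s z + ln_Gamma_shifts {..<k} t z" for k
      by (induction k) (simp_all add: ln_Gamma_shifts_def s_def t_def)
    from this[of m] have "ln_Gamma_sum c n1 z + ln_Gamma_sum c n2 z - ln_Gamma_sum c (n1 + n2) z = L z"
      if "(n1 = m \<and> n2 = M) \<or> (n1 = M \<and> n2 = m)"
      using that unfolding L_def ln_Gamma_sum_eq_shifts s_def[symmetric] by (auto simp: add.commute)
    moreover have "(n1 = m \<and> n2 = M) \<or> (n1 = M \<and> n2 = m)" by (auto simp: m_def M_def)
    ultimately show ?thesis by simp
  qed
  have "log_mellin \<beta> (jacobi_ensemble \<beta> n1 n2) (jacobi_det n1 n2) z = L z"
    unfolding P D c_def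
  proof (rule log_mellin_normalized_fdens[OF \<beta> _ lim[unfolded c_def] g[unfolded c_def] _ _ _ z])
    show "L holomorphic_on half_plane (\<beta> / 2)"
      unfolding L_def using st by (intro holomorphic_intros holomorphic_ln_Gamma_shifts) (auto simp: c_def)
    show "L 0 = 0" by (simp add: L_def)
    fix x assume "- (\<beta> / 2) < x"
    hence x: "- c < x" by (simp add: c_def)
    have "exp (L (of_real x)) = of_real ((\<Prod>k<m. Gamma (s k + x) / Gamma (s k)) / (\<Prod>k<m. Gamma (t k + x) / Gamma (t k)))"
      unfolding L_def exp_diff exp_ln_Gamma_shifts_of_real[OF finite_lessThan st(1) c x]
        exp_ln_Gamma_shifts_of_real[OF finite_lessThan st(2) c x] by (simp only: of_real_divide)
    also have "(\<Prod>k<m. Gamma (s k + x) / Gamma (s k)) / (\<Prod>k<m. Gamma (t k + x) / Gamma (t k)) = g (c + x) / g c"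
      unfolding g_def prod_dividef[symmetric]
    proof (intro prod.cong refl)
      fix k
      have e: "c + x + c * real k = s k + x" "c + c * real k = s k"
        "c + x + (b + c * (real m - 1 + real k)) = t k + x" "c + (b + c * (real m - 1 + real k)) = t k"
        by (simp_all add: s_def t_def b_def algebra_simps)
      show "(Gamma (s k + x) / Gamma (s k)) / (Gamma (t k + x) / Gamma (t k))
         = Gamma (c + x + c * real k) * inverse (Gamma (c + x + (b + c * (real m - 1 + real k)))) /
           (Gamma (c + c * real k) * inverse (Gamma (c + (b + c * (real m - 1 + real k)))))"
        unfolding e by (simp add: divide_inverse)
    qed
    finally show "exp (L (of_real x)) = of_real (g (\<beta> / 2 + x) / g (\<beta> / 2))" by (simp only: c_def)
  qed simp
  thus ?thesis unfolding L_eq by (simp add: c_def)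
qed

lemma beta_density_moments:
  assumes a: "0 < a" and b: "0 < b"
  defines "N \<equiv> density lborel (\<lambda>t. ennreal (beta_density a b t))"
  shows prob_space_beta: "prob_space N"
    and AE_beta_pos: "AE t in N. 0 < t"
    and integrable_beta_powr: "- a < x \<Longrightarrow> integrable N (\<lambda>t. t powr x)"
    and integral_beta_powr: "- a < x \<Longrightarrow> (LINT t|N. t powr x) = Beta (a + x) b / Beta a b"
proof -
  have B: "0 < Beta a b" using a b by (simp add: Beta_def)
  have nn: "0 \<le> beta_density a b t" for t using B by (simp add: beta_density_def)
  have meas [measurable]: "beta_density a b \<in> borel_measurable borel"
    unfolding beta_density_def by measurable
  have eq: "beta_density a b t *\<^sub>R t powr x =
      (indicator {0..1} t *\<^sub>R (t powr (a + x - 1) * (1 - t) powr (b - 1))) / Beta a b" for t x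
  proof (cases "0 < t \<and> t < 1")
    case True
    have "t powr (a + x - 1) = t powr (a - 1) * t powr x"
      by (simp add: powr_add[symmetric] algebra_simps)
    thus ?thesis using True by (simp add: beta_density_def)
  qed (auto simp: beta_density_def indicator_def)
  have int: "integrable lborel (\<lambda>t. beta_density a b t *\<^sub>R t powr x)"
    "(LINT t|lborel. beta_density a b t *\<^sub>R t powr x) = Beta (a + x) b / Beta a b" if "- a < x" for x
  proof -
    have ax: "0 < a + x" using that by simp
    show "integrable lborel (\<lambda>t. beta_density a b t *\<^sub>R t powr x)"
      unfolding eq using integrable_Beta[OF ax b] by (intro integrable_divide) (simp add: set_integrable_def)
    have "(LINT t:{0..1}|lborel. t powr (a + x - 1) * (1 - t) powr (b - 1)) = Beta (a + x) b"
      using set_borel_integral_eq_integral(2)[OF integrable_Beta[OF ax b]] has_integral_Beta_real[OF ax b]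
      by (simp add: integral_unique)
    thus "(LINT t|lborel. beta_density a b t *\<^sub>R t powr x) = Beta (a + x) b / Beta a b"
      unfolding eq by (simp add: set_lebesgue_integral_def)
  qed
  have eq0: "beta_density a b t *\<^sub>R t powr 0 = beta_density a b t" for t
    by (auto simp: beta_density_def)
  show "prob_space N"
  proof (rule prob_spaceI)
    have "emeasure N (space N) = (\<integral>\<^sup>+ t. ennreal (beta_density a b t) \<partial>lborel)"
      unfolding N_def by (simp add: emeasure_density)
    also have "\<dots> = ennreal (LINT t|lborel. beta_density a b t)"
      using int(1)[of 0] a nn unfolding eq0 by (intro nn_integral_eq_integral) auto
    also have "(LINT t|lborel. beta_density a b t) = 1"
      using int(2)[of 0] a B unfolding eq0 by simp
    finally show "emeasure N (space N) = 1" by simp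
  qed
  show "AE t in N. 0 < t"
    unfolding N_def by (subst AE_density) (auto intro!: AE_I2 simp: beta_density_def split: if_splits)
  assume x: "- a < x"
  show "integrable N (\<lambda>t. t powr x)"
    unfolding N_def using int(1)[OF x] nn by (subst integrable_density) auto
  show "(LINT t|N. t powr x) = Beta (a + x) b / Beta a b"
    unfolding N_def using int(2)[OF x] nn by (subst integral_density) auto
qed

text \<open>
  The Beta parameters of $\rho_k$ have the sum $cn$ for every $k$; hence the denominators are all
  equal.  A further factor $\Gamma(cn + z) / \Gamma(cn)$ in numerator and denominator, formally that of
  $k = 1$, completes the numerator to the full product.
\<close>

lemma log_mellin_gram:
  assumes \<beta>: "0 < \<beta>" and n: "0 < n" and z: "z \<in> half_plane (\<beta> / 2)"
  shows "log_mellin \<beta> (gram_ensemble \<beta> n) (gram_det n) z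
       = ln_Gamma_sum (\<beta> / 2) n z -
         of_nat n * (ln_Gamma (of_real (\<beta> / 2 * real n) + z) - ln_Gamma (of_real (\<beta> / 2 * real n)))"
proof -
  define c where "c = \<beta> / 2"
  have c: "0 < c" using \<beta> by (simp add: c_def)
  let ?I = "{2..n}"
  define a where "a = (\<lambda>k. c * (real n - real k + 1))"
  define b where "b = (\<lambda>k. c * (real k - 1))"
  have ab: "c \<le> a k" "0 < a k" "0 < b k" "a k + b k = c * real n" if "k \<in> ?I" for k
  proof -
    have "c * 1 \<le> c * (real n - real k + 1)" using that c by (intro mult_left_mono) auto
    thus "c \<le> a k" by (simp add: a_def)
    thus "0 < a k" using c by simp
    show "0 < b k" using that c by (simp add: b_def)
    show "a k + b k = c * real n" by (simp add: a_def b_def algebra_simps)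
  qed
  \<comment> \<open>outside of the index set any probability measure will do\<close>
  define N where "N = (\<lambda>k. if k \<in> ?I then density lborel (\<lambda>t. ennreal (beta_density (a k) (b k) t)) else return lborel 0)"
  have prob: "prob_space (N k)" for k
    using prob_space_beta[OF ab(2,3)] by (auto simp: N_def intro!: prob_space_return)
  interpret product_sigma_finite N
    unfolding product_sigma_finite_def
    using prob_space.finite_measure[OF prob] finite_measure.axioms(1) by blast
  have P: "gram_ensemble \<beta> n = PiM ?I N"
    unfolding gram_ensemble_def by (intro PiM_cong refl) (simp add: N_def a_def b_def c_def)
  have D: "gram_det n = (\<lambda>y. \<Prod>i\<in>?I. y i)" by (simp add: gram_det_def fun_eq_iff)
  have comp: "(\<lambda>y. y k) \<in> borel_measurable (PiM ?I N)" if "k \<in> ?I" for k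
  proof -
    have "(\<lambda>y. y k) \<in> measurable (PiM ?I N) (N k)"
      using that by (rule measurable_component_singleton)
    also have "measurable (PiM ?I N) (N k) = borel_measurable (PiM ?I N)"
      using that by (intro measurable_cong_sets refl) (simp add: N_def)
    finally show ?thesis .
  qed
  have AE_pos: "AE y in PiM ?I N. \<forall>k\<in>?I. 0 < y k"
  proof (rule AE_finite_allI)
    fix k assume k: "k \<in> ?I"
    have Nk: "N k = density lborel (\<lambda>t. ennreal (beta_density (a k) (b k) t))"
      unfolding N_def using k by (rule if_P)
    have "AE t in N k. 0 < t" unfolding Nk by (rule AE_beta_pos[OF ab(2,3)[OF k]])
    thus "AE y in PiM ?I N. 0 < y k" by (rule AE_PiM_component[OF prob k])
  qed simp
  have cn: "c \<le> c * real n" using c n by simp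
  define L where "L = (\<lambda>z. ln_Gamma_shifts ?I a z - ln_Gamma_shifts ?I (\<lambda>_. c * real n) z)"
  have "log_mellin \<beta> (gram_ensemble \<beta> n) (gram_det n) z = L z"
  proof (rule log_mellin_eq[OF \<beta>])
    show "gram_det n \<in> borel_measurable (gram_ensemble \<beta> n)"
      unfolding P D by (intro borel_measurable_prod comp)
    show "AE \<omega> in gram_ensemble \<beta> n. 0 < gram_det n \<omega>"
      unfolding P D using AE_pos by eventually_elim (auto intro!: prod_pos)
    show "L holomorphic_on half_plane (\<beta> / 2)"
      unfolding L_def using ab cn by (intro holomorphic_intros holomorphic_ln_Gamma_shifts) (auto simp: c_def)
    show "L 0 = 0" by (simp add: L_def)
    fix x assume "- (\<beta> / 2) < x"
    hence x: "- c < x" by (simp add: c_def)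
    have int: "integrable (N k) (\<lambda>t. t powr x)"
      "(LINT t|N k. t powr x) = Beta (a k + x) (b k) / Beta (a k) (b k)" if "k \<in> ?I" for k
      using integrable_beta_powr[OF ab(2,3)[OF that]] integral_beta_powr[OF ab(2,3)[OF that]] ab(1)[OF that] x that
      by (auto simp: N_def)
    have eq: "AE y in PiM ?I N. (\<Prod>k\<in>?I. y k) powr x = (\<Prod>k\<in>?I. y k powr x)"
      using AE_pos by eventually_elim (auto simp: prod_powr_distrib less_imp_le)
    have meas: "(\<lambda>y. (\<Prod>k\<in>?I. y k) powr x) \<in> borel_measurable (PiM ?I N)"
      "(\<lambda>y. (\<Prod>k\<in>?I. y k powr x)) \<in> borel_measurable (PiM ?I N)"
    proof -
      have [measurable]: "(\<lambda>y. \<Prod>k\<in>?I. y k) \<in> borel_measurable (PiM ?I N)" by (intro borel_measurable_prod comp)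
      show "(\<lambda>y. (\<Prod>k\<in>?I. y k) powr x) \<in> borel_measurable (PiM ?I N)" by measurable
      have "(\<lambda>y. y k powr x) \<in> borel_measurable (PiM ?I N)" if "k \<in> ?I" for k
        using comp[OF that] by measurable
      thus "(\<lambda>y. (\<Prod>k\<in>?I. y k powr x)) \<in> borel_measurable (PiM ?I N)" by (intro borel_measurable_prod)
    qed
    show "integrable (gram_ensemble \<beta> n) (\<lambda>\<omega>. gram_det n \<omega> powr x)"
      unfolding P D
      by (subst integrable_cong_AE[OF meas eq]) (intro product_integrable_prod int finite_atLeastAtMost)
    have "(LINT \<omega>|gram_ensemble \<beta> n. gram_det n \<omega> powr x) = (LINT y|PiM ?I N. (\<Prod>k\<in>?I. y k powr x))"
      unfolding P D by (rule integral_cong_AE[OF meas eq])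
    also have "\<dots> = (\<Prod>k\<in>?I. LINT t|N k. t powr x)"
      by (intro product_integral_prod int finite_atLeastAtMost)
    also have "\<dots> = (\<Prod>k\<in>?I. (Gamma (a k + x) / Gamma (a k)) / (Gamma (c * real n + x) / Gamma (c * real n)))"
    proof (intro prod.cong refl)
      fix k assume k: "k \<in> ?I"
      have "Gamma (b k) \<noteq> 0" using ab(3)[OF k] by (metis Gamma_real_pos less_irrefl)
      moreover have e: "a k + x + b k = c * real n + x" using ab(4)[OF k] by simp
      ultimately show "(LINT t|N k. t powr x) = (Gamma (a k + x) / Gamma (a k)) / (Gamma (c * real n + x) / Gamma (c * real n))"
        unfolding int(2)[OF k] Beta_def ab(4)[OF k] e by simp
    qed
    also have "\<dots> = (\<Prod>k\<in>?I. Gamma (a k + x) / Gamma (a k)) / (\<Prod>k\<in>?I. Gamma (c * real n + x) / Gamma (c * real n))"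
      by (rule prod_dividef)
    also have "of_real \<dots> = exp (L (of_real x))"
    proof -
      have "exp (ln_Gamma_shifts ?I a (of_real x)) = of_real (\<Prod>k\<in>?I. Gamma (a k + x) / Gamma (a k))"
        using ab(1) c x by (intro exp_ln_Gamma_shifts_of_real) auto
      thus ?thesis
        unfolding L_def exp_diff exp_ln_Gamma_shifts_of_real[OF finite_atLeastAtMost cn c x]
        by (simp only: of_real_divide)
    qed
    finally show "exp (L (of_real x)) = of_real (LINT \<omega>|gram_ensemble \<beta> n. gram_det n \<omega> powr x)"
      by simp
  qed fact
  also have "L z = ln_Gamma_sum c n z -
         of_nat n * (ln_Gamma (of_real (c * real n) + z) - ln_Gamma (of_real (c * real n)))"
  proof -
    define T where "T = (\<lambda>k. ln_Gamma (of_real (c * real k) + z) - ln_Gamma (of_real (c * real k)) :: complex)"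
    have "(\<Sum>k\<in>?I. ln_Gamma (of_real (a k) + z) - ln_Gamma (of_real (a k))) = (\<Sum>j=1..n - 1. T j)"
    proof (rule sum.reindex_bij_witness[of _ "\<lambda>j. n + 1 - j" "\<lambda>k. n + 1 - k"])
      fix k assume "k \<in> ?I"
      hence e: "c * real (n + 1 - k) = a k" by (auto simp: a_def of_nat_diff algebra_simps)
      show "T (n + 1 - k) = ln_Gamma (of_real (a k) + z) - ln_Gamma (of_real (a k))" unfolding T_def e ..
    qed auto
    moreover have "{1..n} = insert n {1..n - 1}" using n by auto
    hence "ln_Gamma_sum c n z = T n + (\<Sum>j=1..n - 1. T j)"
      using n unfolding ln_Gamma_sum_def T_def[symmetric] by simp
    moreover have "L z = (\<Sum>k\<in>?I. ln_Gamma (of_real (a k) + z) - ln_Gamma (of_real (a k))) - (\<Sum>k\<in>?I. T n)"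
      unfolding L_def T_def ln_Gamma_shifts_def ..
    ultimately have "L z = ln_Gamma_sum c n z - T n - of_nat (n - 1) * T n" by simp
    also have "of_nat (n - 1) = (of_nat n - 1 :: complex)" using n by (simp add: of_nat_diff)
    finally show ?thesis by (simp add: T_def algebra_simps)
  qed
  finally show ?thesis by (simp add: c_def)
qed


section \<open>Binet's formula\<close>

lemma binet_phi_bounded: "\<exists>C\<ge>0. \<forall>s>0. \<bar>binet_phi s\<bar> \<le> C"
proof -
  have "(binet_phi \<longlongrightarrow> 1 / 12) (at_right 0)"
    unfolding binet_phi_def by real_asymp
  hence "eventually (\<lambda>s. dist (binet_phi s) (1 / 12) < 1) (at_right 0)"
    by (rule tendstoD) simp
  then obtain a where a: "0 < a" "\<And>s. 0 < s \<Longrightarrow> s < a \<Longrightarrow> dist (binet_phi s) (1 / 12) < 1"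
    by (auto simp: eventually_at_right_field)
  have "(binet_phi \<longlongrightarrow> 0) at_top"
    unfolding binet_phi_def by real_asymp
  hence "eventually (\<lambda>s. dist (binet_phi s) 0 < 1) at_top"
    by (rule tendstoD) simp
  then obtain b where b: "\<And>s. b \<le> s \<Longrightarrow> dist (binet_phi s) 0 < 1"
    by (auto simp: eventually_at_top_linorder)
  have "continuous_on {a..b} binet_phi"
    unfolding binet_phi_def using a by (intro continuous_intros) auto
  hence "bounded (binet_phi ` {a..b})"
    by (intro compact_imp_bounded compact_continuous_image) auto
  then obtain K where K: "\<And>s. s \<in> {a..b} \<Longrightarrow> norm (binet_phi s) \<le> K"
    unfolding bounded_iff by blast
  have "\<bar>binet_phi s\<bar> \<le> max K 2" if "0 < s" for s
  proof -
    consider "s < a" | "s \<in> {a..b}" | "b \<le> s" by force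
    thus ?thesis
    proof cases
      case 1
      thus ?thesis using a(2)[OF that 1] by (simp add: dist_real_def)
    next
      case 2
      thus ?thesis using K[OF 2] by simp
    next
      case 3
      thus ?thesis using b[OF 3] by (simp add: dist_real_def)
    qed
  qed
  thus ?thesis by (intro exI[of _ "max K 2"]) auto
qed

lemma borel_measurable_binet_phi [measurable]: "binet_phi \<in> borel_measurable borel"
  unfolding binet_phi_def by measurable

lemma set_integrable_dominated:
  fixes f :: "'a \<Rightarrow> complex" and g :: "'a \<Rightarrow> real"
  assumes "set_integrable M A g" "(\<lambda>x. indicator A x *\<^sub>R f x) \<in> borel_measurable M"
    and "\<And>x. x \<in> A \<Longrightarrow> norm (f x) \<le> g x"
  shows "set_integrable M A f"
    and "norm (set_lebesgue_integral M A f) \<le> set_lebesgue_integral M A g"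
proof -
  have le: "norm (indicator A x *\<^sub>R f x) \<le> indicator A x *\<^sub>R g x" for x
    using assms(3)[of x] by (simp add: indicator_def)
  show int: "set_integrable M A f"
    unfolding set_integrable_def
    by (rule Bochner_Integration.integrable_bound[OF assms(1)[unfolded set_integrable_def] assms(2)])
       (use le in \<open>auto intro!: AE_I2 intro: order_trans[OF _ abs_ge_self]\<close>)
  show "norm (set_lebesgue_integral M A f) \<le> set_lebesgue_integral M A g"
    unfolding set_lebesgue_integral_def
  proof (rule order_trans[OF integral_norm_bound], rule integral_mono)
    show "integrable M (\<lambda>x. norm (indicator A x *\<^sub>R f x))"
      using int unfolding set_integrable_def by (rule integrable_norm)
    show "integrable M (\<lambda>x. indicator A x *\<^sub>R g x)"
      using assms(1) unfolding set_integrable_def .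
  qed (rule le)
qed

lemma integral_exp_decay_complex:
  fixes z :: complex
  assumes "0 < Re z"
  shows "set_integrable lborel {0<..} (\<lambda>s. exp (- (of_real s * z)))"
    and "(LINT s:{0<..}|lborel. exp (- (of_real s * z))) = 1 / z"
proof -
  have z: "z \<noteq> 0" using assms by auto
  have eq: "einterval 0 \<infinity> = {0<..}" by (auto simp: einterval_def)
  show int: "set_integrable lborel {0<..} (\<lambda>s. exp (- (of_real s * z)))"
    by (rule set_integrable_dominated[OF set_integrable_exp_decay(1)[OF assms]]) auto
  have "(LBINT s=0..\<infinity>. exp (- (of_real s * z))) = 0 - (- exp (- (of_real 0 * z)) / z)"
  proof (rule interval_integral_FTC_integrable[where F = "\<lambda>s. - exp (- (of_real s * z)) / z"])
    show "((\<lambda>s. - exp (- (of_real s * z)) / z) has_vector_derivative exp (- (of_real s * z))) (at s)" for s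
      using z by (auto intro!: derivative_eq_intros has_vector_derivative_real_field)
    show "set_integrable lborel (einterval 0 \<infinity>) (\<lambda>s. exp (- (of_real s * z)))"
      unfolding eq by (rule int)
    have "((\<lambda>s::real. - exp (- (of_real s * z)) / z) \<longlongrightarrow> - exp (- (of_real 0 * z)) / z) (at_right 0)"
      using z by (intro tendsto_intros)
    thus "(((\<lambda>s. - exp (- (of_real s * z)) / z) \<circ> real_of_ereal) \<longlongrightarrow> - exp (- (of_real 0 * z)) / z) (at_right 0)"
      by (simp add: zero_ereal_def ereal_tendsto_simps)
    have "((\<lambda>s::real. - exp (- (of_real s * z)) / z) \<longlongrightarrow> 0) at_top"
    proof (rule Lim_null_comparison)
      show "\<forall>\<^sub>F s in at_top. norm (- exp (- (of_real s * z)) / z) \<le> exp (- (s * Re z)) / norm z"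
        by (simp add: norm_divide)
      show "((\<lambda>s. exp (- (s * Re z)) / norm z) \<longlongrightarrow> 0) at_top"
        using assms z by real_asymp
    qed
    thus "(((\<lambda>s. - exp (- (of_real s * z)) / z) \<circ> real_of_ereal) \<longlongrightarrow> 0) (at_left \<infinity>)"
      by (simp add: ereal_tendsto_simps)
  qed (auto intro!: continuous_intros)
  thus "(LINT s:{0<..}|lborel. exp (- (of_real s * z))) = 1 / z"
    by (simp add: interval_lebesgue_integral_def eq)
qed

text \<open>
  The remainder in Binet's first formula for $\ln\Gamma$.
\<close>

definition binet :: "complex \<Rightarrow> complex" where
  "binet z = (LINT s:{0<..}|lborel. of_real (binet_phi s) * exp (- (of_real s * z)))"

lemma set_integrable_binet:
  assumes "0 < Re z"
  shows "set_integrable lborel {0<..} (\<lambda>s. of_real (binet_phi s) * exp (- (of_real s * z)))"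
proof -
  obtain C where C: "0 \<le> C" "\<And>s. 0 < s \<Longrightarrow> \<bar>binet_phi s\<bar> \<le> C" using binet_phi_bounded by blast
  show ?thesis
  proof (rule set_integrable_dominated)
    show "set_integrable lborel {0<..} (\<lambda>s. C * exp (- (s * Re z)))"
      using set_integrable_exp_decay(1)[OF assms] by simp
  qed (use C in \<open>auto simp: norm_mult intro!: mult_right_mono\<close>)
qed

lemma norm_binet_le: "\<exists>C. \<forall>z. 0 < Re z \<longrightarrow> norm (binet z) \<le> C / Re z"
proof -
  obtain C where C: "0 \<le> C" "\<And>s. 0 < s \<Longrightarrow> \<bar>binet_phi s\<bar> \<le> C" using binet_phi_bounded by blast
  have "norm (binet z) \<le> C / Re z" if "0 < Re z" for z
  proof -
    have "norm (binet z) \<le> (LINT s:{0<..}|lborel. C * exp (- (s * Re z)))"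
      unfolding binet_def
    proof (rule set_integrable_dominated)
      show "set_integrable lborel {0<..} (\<lambda>s. C * exp (- (s * Re z)))"
        using set_integrable_exp_decay(1)[OF that] by simp
    qed (use C in \<open>auto simp: norm_mult intro!: mult_right_mono\<close>)
    also have "\<dots> = C / Re z" using set_integrable_exp_decay(2)[OF that] by simp
    finally show ?thesis .
  qed
  thus ?thesis by blast
qed

text \<open>
  With this representation the decrement of the Binet integral becomes an elementary double
  integral.
\<close>

lemma binet_phi_telescope:
  assumes "0 < s"
  shows "(LINT t:{0..1}|lborel. (1 / 2 - t) * exp (- (s * t))) = binet_phi s * (1 - exp (- s))"
proof -
  let ?F = "\<lambda>t. exp (- (s * t)) * ((t - 1 / 2) / s + 1 / s\<^sup>2)"
  have "(LINT t:{0..1}|lborel. (1 / 2 - t) * exp (- (s * t))) = ?F 1 - ?F 0"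
    unfolding set_lebesgue_integral_def
  proof (rule integral_FTC_atLeastAtMost)
    fix t :: real
    have "(?F has_real_derivative (1 / 2 - t) * exp (- (s * t))) (at t within {0..1})"
      using assms by (auto intro!: derivative_eq_intros simp: field_simps power2_eq_square)
    thus "(?F has_vector_derivative (1 / 2 - t) * exp (- (s * t))) (at t within {0..1})"
      by (simp add: has_real_derivative_iff_has_vector_derivative)
  qed (auto intro!: continuous_intros)
  also have "\<dots> = binet_phi s * (1 - exp (- s))"
  proof -
    have "exp s \<noteq> 1" using assms by simp
    thus ?thesis using assms
      by (simp add: binet_phi_def exp_minus divide_simps power2_eq_square) (simp add: algebra_simps)
  qed
  finally show ?thesis .
qed

text \<open>
  By Fubini the left-hand side is $\int_0^1 (\frac12 - t) / (z + t)\, dt$.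
\<close>

lemma binet_diff:
  assumes z: "0 < Re z"
  shows "binet z - binet (z + 1) = (z + 1 / 2) * (Ln (z + 1) - Ln z) - 1"
proof -
  define f where "f = (\<lambda>s t. indicator {0<..} s *\<^sub>R indicator {0..1} t *\<^sub>R
     (of_real (1 / 2 - t) * exp (- (of_real s * (z + of_real t)))) :: complex)"
  have f_le: "norm (f s t) \<le> (indicator {0<..} s *\<^sub>R exp (- (s * Re z))) * indicator {0..1} t" for s t
  proof (cases "0 < s \<and> t \<in> {0..1}")
    case True
    have "norm (f s t) = \<bar>1 / 2 - t\<bar> * exp (- (s * (Re z + t)))"
      using True by (simp add: f_def norm_mult del: of_real_diff of_real_divide)
    also have "\<dots> \<le> 1 * exp (- (s * Re z))"
      using True by (intro mult_mono) (auto simp: abs_if algebra_simps)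
    finally show ?thesis using True by simp
  qed (auto simp: f_def)
  have f_meas [measurable]: "case_prod f \<in> borel_measurable (lborel \<Otimes>\<^sub>M lborel)"
    unfolding f_def by measurable
  have int_1: "integrable lborel (\<lambda>s. indicator {0<..} s *\<^sub>R exp (- (s * Re z)))"
    using set_integrable_exp_decay(1)[OF z] by (simp add: set_integrable_def)
  have f_int: "integrable lborel (f s)" for s
  proof (rule Bochner_Integration.integrable_bound)
    show "integrable lborel (\<lambda>t::real. (indicator {0<..} s *\<^sub>R exp (- (s * Re z))) * indicator {0..1} t)"
      by (intro integrable_mult_right integrable_real_indicator) auto
    show "f s \<in> borel_measurable lborel" unfolding f_def by measurable
  qed (auto intro!: AE_I2 order_trans[OF f_le])
  have "integrable (lborel \<Otimes>\<^sub>M lborel) (case_prod f)"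
  proof (rule lborel_pair.Fubini_integrable)
    show "integrable lborel (\<lambda>s. LINT t|lborel. norm (case_prod f (s, t)))"
    proof (rule Bochner_Integration.integrable_bound[OF int_1])
      show "AE s in lborel. norm (LINT t|lborel. norm (case_prod f (s, t))) \<le> norm (indicator {0<..} s *\<^sub>R exp (- (s * Re z)))"
      proof (rule AE_I2)
        fix s
        have "(LINT t|lborel. norm (f s t)) \<le> (LINT t|lborel. (indicator {0<..} s *\<^sub>R exp (- (s * Re z))) * indicator {0..1::real} t)"
          using f_int[of s] f_le by (intro integral_mono integrable_norm integrable_mult_right integrable_real_indicator) auto
        also have "\<dots> = indicator {0<..} s *\<^sub>R exp (- (s * Re z))" by simp
        finally show "norm (LINT t|lborel. norm (case_prod f (s, t))) \<le> norm (indicator {0<..} s *\<^sub>R exp (- (s * Re z)))"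
          by simp
      qed
    qed measurable
  qed (use f_int in auto)
  hence fubini: "(LINT t|lborel. LINT s|lborel. f s t) = (LINT s|lborel. LINT t|lborel. f s t)"
    by (rule lborel_pair.Fubini_integral)
  have z1: "0 < Re (z + 1)" using z by simp
  have "binet z - binet (z + 1) = (LINT s:{0<..}|lborel. of_real (binet_phi s) * exp (- (of_real s * z))
         - of_real (binet_phi s) * exp (- (of_real s * (z + 1))))"
    unfolding binet_def using set_integrable_binet[OF z] set_integrable_binet[OF z1]
    by (intro set_integral_diff(2)[symmetric])
  also have "\<dots> = (LINT s|lborel. LINT t|lborel. f s t)"
    unfolding set_lebesgue_integral_def
  proof (intro Bochner_Integration.integral_cong refl)
    fix s :: real
    show "indicator {0<..} s *\<^sub>R (of_real (binet_phi s) * exp (- (of_real s * z)) - of_real (binet_phi s) * exp (- (of_real s * (z + 1))))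
        = (LINT t|lborel. f s t)"
    proof (cases "0 < s")
      case True
      have "f s t = exp (- (of_real s * z)) * of_real (indicator {0..1} t *\<^sub>R ((1 / 2 - t) * exp (- (s * t))))" for t
        using True by (simp add: f_def indicator_def exp_of_real[symmetric] mult_exp_exp algebra_simps)
      hence "(LINT t|lborel. f s t) = exp (- (of_real s * z)) * of_real (LINT t:{0..1}|lborel. (1 / 2 - t) * exp (- (s * t)))"
        unfolding set_lebesgue_integral_def
        by (simp only: integral_mult_right_zero integral_complex_of_real)
      also have "\<dots> = of_real (binet_phi s) * (exp (- (of_real s * z)) * (1 - exp (- of_real s)))"
        unfolding binet_phi_telescope[OF True] by (simp add: exp_of_real[symmetric])
      also have "exp (- (of_real s * z)) * (1 - exp (- of_real s)) = exp (- (of_real s * z)) - exp (- (of_real s * (z + 1)))"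
        by (simp add: algebra_simps mult_exp_exp)
      finally show ?thesis using True by (simp add: algebra_simps)
    qed (simp add: f_def)
  qed
  also have "\<dots> = (LINT t|lborel. LINT s|lborel. f s t)" by (rule fubini[symmetric])
  also have "\<dots> = (LINT t|lborel. indicator {0..1} t *\<^sub>R (of_real (1 / 2 - t) / (z + of_real t)))"
  proof (intro Bochner_Integration.integral_cong refl)
    fix t :: real
    show "(LINT s|lborel. f s t) = indicator {0..1} t *\<^sub>R (of_real (1 / 2 - t) / (z + of_real t))"
    proof (cases "t \<in> {0..1}")
      case True
      have "(LINT s|lborel. f s t) = (LINT s:{0<..}|lborel. of_real (1 / 2 - t) * exp (- (of_real s * (z + of_real t))))"
        unfolding set_lebesgue_integral_def f_def using True by simp
      also have "\<dots> = of_real (1 / 2 - t) * (LINT s:{0<..}|lborel. exp (- (of_real s * (z + of_real t))))"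
        by (rule set_integral_mult_right)
      finally have "(LINT s|lborel. f s t) = of_real (1 / 2 - t) * (LINT s:{0<..}|lborel. exp (- (of_real s * (z + of_real t))))" .
      thus ?thesis using True z by (subst (asm) integral_exp_decay_complex(2)) auto
    qed (simp add: f_def)
  qed
  also have "\<dots> = ((z + 1 / 2) * Ln (z + of_real 1) - of_real 1) - ((z + 1 / 2) * Ln (z + of_real 0) - of_real 0)"
  proof (rule integral_FTC_atLeastAtMost)
    fix t :: real assume t: "0 \<le> t" "t \<le> 1"
    have nz: "z + of_real t \<notin> \<real>\<^sub>\<le>\<^sub>0" "z + of_real t \<noteq> 0"
      using z t by (auto simp: complex_nonpos_Reals_iff complex_eq_iff)
    have "((\<lambda>t. Ln (z + t)) has_field_derivative inverse (z + of_real t) * (0 + 1)) (at (of_real t))"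
      by (rule DERIV_chain2[of Ln, OF has_field_derivative_Ln[OF nz(1)] DERIV_add[OF DERIV_const DERIV_ident]])
    hence "((\<lambda>t. Ln (z + t)) has_field_derivative 1 / (z + of_real t)) (at (of_real t))"
      by (simp add: inverse_eq_divide)
    hence "((\<lambda>t. (z + 1 / 2) * Ln (z + t) - t) has_field_derivative (z + 1 / 2) * (1 / (z + of_real t)) - 1) (at (of_real t))"
      by (intro DERIV_diff DERIV_cmult DERIV_ident)
    also have "(z + 1 / 2) * (1 / (z + of_real t)) - 1 = ((z + 1 / 2) - (z + of_real t)) / (z + of_real t)"
      using nz(2) by (simp only: diff_divide_distrib) simp
    also have "(z + 1 / 2) - (z + of_real t) = of_real (1 / 2 - t)" by simp
    finally have "((\<lambda>t. (z + 1 / 2) * Ln (z + t) - t) has_field_derivative of_real (1 / 2 - t) / (z + of_real t)) (at (of_real t))" .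
    thus "((\<lambda>t. (z + 1 / 2) * Ln (z + of_real t) - of_real t) has_vector_derivative of_real (1 / 2 - t) / (z + of_real t)) (at t within {0..1})"
      by (rule has_vector_derivative_real_field)
  next
    show "continuous_on {0..1} (\<lambda>t. complex_of_real (1 / 2 - t) / (z + of_real t))"
      using z by (intro continuous_intros) (auto simp: complex_eq_iff)
  qed simp
  finally show ?thesis by (simp add: algebra_simps)
qed

lemma Ln_add_of_nat:
  assumes "0 < Re z" "0 < k"
  shows "Ln (z / of_nat k + 1) = Ln (z + of_nat k) - of_real (ln (real k))"
proof -
  have "z / of_nat k + 1 = (z + of_nat k) / of_real (real k)" using assms by (simp add: field_simps)
  also have "Ln \<dots> = Ln (z + of_nat k) - of_real (ln (real k))"
    using assms by (intro Ln_divide_of_real) (auto simp: complex_eq_iff)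
  finally show ?thesis .
qed

text \<open>
  The series that defines \<open>ln_Gamma\<close>, written with the values \<open>Ln (z + k)\<close> that also
  occur in the functional equation.
\<close>

lemma ln_Gamma_series_eq:
  assumes "0 < Re z" "0 < n"
  shows "ln_Gamma_series z n = z * of_real (ln (real n)) + of_real (ln (fact n)) - (\<Sum>k=0..n. Ln (z + of_nat k))"
proof -
  have "(\<Sum>k=1..n. ln (z / of_nat k + 1)) = (\<Sum>k=1..n. Ln (z + of_nat k)) - (\<Sum>k=1..n. of_real (ln (real k)))"
    unfolding sum_subtractf[symmetric] using assms by (intro sum.cong Ln_add_of_nat refl) auto
  moreover have "(\<Sum>k=1..n. complex_of_real (ln (real k))) = of_real (ln (fact n))"
    by (induction n) (simp_all add: ln_mult)
  moreover have "(\<Sum>k=0..n. Ln (z + of_nat k)) = Ln z + (\<Sum>k=1..n. Ln (z + of_nat k))"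
    by (simp add: sum.atLeast_Suc_atMost)
  moreover have "ln (of_nat n) = complex_of_real (ln (real n))"
    using assms Ln_of_real[of "real n"] by simp
  ultimately show ?thesis unfolding ln_Gamma_series_def by simp
qed

lemma ln_Gamma_plus1:
  assumes z: "0 < Re z"
  shows "ln_Gamma (z + 1) = ln_Gamma z + Ln z"
proof -
  have notin: "w \<notin> \<int>\<^sub>\<le>\<^sub>0" if "0 < Re w" for w :: complex
    using that by (auto elim!: nonpos_Ints_cases)
  have z1: "0 < Re (z + 1)" using z by simp
  have lim1: "(\<lambda>n. ln_Gamma_series (z + 1) n - ln_Gamma_series z n) \<longlonglongrightarrow> ln_Gamma (z + 1) - ln_Gamma z"
    by (intro tendsto_diff ln_Gamma_complex_LIMSEQ notin z z1)
  have ev: "eventually (\<lambda>n. ln_Gamma_series (z + 1) n - ln_Gamma_series z n = Ln z - Ln ((z + 1) / of_nat n + 1)) sequentially"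
    using eventually_gt_at_top[of 0]
  proof eventually_elim
    case (elim n)
    have "(\<Sum>k=0..n. Ln (z + 1 + of_nat k)) = (\<Sum>k=0..n. Ln (z + of_nat (Suc k)))"
      by (simp add: add_ac)
    also have "\<dots> = (\<Sum>k=1..Suc n. Ln (z + of_nat k))"
      by (rule sum.reindex_bij_witness[of _ "\<lambda>k. k - 1" Suc]) auto
    also have "\<dots> = (\<Sum>k=0..n. Ln (z + of_nat k)) + Ln (z + of_nat (Suc n)) - Ln z"
      by (simp add: sum.atLeast_Suc_atMost[of 0 n])
    finally have "ln_Gamma_series (z + 1) n - ln_Gamma_series z n
        = of_real (ln (real n)) - (Ln (z + of_nat (Suc n)) - Ln z)"
      unfolding ln_Gamma_series_eq[OF z elim] ln_Gamma_series_eq[OF z1 elim]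
      by (simp add: algebra_simps)
    moreover have "z + of_nat (Suc n) = z + 1 + of_nat n" by simp
    ultimately show ?case unfolding Ln_add_of_nat[OF z1 elim] by (simp add: add.assoc)
  qed
  have lim2: "(\<lambda>n. Ln z - Ln ((z + 1) / of_nat n + 1)) \<longlonglongrightarrow> Ln z - Ln (0 + 1)"
    by (intro tendsto_intros tendsto_divide_0[OF tendsto_const] tendsto_of_nat) auto
  have "ln_Gamma (z + 1) - ln_Gamma z = Ln z - Ln (0 + 1)"
    by (rule LIMSEQ_unique[OF Lim_transform_eventually[OF lim1 ev] lim2])
  thus ?thesis by (simp add: algebra_simps)
qed

lemma ln_Gamma_add_of_nat:
  assumes z: "0 < Re z"
  shows "ln_Gamma (z + of_nat n) = ln_Gamma z + (\<Sum>k<n. Ln (z + of_nat k))"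
proof (induction n)
  case (Suc n)
  have "ln_Gamma ((z + of_nat n) + 1) = ln_Gamma (z + of_nat n) + Ln (z + of_nat n)"
    using z by (intro ln_Gamma_plus1) auto
  thus ?case using Suc by (simp add: add_ac)
qed simp

lemma ln_Gamma_shift_asymptotics:
  assumes z: "0 < Re z"
  shows "(\<lambda>n. ln_Gamma (z + of_nat (Suc n)) - of_real (ln (fact n)) - z * of_real (ln (real n))) \<longlonglongrightarrow> 0"
proof -
  have "z \<notin> \<int>\<^sub>\<le>\<^sub>0" using z by (auto elim!: nonpos_Ints_cases)
  hence "(\<lambda>n. ln_Gamma z - ln_Gamma_series z n) \<longlonglongrightarrow> ln_Gamma z - ln_Gamma z"
    by (intro tendsto_intros ln_Gamma_complex_LIMSEQ)
  moreover have "eventually (\<lambda>n. ln_Gamma z - ln_Gamma_series z n =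
     ln_Gamma (z + of_nat (Suc n)) - of_real (ln (fact n)) - z * of_real (ln (real n))) sequentially"
    using eventually_gt_at_top[of 0]
  proof eventually_elim
    case (elim n)
    have "{0..n} = {..<Suc n}" by auto
    thus ?case unfolding ln_Gamma_series_eq[OF z elim] ln_Gamma_add_of_nat[OF z] by simp
  qed
  ultimately have "(\<lambda>n. ln_Gamma (z + of_nat (Suc n)) - of_real (ln (fact n)) - z * of_real (ln (real n)))
      \<longlonglongrightarrow> ln_Gamma z - ln_Gamma z"
    by (rule Lim_transform_eventually)
  thus ?thesis by simp
qed

definition stirling_main :: "complex \<Rightarrow> complex" where
  "stirling_main z = (z - 1 / 2) * Ln z - z"

text \<open>
  A joint limit in numerator and denominator; the proof passes to the quotient $\ln(1 + w) / w$,
  which is continuous at $0$ with value $1$.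
\<close>

lemma tendsto_Ln_div:
  assumes "(g \<longlongrightarrow> a) F" "filterlim h at_infinity F" "(k \<longlongrightarrow> b) F"
  shows "((\<lambda>x. (h x + k x) * Ln (1 + g x / h x)) \<longlongrightarrow> a) F"
proof -
  define q where "q = (\<lambda>w::complex. if w = 0 then 1 else Ln (1 + w) / w)"
  have "((\<lambda>w. Ln (1 + w)) has_field_derivative 1) (at 0)"
    by (auto intro!: derivative_eq_intros)
  hence "((\<lambda>w. Ln (1 + w) / w) \<longlongrightarrow> 1) (at (0::complex))"
    by (simp add: has_field_derivative_iff)
  hence "isCont q 0"
    unfolding isCont_def q_def by (auto intro: Lim_transform_eventually simp: eventually_at_filter)
  moreover have gh: "((\<lambda>x. g x / h x) \<longlongrightarrow> 0) F"
    using assms tendsto_divide_0 by blast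
  ultimately have "((\<lambda>x. q (g x / h x)) \<longlongrightarrow> q 0) F"
    using isCont_tendsto_compose by blast
  moreover have "((\<lambda>x. 1 + k x / h x) \<longlongrightarrow> 1 + 0) F"
    using assms by (intro tendsto_intros tendsto_divide_0)
  ultimately have "((\<lambda>x. (1 + k x / h x) * g x * q (g x / h x)) \<longlongrightarrow> (1 + 0) * a * q 0) F"
    by (intro tendsto_mult assms)
  moreover have "eventually (\<lambda>x. (1 + k x / h x) * g x * q (g x / h x) = (h x + k x) * Ln (1 + g x / h x)) F"
  proof -
    have "eventually (\<lambda>x. h x \<noteq> 0) F" using assms(2) by (rule filterlim_at_infinity_imp_eventually_ne)
    thus ?thesis by eventually_elim (auto simp: q_def field_simps)
  qed
  ultimately show ?thesis by (simp add: q_def Lim_transform_eventually)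
qed

lemma stirling_main_shift:
  assumes u: "((\<lambda>x. u x) \<longlongrightarrow> u0) F" and n: "filterlim n at_top F"
    and pos: "eventually (\<lambda>x. 0 < Re (1 + u x)) F"
  shows "((\<lambda>x. stirling_main (1 + u x + of_nat (n x)) -
            ((of_nat (n x) + 1 / 2 + u x) * of_real (ln (real (n x))) - of_nat (n x))) \<longlongrightarrow> 0) F"
proof -
  have inf: "filterlim (\<lambda>x. of_nat (n x) :: complex) at_infinity F"
    by (rule filterlim_compose[OF tendsto_of_nat n])
  have "((\<lambda>x. (of_nat (n x) + (1 / 2 + u x)) * Ln (1 + (1 + u x) / of_nat (n x))) \<longlongrightarrow> 1 + u0) F"
    by (rule tendsto_Ln_div[OF tendsto_add[OF tendsto_const u] inf tendsto_add[OF tendsto_const u]])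
  hence "((\<lambda>x. (of_nat (n x) + (1 / 2 + u x)) * Ln (1 + (1 + u x) / of_nat (n x)) - (1 + u x)) \<longlongrightarrow> 1 + u0 - (1 + u0)) F"
    by (intro tendsto_intros u)
  moreover have "eventually (\<lambda>x. (of_nat (n x) + (1 / 2 + u x)) * Ln (1 + (1 + u x) / of_nat (n x)) - (1 + u x) =
     stirling_main (1 + u x + of_nat (n x)) -
            ((of_nat (n x) + 1 / 2 + u x) * of_real (ln (real (n x))) - of_nat (n x))) F"
    using pos eventually_compose_filterlim[OF eventually_gt_at_top[of 0] n]
  proof eventually_elim
    case (elim x)
    have L: "Ln (1 + u x + of_nat (n x)) = Ln (1 + (1 + u x) / of_nat (n x)) + of_real (ln (real (n x)))"
      using Ln_add_of_nat[OF elim(1), of "n x"] elim(2) by (simp add: add.commute)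
    show ?case unfolding stirling_main_def L by (simp add: field_simps)
  qed
  ultimately show ?thesis by (simp add: Lim_transform_eventually)
qed

lemma binet_tendsto_0:
  assumes "filterlim (\<lambda>x. Re (f x)) at_top F"
  shows "((\<lambda>x. binet (f x)) \<longlongrightarrow> 0) F"
proof -
  obtain C where C: "\<And>z. 0 < Re z \<Longrightarrow> norm (binet z) \<le> C / Re z" using norm_binet_le by blast
  show ?thesis
  proof (rule Lim_null_comparison)
    show "eventually (\<lambda>x. norm (binet (f x)) \<le> C / Re (f x)) F"
      using assms[THEN filterlim_at_top_dense[THEN iffD1], rule_format, of 0]
      by eventually_elim (rule C)
    show "((\<lambda>x. C / Re (f x)) \<longlongrightarrow> 0) F"
      by (intro tendsto_divide_0[OF tendsto_const] filterlim_at_top_imp_at_infinity assms)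
  qed
qed

text \<open>
  The difference of the two sides of Binet's formula has period 1 because of \<open>binet_diff\<close>; hence it
  is equal to its limit along \<open>z + n\<close>, which does not depend on \<open>z\<close>.
\<close>

lemma binet_formula_const:
  assumes z: "0 < Re z"
  shows "ln_Gamma z - stirling_main z - binet z = 1 - binet 1"
proof -
  define h where "h = (\<lambda>z. ln_Gamma z - stirling_main z - binet z)"
  have h_Suc: "h (z + 1) = h z" if "0 < Re z" for z
  proof -
    have d: "binet z = binet (z + 1) + ((z + 1 / 2) * (Ln (z + 1) - Ln z) - 1)"
      using binet_diff[OF that] by (simp only: diff_eq_eq add.commute)
    show ?thesis unfolding h_def stirling_main_def ln_Gamma_plus1[OF that] d by (simp add: field_simps)
  qed
  have h_add: "h (z + of_nat n) = h z" if "0 < Re z" for z n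
  proof (induction n)
    case (Suc n)
    have "h ((z + of_nat n) + 1) = h (z + of_nat n)" using that by (intro h_Suc) auto
    thus ?case using Suc by (simp add: add_ac)
  qed simp
  define a where "a = (\<lambda>(z::complex) n. ln_Gamma (z + of_nat (Suc n)) - of_real (ln (fact n)) - z * of_real (ln (real n)))"
  define b where "b = (\<lambda>(z::complex) n. stirling_main (1 + z + of_nat n) - ((of_nat n + 1 / 2 + z) * of_real (ln (real n)) - of_nat n))"
  have lim: "(\<lambda>n. a z n - b z n - binet (z + of_nat (Suc n))) \<longlonglongrightarrow> 0 - 0 - 0" if "0 < Re z" for z
  proof (intro tendsto_diff)
    show "a z \<longlonglongrightarrow> 0" unfolding a_def by (rule ln_Gamma_shift_asymptotics[OF that])
    show "b z \<longlonglongrightarrow> 0" unfolding b_def using that by (intro stirling_main_shift filterlim_ident tendsto_const) auto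
    have "filterlim (\<lambda>n. Re z + 1 + real n) at_top sequentially"
      by (intro filterlim_tendsto_add_at_top[OF tendsto_const] filterlim_real_sequentially)
    thus "(\<lambda>n. binet (z + of_nat (Suc n))) \<longlonglongrightarrow> 0"
      by (intro binet_tendsto_0) (simp add: add_ac)
  qed
  have eq: "a z n - b z n - binet (z + of_nat (Suc n)) = h z
      + ((of_nat n + 1 / 2) * of_real (ln (real n)) - of_nat n - of_real (ln (fact n)))" if "0 < Re z" for z n
  proof -
    have "1 + z + of_nat n = z + of_nat (Suc n)" by simp
    thus ?thesis using h_add[OF that, of "Suc n", symmetric] unfolding a_def b_def h_def
      by (simp only:) (simp add: algebra_simps)
  qed
  have one: "0 < Re (1::complex)" by simp
  have "(\<lambda>n. (a z n - b z n - binet (z + of_nat (Suc n))) - (a 1 n - b 1 n - binet (1 + of_nat (Suc n))))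
      \<longlonglongrightarrow> (0 - 0 - 0) - (0 - 0 - 0)"
    by (intro tendsto_diff[OF lim[OF z] lim[OF one]])
  moreover have "(a z n - b z n - binet (z + of_nat (Suc n))) - (a 1 n - b 1 n - binet (1 + of_nat (Suc n))) = h z - h 1" for n
    unfolding eq[OF z] eq[OF one] by simp
  ultimately have "(\<lambda>n::nat. h z - h 1) \<longlonglongrightarrow> 0" by simp
  hence "h z = h 1" by (simp add: LIMSEQ_const_iff)
  also have "h 1 = 1 - binet 1"
    using ln_Gamma_complex_conv_fact[of 1] by (simp add: h_def stirling_main_def)
  finally show ?thesis by (simp add: h_def)
qed

text \<open>
  The constant follows from Legendre's duplication formula at large integers.
\<close>

lemma binet_formula:
  assumes z: "0 < Re z"
  shows "ln_Gamma z = stirling_main z + of_real (ln (2 * pi) / 2) + binet z"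
proof -
  define K where "K = 1 - binet 1"
  have lnG: "ln_Gamma z = stirling_main z + K + binet z" if "0 < Re z" for z
    using binet_formula_const[OF that] by (simp add: K_def algebra_simps)
  have "binet 1 = of_real (LINT s:{0<..}|lborel. binet_phi s * exp (- s))"
    unfolding binet_def set_lebesgue_integral_def integral_complex_of_real[symmetric]
    by (intro Bochner_Integration.integral_cong refl) (simp add: exp_of_real[symmetric] scaleR_conv_of_real)
  then obtain k where k: "K = of_real k" unfolding K_def by (metis of_real_1 of_real_diff)
  define E where "E = (\<lambda>n. binet (of_nat n) + binet (of_nat n + 1 / 2) - binet (2 * of_nat n))"
  \<comment> \<open>the elementary terms that remain when Binet's formula is inserted in the duplication formula\<close>
  define A where "A = (\<lambda>n. real n * ln (1 + 1 / (2 * real n)) - 1 / 2 - (2 * real n - 1 / 2) * ln 2)"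
  have ev: "eventually (\<lambda>n. exp (of_real k + of_real (A n + (2 * real n - 1) * ln 2) + E n) = of_real (sqrt pi)) sequentially"
    using eventually_gt_at_top[of 0]
  proof eventually_elim
    case (elim n)
    have notin: "w \<notin> \<int>\<^sub>\<le>\<^sub>0" if "0 < Re w" for w :: complex
      using that by (auto elim!: nonpos_Ints_cases)
    have G: "Gamma w = exp (ln_Gamma w)" if "0 < Re w" for w :: complex
      using notin[OF that] by (simp add: Gamma_complex_altdef)
    define N where "N = complex_of_nat n"
    have N: "0 < Re N" "0 < Re (N + 1 / 2)" "0 < Re (2 * N)" using elim by (auto simp: N_def)
    have leg: "exp (ln_Gamma N) * exp (ln_Gamma (N + 1 / 2)) = exp ((1 - 2 * N) * of_real (ln 2)) * of_real (sqrt pi) * exp (ln_Gamma (2 * N))"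
      using Gamma_legendre_duplication[of N] notin[OF N(1)] notin[OF N(2)] N by (simp only: G) auto
    have aux: "X * Y / U / W = S" if "X * Y = W * S * U" "U \<noteq> 0" "W \<noteq> 0" for X Y U W S :: complex
      using that by (simp add: field_simps)
    have "exp (ln_Gamma N + ln_Gamma (N + 1 / 2) - ln_Gamma (2 * N) - (1 - 2 * N) * of_real (ln 2)) = of_real (sqrt pi)"
      unfolding exp_add exp_diff by (rule aux[OF leg]) simp_all
    moreover have "ln_Gamma N + ln_Gamma (N + 1 / 2) - ln_Gamma (2 * N) - (1 - 2 * N) * of_real (ln 2)
        = of_real k + of_real (A n + (2 * real n - 1) * ln 2) + E n"
    proof -
      have L1: "Ln N = of_real (ln (real n))" using elim Ln_of_real[of "real n"] by (simp add: N_def)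
      have L2: "Ln (N + 1 / 2) = of_real (ln (real n) + ln (1 + 1 / (2 * real n)))"
      proof -
        have "N + 1 / 2 = of_real (real n * (1 + 1 / (2 * real n)))" using elim by (simp add: N_def field_simps)
        also have "Ln \<dots> = of_real (ln (real n * (1 + 1 / (2 * real n))))"
          using elim by (intro Ln_of_real) (simp add: add_pos_nonneg)
        also have "ln (real n * (1 + 1 / (2 * real n))) = ln (real n) + ln (1 + 1 / (2 * real n))"
          using elim by (intro ln_mult_pos) (auto simp: add_pos_nonneg)
        finally show ?thesis .
      qed
      have L3: "Ln (2 * N) = of_real (ln 2 + ln (real n))"
      proof -
        have "2 * N = of_real (2 * real n)" by (simp add: N_def)
        also have "Ln \<dots> = of_real (ln (2 * real n))" using elim by (intro Ln_of_real) auto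
        finally show ?thesis using elim by (simp add: ln_mult)
      qed
      show ?thesis
        unfolding lnG[OF N(1)] lnG[OF N(2)] lnG[OF N(3)] stirling_main_def L1 L2 L3
        unfolding E_def A_def k N_def by (simp add: field_simps)
    qed
    ultimately show ?case by simp
  qed
  have "(\<lambda>n. real n * ln (1 + 1 / (2 * real n)) - 1 / 2 - (2 * real n - 1 / 2) * ln 2 + (2 * real n - 1) * ln 2) \<longlonglongrightarrow> - (ln 2 / 2)"
    by real_asymp
  hence A: "(\<lambda>n. A n + (2 * real n - 1) * ln 2) \<longlonglongrightarrow> - (ln 2 / 2)" by (simp add: A_def)
  have "E \<longlonglongrightarrow> 0 + 0 - 0"
    unfolding E_def
  proof (intro tendsto_diff tendsto_add binet_tendsto_0)
    show "filterlim (\<lambda>n. Re (of_nat n)) at_top sequentially" "filterlim (\<lambda>n. Re (of_nat n + 1 / 2)) at_top sequentially"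
      "filterlim (\<lambda>n. Re (2 * of_nat n)) at_top sequentially"
      by (simp; real_asymp)+
  qed
  hence "(\<lambda>n. exp (of_real k + of_real (A n + (2 * real n - 1) * ln 2) + E n)) \<longlonglongrightarrow> exp (of_real k + of_real (- (ln 2 / 2)) + 0)"
    using A by (intro tendsto_intros) auto
  moreover have "(\<lambda>n. exp (of_real k + of_real (A n + (2 * real n - 1) * ln 2) + E n)) \<longlonglongrightarrow> of_real (sqrt pi)"
    using ev by (rule tendsto_eventually)
  ultimately have "exp (of_real k + of_real (- (ln 2 / 2)) + 0) = complex_of_real (sqrt pi)"
    by (rule LIMSEQ_unique)
  hence "exp (of_real (k - ln 2 / 2)) = complex_of_real (sqrt pi)" by simp
  hence "exp (k - ln 2 / 2) = sqrt pi" by (simp only: exp_of_real of_real_eq_iff)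
  hence "ln (exp (k - ln 2 / 2)) = ln (sqrt pi)" by (simp only:)
  hence "k - ln 2 / 2 = ln pi / 2" by (simp add: ln_sqrt)
  hence "k = ln (2 * pi) / 2" by (simp add: ln_mult field_simps)
  thus ?thesis using lnG[OF z] by (simp only: k)
qed


section \<open>The logarithm of the Barnes function\<close>

text \<open>
  Taylor's formula of second order on the disc of radius $1/2$, where the third derivative
  $2 / (1 + w)^3$ is at most $16$.
\<close>

lemma Ln_approx_quadratic:
  assumes "norm (x::complex) \<le> 1 / 2"
  shows "norm (Ln (1 + x) - x + x\<^sup>2 / 2) \<le> 8 * norm x ^ 3"
proof -
  define f where "f = (\<lambda>i w. if i = (0::nat) then Ln (1 + w) else if i = 1 then 1 / (1 + w)
     else if i = 2 then - 1 / (1 + w)\<^sup>2 else 2 / (1 + w) ^ 3 :: complex)"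
  have re: "1 / 2 \<le> Re (1 + w)" "1 / 2 \<le> norm (1 + w)" if "w \<in> cball 0 (1 / 2)" for w :: complex
  proof -
    show "1 / 2 \<le> Re (1 + w)" using that abs_Re_le_cmod[of w] by (auto simp: abs_le_iff)
    thus "1 / 2 \<le> norm (1 + w)" using complex_Re_le_cmod[of "1 + w"] by linarith
  qed
  have "norm (f 0 x - (\<Sum>i\<le>2. f i 0 * (x - 0) ^ i / fact i)) \<le> 16 * norm (x - 0) ^ (Suc 2) / fact 2"
  proof (rule field_Taylor[where S = "cball 0 (1 / 2)"])
    fix i :: nat and w :: complex assume w: "w \<in> cball 0 (1 / 2)" and i: "i \<le> 2"
    have nz: "1 + w \<noteq> 0" "1 + w \<notin> \<real>\<^sub>\<le>\<^sub>0" using re[OF w] by (auto simp: complex_nonpos_Reals_iff complex_eq_iff)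
    have d: "((\<lambda>w. 1 + w) has_field_derivative 1) (at w within cball 0 (1 / 2))"
      by (auto intro!: derivative_eq_intros)
    have d0: "((\<lambda>w. Ln (1 + w)) has_field_derivative inverse (1 + w) * 1) (at w within cball 0 (1 / 2))"
      using DERIV_chain2[OF has_field_derivative_Ln[OF nz(2)] d] .
    have d1: "((\<lambda>w. 1 / (1 + w)) has_field_derivative - 1 / (1 + w)\<^sup>2) (at w within cball 0 (1 / 2))"
      using nz(1) by (auto intro!: derivative_eq_intros simp: power2_eq_square)
    have d2: "((\<lambda>w. - 1 / (1 + w)\<^sup>2) has_field_derivative 2 / (1 + w) ^ 3) (at w within cball 0 (1 / 2))"
      using nz(1) by (auto intro!: derivative_eq_intros simp: divide_simps power2_eq_square power3_eq_cube)
    have "i = 0 \<or> i = 1 \<or> i = 2" using i by linarith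
    thus "(f i has_field_derivative f (Suc i) w) (at w within cball 0 (1 / 2))"
      using d0 d1 d2 by (elim disjE) (simp_all add: f_def inverse_eq_divide)
  next
    fix w :: complex assume w: "w \<in> cball 0 (1 / 2)"
    have "(1 / 2) ^ 3 \<le> norm (1 + w) ^ 3" using re[OF w] by (intro power_mono) auto
    moreover have "0 < norm (1 + w)" using re[OF w] by linarith
    ultimately have "2 / norm (1 + w) ^ 3 \<le> 2 / (1 / 2) ^ 3"
      by (intro divide_left_mono mult_pos_pos zero_less_power) auto
    thus "norm (f (Suc 2) w) \<le> 16" by (simp add: f_def norm_divide norm_mult power3_eq_cube)
  qed (use assms in auto)
  moreover have "f 0 x - (\<Sum>i\<le>2. f i 0 * (x - 0) ^ i / fact i) = Ln (1 + x) - x + x\<^sup>2 / 2"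
    by (simp add: f_def numeral_2_eq_2)
  ultimately show ?thesis by simp
qed

text \<open>
  The logarithm of a factor of the Weierstrass product of $G(1 + u)$, the factor of index $j + 1$.
\<close>

definition barnes_term :: "complex \<Rightarrow> nat \<Rightarrow> complex" where
  "barnes_term u j = of_nat (Suc j) * Ln (1 + u / of_nat (Suc j))
     + u\<^sup>2 / 2 * of_real (ln (1 + 1 / real (Suc j))) - u"

text \<open>
  The terms of order $u$ and $u^2 / k$ cancel, where $k$ is the index of the factor.
\<close>

lemma norm_barnes_term_le:
  assumes "norm u \<le> R" and j: "2 * R \<le> real (Suc j)" "1 \<le> j"
  shows "norm (barnes_term u j) \<le> (8 * R ^ 3 + R\<^sup>2) / real (Suc j) ^ 2"
proof -
  define k where "k = real (Suc j)"
  have k: "2 \<le> k" "0 < k" using j by (auto simp: k_def)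
  have ck: "of_nat (Suc j) = complex_of_real k" by (simp add: k_def)
  define x where "x = u / of_real k"
  have R: "0 \<le> R" using assms(1) norm_ge_zero order_trans by blast
  have nx: "norm x \<le> R / k" using assms(1) k by (simp add: x_def norm_divide divide_right_mono)
  also have "R / k \<le> 1 / 2"
  proof -
    have "2 * R \<le> k" using j by (simp add: k_def)
    thus ?thesis using k by (simp add: field_simps)
  qed
  finally have x: "norm x \<le> 1 / 2" .
  define r where "r = Ln (1 + x) - x + x\<^sup>2 / 2"
  define r' where "r' = ln (1 + 1 / k) - 1 / k"
  have "norm r \<le> 8 * norm x ^ 3" unfolding r_def by (rule Ln_approx_quadratic[OF x])
  also have "\<dots> \<le> 8 * (R / k) ^ 3" using nx by (intro mult_left_mono power_mono) auto
  finally have r: "norm r \<le> 8 * (R / k) ^ 3" .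
  have r': "\<bar>r'\<bar> \<le> 2 * (1 / k)\<^sup>2"
    unfolding r'_def using k by (intro abs_ln_one_plus_x_minus_x_bound) auto
  have "barnes_term u j = of_real k * r + u\<^sup>2 / 2 * of_real r'"
    unfolding barnes_term_def ck k_def[symmetric] r_def r'_def x_def using k
    by (simp add: field_simps power2_eq_square)
  hence "norm (barnes_term u j) \<le> norm (of_real k * r) + norm (u\<^sup>2 / 2 * of_real r')"
    by (simp only: norm_triangle_ineq)
  also have "\<dots> = k * norm r + (norm u)\<^sup>2 / 2 * \<bar>r'\<bar>"
    using k by (simp add: norm_mult norm_divide norm_power)
  also have "\<dots> \<le> k * (8 * (R / k) ^ 3) + R\<^sup>2 / 2 * (2 * (1 / k)\<^sup>2)"
    using k r r' assms(1) by (intro add_mono mult_mono mult_left_mono divide_right_mono power_mono) auto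
  also have "\<dots> = (8 * R ^ 3 + R\<^sup>2) / k ^ 2"
    using k by (simp add: field_simps power2_eq_square power3_eq_cube)
  finally show ?thesis by (simp add: k_def)
qed

lemma uniform_limit_barnes_series:
  "uniform_limit (cball 0 R) (\<lambda>n u. \<Sum>j<n. barnes_term u j) (\<lambda>u. \<Sum>j. barnes_term u j) sequentially"
proof (rule Weierstrass_m_test_ev)
  show "\<forall>\<^sub>F j in sequentially. \<forall>u\<in>cball 0 R. norm (barnes_term u j) \<le> (8 * R ^ 3 + R\<^sup>2) * (1 / real (Suc j) ^ 2)"
    using eventually_ge_at_top[of "nat \<lceil>2 * R\<rceil> + 1"]
  proof eventually_elim
    case (elim j)
    hence "2 * R \<le> real (Suc j)" "1 \<le> j" by linarith+
    thus ?case using norm_barnes_term_le[of _ R j] by auto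
  qed
  have "summable (\<lambda>n. 1 / real n ^ 2)" using inverse_power_summable[of 2, where 'a = real] by (simp add: inverse_eq_divide)
  hence "summable (\<lambda>j. 1 / real (Suc j) ^ 2)" by (subst summable_Suc_iff)
  thus "summable (\<lambda>j. (8 * R ^ 3 + R\<^sup>2) * (1 / real (Suc j) ^ 2))" by (rule summable_mult)
qed

text \<open>
  The branch of $\ln G(1 + u)$ that is real for real $u > -1$.
\<close>

definition ln_G :: "complex \<Rightarrow> complex" where
  "ln_G u = u / 2 * of_real (ln (2 * pi)) - (u + 1) * u / 2 + (\<Sum>j. barnes_term u j)"

lemma sums_barnes_series: "(\<lambda>j. barnes_term u j) sums (\<Sum>j. barnes_term u j)"
  unfolding sums_def using tendsto_uniform_limitI[OF uniform_limit_barnes_series[of "norm u"], of u] by simp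

lemma Re_one_plus_div_pos:
  assumes "-1 < Re u"
  shows "0 < Re (1 + u / of_nat (Suc j))"
proof -
  have "Re (u / of_nat (Suc j)) = Re u / real (Suc j)"
    by (metis Re_divide_of_nat)
  moreover have "- 1 < Re u / real (Suc j)" using assms by (simp add: field_simps)
  ultimately show ?thesis by simp
qed

lemma holomorphic_ln_G: "ln_G holomorphic_on {u. -1 < Re u}"
proof -
  have op: "open {u::complex. -1 < Re u}" by (rule open_halfspace_Re_gt)
  have "(\<lambda>u. \<Sum>j. barnes_term u j) holomorphic_on {u. -1 < Re u}"
  proof (rule holomorphic_uniform_sequence[OF op])
    fix n
    show "(\<lambda>u. \<Sum>j<n. barnes_term u j) holomorphic_on {u. -1 < Re u}"
      unfolding barnes_term_def
    proof (intro holomorphic_intros)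
      fix j :: nat and u :: complex assume "u \<in> {u. -1 < Re u}"
      thus "1 + u / of_nat (Suc j) \<notin> \<real>\<^sub>\<le>\<^sub>0"
        using Re_one_plus_div_pos[of u j] by (auto simp: complex_nonpos_Reals_iff)
    qed (simp_all del: of_nat_Suc)
  next
    fix u :: complex assume u: "u \<in> {u. -1 < Re u}"
    then obtain d where d: "0 < d" "cball u d \<subseteq> {u. -1 < Re u}" using op open_contains_cball by blast
    have "cball u d \<subseteq> cball 0 (norm u + d)"
    proof
      fix w assume "w \<in> cball u d"
      thus "w \<in> cball 0 (norm u + d)" using norm_triangle_ineq[of u "w - u"] by (simp add: dist_norm norm_minus_commute)
    qed
    thus "\<exists>d>0. cball u d \<subseteq> {u. -1 < Re u} \<and>
       uniform_limit (cball u d) (\<lambda>n u. \<Sum>j<n. barnes_term u j) (\<lambda>u. \<Sum>j. barnes_term u j) sequentially"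
      using d uniform_limit_on_subset[OF uniform_limit_barnes_series] by blast
  qed
  thus ?thesis unfolding ln_G_def by (intro holomorphic_intros) auto
qed

lemma exp_ln_G:
  assumes u: "-1 < Re u"
  shows "exp (ln_G u) = barnes_G (1 + u)"
proof -
  define S where "S = (\<Sum>j. barnes_term u j)"
  define f where "f = (\<lambda>j. (1 + u / of_nat (Suc j)) ^ Suc j *
           exp (u\<^sup>2 / 2 * of_real (ln (1 + 1 / real (Suc j)))) * exp (- u))"
  have f: "f j = exp (barnes_term u j)" for j
  proof -
    have "1 + u / of_nat (Suc j) \<noteq> 0"
      using Re_one_plus_div_pos[OF u, of j] by (metis less_irrefl zero_complex.sel(1))
    hence "(1 + u / of_nat (Suc j)) ^ Suc j = exp (of_nat (Suc j) * Ln (1 + u / of_nat (Suc j)))"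
      by (subst exp_of_nat_mult, subst exp_Ln) simp_all
    thus ?thesis unfolding f_def barnes_term_def by (simp only: exp_add exp_diff exp_minus divide_inverse)
  qed
  have "(\<lambda>n. \<Sum>j\<le>n. barnes_term u j) \<longlonglongrightarrow> S"
    using sums_barnes_series[of u] unfolding S_def by (simp add: sums_def_le)
  hence "(\<lambda>n. exp (\<Sum>j\<le>n. barnes_term u j)) \<longlonglongrightarrow> exp S" by (rule tendsto_exp)
  hence "(\<lambda>n. \<Prod>j\<le>n. f j) \<longlonglongrightarrow> exp S" by (simp add: f exp_sum)
  hence "f has_prod exp S" by (simp add: has_prod_def raw_has_prod_def)
  hence "prodinf f = exp S" using has_prod_unique by metis
  moreover have "barnes_G (1 + u) = exp (u / 2 * of_real (ln (2 * pi))) * exp (- ((u + 1) * u / 2)) * prodinf f"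
    unfolding barnes_G_def Let_def f_def by simp
  moreover have "ln_G u = u / 2 * of_real (ln (2 * pi)) + - ((u + 1) * u / 2) + S"
    by (simp add: ln_G_def S_def)
  ultimately show ?thesis by (simp only: exp_add)
qed

lemma ln_G_real:
  assumes "-1 < x"
  shows "ln_G (of_real x) \<in> \<real>"
proof -
  have "barnes_term (of_real x) j \<in> \<real>" for j
  proof -
    have "0 < 1 + x / real (Suc j)" using Re_one_plus_div_pos[of "of_real x" j] assms by simp
    moreover have "1 + complex_of_real x / of_nat (Suc j) = of_real (1 + x / real (Suc j))" by simp
    ultimately have "Ln (1 + complex_of_real x / of_nat (Suc j)) = of_real (ln (1 + x / real (Suc j)))"
      by (metis Ln_of_real)
    thus ?thesis unfolding barnes_term_def by (auto intro!: Reals_add Reals_mult Reals_diff Reals_divide Reals_power)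
  qed
  hence "(\<Sum>j<n. barnes_term (of_real x) j) \<in> \<real>" for n by (intro sum_in_Reals)
  hence "(\<Sum>j. barnes_term (of_real x) j) \<in> \<real>"
    using sums_barnes_series[of "of_real x"] unfolding sums_def
    by (intro Lim_in_closed_set[OF closed_complex_Reals always_eventually]) auto
  thus ?thesis unfolding ln_G_def by (auto intro!: Reals_add Reals_mult Reals_diff Reals_divide)
qed

text \<open>
  Two branches on the half-plane differ by a constant multiple of $2\pi i$; if both are real at the
  point $1$, they are equal.
\<close>

lemma ln_barnes_G_eq:
  assumes u: "-1 < Re u"
  shows "ln_barnes_G (1 + u) = ln_G u"
proof -
  let ?A = "{z::complex. Re z > 0}"
  let ?Q = "\<lambda>L. log_branch ?A barnes_G L \<and> (\<forall>x>0. L (of_real x) \<in> \<real>)"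
  define L where "L = (\<lambda>w. ln_G (w - 1))"
  have "?Q L"
  proof (intro conjI allI impI)
    have "ln_G \<circ> (\<lambda>w. w - 1) holomorphic_on ?A"
    proof (rule holomorphic_on_compose)
      show "ln_G holomorphic_on (\<lambda>w. w - 1) ` ?A"
        by (rule holomorphic_on_subset[OF holomorphic_ln_G]) auto
    qed (intro holomorphic_intros)
    hence "L holomorphic_on ?A" by (simp add: L_def o_def)
    moreover have "exp (L w) = barnes_G w" if "w \<in> ?A" for w
      using exp_ln_G[of "w - 1"] that by (simp add: L_def)
    ultimately show "log_branch ?A barnes_G L" by (simp add: log_branch_def)
    show "L (of_real x) \<in> \<real>" if "0 < x" for x
      using ln_G_real[of "x - 1"] that by (simp add: L_def)
  qed
  moreover from this have Q: "?Q ln_barnes_G" unfolding ln_barnes_G_def by (rule someI[where P = ?Q])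
  moreover have "ln_barnes_G 1 = L 1"
  proof -
    have "exp (ln_barnes_G 1) = exp (L 1)" using Q \<open>?Q L\<close> by (simp add: log_branch_def)
    moreover obtain a b where "ln_barnes_G 1 = of_real a" "L 1 = of_real b"
      using Q \<open>?Q L\<close> by (metis Reals_cases of_real_1 zero_less_one)
    ultimately show ?thesis by (simp add: exp_of_real)
  qed
  moreover have "connected ?A" by (intro convex_connected convex_halfspace_Re_gt)
  ultimately have "ln_barnes_G (1 + u) = L (1 + u)"
    using u log_branch_unique[of ?A barnes_G ln_barnes_G L 1 "1 + u"] by simp
  thus ?thesis by (simp add: L_def)
qed


section \<open>Expansion of the logarithms of Gamma products\<close>

text \<open>
  For \<open>Re w \<le> 0\<close> there is no exponential factor; without this refinement the integrals below would
  converge only for $z$ in a vertical strip.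
\<close>

lemma norm_exp_minus_1_le_max: "norm (exp w - 1 :: complex) \<le> norm w * max 1 (exp (Re w))"
proof (cases "0 \<le> Re w")
  case True
  have "norm (exp w - 1) \<le> exp \<bar>Re w\<bar> * norm w" using Taylor_exp[of w 0] by simp
  thus ?thesis using True by (simp add: max_def mult.commute)
next
  case False
  have "norm (exp (- w) - 1) \<le> exp \<bar>Re w\<bar> * norm w" using Taylor_exp[of "- w" 0] by simp
  hence "norm (exp w) * norm (exp (- w) - 1) \<le> norm (exp w) * (exp \<bar>Re w\<bar> * norm w)"
    by (intro mult_left_mono) auto
  also have "norm (exp w) * norm (exp (- w) - 1) = norm (exp w - 1)"
    unfolding norm_mult[symmetric] by (simp add: right_diff_distrib mult_exp_exp norm_minus_commute)
  also have "norm (exp w) * (exp \<bar>Re w\<bar> * norm w) = norm w"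
    using False by (simp add: mult.assoc[symmetric] mult_exp_exp)
  finally show ?thesis using False by simp
qed

definition tail_integrand :: "real \<Rightarrow> nat \<Rightarrow> complex \<Rightarrow> real \<Rightarrow> complex" where
  "tail_integrand c n z s = of_real (binet_phi s) * (exp (- (of_real s * z)) - 1) / of_real (exp (s * c) - 1)
     * of_real (exp (- (s * c * real n)))"

text \<open>
  For $n = 0$ this is the integral in $\Upsilon$ (with $c = \beta / 2$), for general $n$ the
  remainder after $n$ terms of the geometric series in $e^{-cs}$.
\<close>

definition binet_tail :: "real \<Rightarrow> nat \<Rightarrow> complex \<Rightarrow> complex" where
  "binet_tail c n z = (LINT s:{0<..}|lborel. tail_integrand c n z s)"

text \<open>
  The estimate $cs e^{cs} \le (1 + cs)(e^{cs} - 1)$ is used for the denominator.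
\<close>

lemma norm_tail_integrand_le:
  assumes c: "0 < c" and s: "0 < s" and C: "\<bar>binet_phi s\<bar> \<le> C"
  shows "norm (tail_integrand c n z s) \<le>
     C * norm z / c * ((1 + c * s) * max (exp (- (c * s))) (exp (- (s * (Re z + c))))) * exp (- (s * c * real n))"
proof -
  have C0: "0 \<le> C" using C abs_ge_zero order_trans by blast
  have E: "0 < exp (s * c) - 1" using c s by simp
  have "norm (exp (- (of_real s * z)) - 1) \<le> norm (- (of_real s * z)) * max 1 (exp (Re (- (of_real s * z))))"
    by (rule norm_exp_minus_1_le_max)
  hence 1: "norm (exp (- (of_real s * z)) - 1) \<le> s * norm z * max 1 (exp (- (s * Re z)))"
    using s by (simp add: norm_mult)
  have "c * s * exp (s * c) \<le> (1 + c * s) * (exp (s * c) - 1)"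
    using exp_ge_add_one_self[of "s * c"] by (simp add: algebra_simps)
  hence 2: "s / (exp (s * c) - 1) \<le> (1 + c * s) / c * exp (- (c * s))"
    using E c by (simp add: field_simps exp_minus)
  have "norm (tail_integrand c n z s) = \<bar>binet_phi s\<bar> * (norm (exp (- (of_real s * z)) - 1) / (exp (s * c) - 1)) * exp (- (s * c * real n))"
    using E unfolding tail_integrand_def norm_mult norm_divide norm_of_real by simp
  also have "\<dots> \<le> C * ((s * norm z * max 1 (exp (- (s * Re z)))) / (exp (s * c) - 1)) * exp (- (s * c * real n))"
    using E C0 1 C s by (intro mult_mono divide_right_mono mult_nonneg_nonneg divide_nonneg_pos) auto
  also have "(s * norm z * max 1 (exp (- (s * Re z)))) / (exp (s * c) - 1)
      = (s / (exp (s * c) - 1)) * (norm z * max 1 (exp (- (s * Re z))))" by simp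
  also have "C * \<dots> * exp (- (s * c * real n)) \<le>
     C * (((1 + c * s) / c * exp (- (c * s))) * (norm z * max 1 (exp (- (s * Re z))))) * exp (- (s * c * real n))"
    using 2 C0 by (intro mult_right_mono mult_left_mono) (auto simp: max_def)
  also have "\<dots> = C * norm z / c * ((1 + c * s) * (exp (- (c * s)) * max 1 (exp (- (s * Re z))))) * exp (- (s * c * real n))"
    by simp
  also have "exp (- (c * s)) * max 1 (exp (- (s * Re z))) = max (exp (- (c * s))) (exp (- (s * (Re z + c))))"
    by (auto simp: max_def mult_exp_exp algebra_simps)
  finally show ?thesis .
qed

lemma measurable_tail_integrand [measurable]: "tail_integrand c n z \<in> borel_measurable borel"
  unfolding tail_integrand_def by measurable

lemma set_integrable_tail:
  assumes c: "0 < c" and z: "- c < Re z"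
  shows "set_integrable lborel {0<..} (tail_integrand c n z)"
proof -
  obtain C where C: "0 \<le> C" "\<And>s. 0 < s \<Longrightarrow> \<bar>binet_phi s\<bar> \<le> C" using binet_phi_bounded by blast
  \<comment> \<open>the rate of exponential decay of the integrand; half of it is given up to absorb the factor \<open>1 + c * s\<close>\<close>
  define \<delta> where "\<delta> = min c (Re z + c)"
  have \<delta>: "0 < \<delta>" "\<delta> \<le> c" "\<delta> \<le> Re z + c" using c z by (auto simp: \<delta>_def)
  define K where "K = C * norm z / c * (1 + 2 * c / \<delta>)"
  show ?thesis
  proof (rule set_integrable_dominated(1))
    show "set_integrable lborel {0<..} (\<lambda>s. K * exp (- (s * (\<delta> / 2))))"
      using set_integrable_exp_decay(1)[of "\<delta> / 2"] \<delta> by simp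
    show "(\<lambda>s. indicator {0<..} s *\<^sub>R tail_integrand c n z s) \<in> borel_measurable lborel" by measurable
    fix s :: real assume "s \<in> {0<..}"
    hence s: "0 < s" by simp
    have a1: "max (exp (- (c * s))) (exp (- (s * (Re z + c)))) \<le> exp (- (s * \<delta>))"
      using \<delta> s by (auto simp: mult.commute)
    have "1 + c * s \<le> (1 + 2 * c / \<delta>) * exp (s * (\<delta> / 2))"
    proof -
      have "1 + s * (\<delta> / 2) \<le> exp (s * (\<delta> / 2))" by (rule exp_ge_add_one_self)
      hence "s * (\<delta> / 2) \<le> exp (s * (\<delta> / 2))" by linarith
      hence "2 * c / \<delta> * (s * (\<delta> / 2)) \<le> 2 * c / \<delta> * exp (s * (\<delta> / 2))"
        using \<delta> c by (intro mult_left_mono) auto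
      moreover have "1 \<le> exp (s * (\<delta> / 2))" using s \<delta> by simp
      moreover have "2 * c / \<delta> * (s * (\<delta> / 2)) = c * s" using \<delta> by simp
      moreover have "(1 + 2 * c / \<delta>) * exp (s * (\<delta> / 2)) = exp (s * (\<delta> / 2)) + 2 * c / \<delta> * exp (s * (\<delta> / 2))"
        by (simp add: distrib_right)
      ultimately show ?thesis by linarith
    qed
    hence a2: "(1 + c * s) * max (exp (- (c * s))) (exp (- (s * (Re z + c))))
        \<le> ((1 + 2 * c / \<delta>) * exp (s * (\<delta> / 2))) * exp (- (s * \<delta>))"
      using a1 c s \<delta> by (intro mult_mono) (auto simp: max_def)
    have a3: "exp (- (s * c * real n)) \<le> 1" using c s by simp
    have "norm (tail_integrand c n z s) \<le>
     C * norm z / c * ((1 + c * s) * max (exp (- (c * s))) (exp (- (s * (Re z + c))))) * exp (- (s * c * real n))"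
      by (rule norm_tail_integrand_le[OF c s C(2)[OF s]])
    also have "\<dots> \<le> C * norm z / c * (((1 + 2 * c / \<delta>) * exp (s * (\<delta> / 2))) * exp (- (s * \<delta>))) * 1"
      by (rule mult_mono[OF mult_left_mono[OF a2] a3]) (use C c s \<delta> in auto)
    also have "\<dots> = K * (exp (s * (\<delta> / 2)) * exp (- (s * \<delta>)))" by (simp add: K_def)
    also have "exp (s * (\<delta> / 2)) * exp (- (s * \<delta>)) = exp (- (s * (\<delta> / 2)))"
      by (simp add: mult_exp_exp algebra_simps)
    finally show "norm (tail_integrand c n z s) \<le> K * exp (- (s * (\<delta> / 2)))" .
  qed
qed

lemma norm_binet_tail_le:
  assumes c: "0 < c"
  shows "\<exists>K. \<forall>n z. - c < Re z \<longrightarrow> norm (binet_tail c (Suc (Suc n)) z) \<le> K * norm z / real (Suc n)"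
proof -
  obtain C where C: "0 \<le> C" "\<And>s. 0 < s \<Longrightarrow> \<bar>binet_phi s\<bar> \<le> C" using binet_phi_bounded by blast
  have "norm (binet_tail c (Suc (Suc n)) z) \<le> C / c\<^sup>2 * norm z / real (Suc n)" if z: "- c < Re z" for n z
  proof -
    have pos: "0 < c * real (Suc n)" using c by simp
    have "norm (binet_tail c (Suc (Suc n)) z) \<le> (LINT s:{0<..}|lborel. C * norm z / c * exp (- (s * (c * real (Suc n)))))"
      unfolding binet_tail_def
    proof (rule set_integrable_dominated(2))
      show "set_integrable lborel {0<..} (\<lambda>s. C * norm z / c * exp (- (s * (c * real (Suc n)))))"
        using set_integrable_exp_decay(1)[OF pos] by (intro set_integrable_mult_right)
      show "(\<lambda>s. indicator {0<..} s *\<^sub>R tail_integrand c (Suc (Suc n)) z s) \<in> borel_measurable lborel" by measurable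
      fix s :: real assume "s \<in> {0<..}"
      hence s: "0 < s" by simp
      have m: "(1 + c * s) * max (exp (- (c * s))) (exp (- (s * (Re z + c)))) \<le> exp (c * s) * 1"
        using c s z exp_ge_add_one_self[of "c * s"] by (intro mult_mono) (auto simp: max_def)
      have "norm (tail_integrand c (Suc (Suc n)) z s) \<le>
     C * norm z / c * ((1 + c * s) * max (exp (- (c * s))) (exp (- (s * (Re z + c))))) * exp (- (s * c * real (Suc (Suc n))))"
        by (rule norm_tail_integrand_le[OF c s C(2)[OF s]])
      also have "\<dots> \<le> C * norm z / c * (exp (c * s) * 1) * exp (- (s * c * real (Suc (Suc n))))"
        using m C c by (intro mult_right_mono mult_left_mono) auto
      also have "\<dots> = C * norm z / c * (exp (c * s) * exp (- (s * c * real (Suc (Suc n)))))" by simp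
      also have "exp (c * s) * exp (- (s * c * real (Suc (Suc n)))) = exp (- (s * (c * real (Suc n))))"
        unfolding mult_exp_exp by (simp add: algebra_simps)
      finally show "norm (tail_integrand c (Suc (Suc n)) z s) \<le> C * norm z / c * exp (- (s * (c * real (Suc n))))" .
    qed
    also have "\<dots> = C * norm z / c * (1 / (c * real (Suc n)))"
      by (subst set_integral_mult_right) (simp only: set_integrable_exp_decay(2)[OF pos])
    also have "\<dots> = C / c\<^sup>2 * norm z / real (Suc n)" by (simp add: power2_eq_square)
    finally show ?thesis .
  qed
  thus ?thesis by blast
qed

text \<open>
  The term of index $n + 1$ of the geometric series.
\<close>

lemma binet_tail_step:
  assumes c: "0 < c" and z: "- c < Re z"
  shows "binet_tail c n z - binet_tail c (Suc n) z
       = binet (of_real (c * real (Suc n)) + z) - binet (of_real (c * real (Suc n)))"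
proof -
  let ?w = "complex_of_real (c * real (Suc n))"
  have "c * 1 \<le> c * real (Suc n)" using c by (intro mult_left_mono) auto
  hence "0 < c * real (Suc n) + Re z" "0 < c * real (Suc n)" using z c by linarith+
  hence w: "0 < Re (?w + z)" "0 < Re ?w" by (simp_all del: of_nat_Suc)
  have "binet_tail c n z - binet_tail c (Suc n) z = (LINT s:{0<..}|lborel. tail_integrand c n z s - tail_integrand c (Suc n) z s)"
    unfolding binet_tail_def by (intro set_integral_diff(2)[symmetric] set_integrable_tail c z)
  also have "\<dots> = (LINT s:{0<..}|lborel. of_real (binet_phi s) * exp (- (of_real s * (?w + z))) - of_real (binet_phi s) * exp (- (of_real s * ?w)))"
  proof (rule set_lebesgue_integral_cong)
    show "\<forall>s. s \<in> {0<..} \<longrightarrow> tail_integrand c n z s - tail_integrand c (Suc n) z s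
      = of_real (binet_phi s) * exp (- (of_real s * (?w + z))) - of_real (binet_phi s) * exp (- (of_real s * ?w))"
    proof (intro allI impI)
      fix s :: real assume "s \<in> {0<..}"
      hence E: "exp (s * c) - 1 \<noteq> 0" using c by simp
      define Q where "Q = exp (- (s * c * real (Suc n)))"
      have e1: "exp (- (s * c * real n)) - exp (- (s * c * real (Suc n))) = (exp (s * c) - 1) * Q"
        by (simp add: Q_def algebra_simps mult_exp_exp)
      have e2: "exp (- (of_real s * ?w)) = complex_of_real Q"
        by (simp add: Q_def exp_of_real[symmetric] mult.assoc del: of_nat_Suc)
      have e3: "exp (- (of_real s * (?w + z))) = exp (- (of_real s * z)) * exp (- (of_real s * ?w))"
        unfolding mult_exp_exp by (simp add: algebra_simps)
      have "tail_integrand c n z s - tail_integrand c (Suc n) z s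
        = of_real (binet_phi s) * (exp (- (of_real s * z)) - 1) / of_real (exp (s * c) - 1) *
            of_real (exp (- (s * c * real n)) - exp (- (s * c * real (Suc n))))"
        unfolding tail_integrand_def of_real_diff[of "exp (- (s * c * real n))"] by (simp only: right_diff_distrib)
      also have "\<dots> = of_real (binet_phi s) * (exp (- (of_real s * z)) - 1) * exp (- (of_real s * ?w))"
        unfolding e1 e2 using E by (simp del: of_real_diff)
      also have "\<dots> = of_real (binet_phi s) * exp (- (of_real s * (?w + z))) - of_real (binet_phi s) * exp (- (of_real s * ?w))"
        unfolding e3 by (simp add: algebra_simps)
      finally show "tail_integrand c n z s - tail_integrand c (Suc n) z s = \<dots>" .
    qed
  qed simp
  also have "\<dots> = binet (?w + z) - binet ?w"
    unfolding binet_def by (intro set_integral_diff(2) set_integrable_binet w)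
  finally show ?thesis .
qed

text \<open>
  Binet's formula is inserted in each summand.  The logarithms of $ck + z = c(k + u)$ split into
  $\ln c$, $\ln k$ and $\ln(1 + u / k)$, and the last one is the main part of a term of the Barnes series.
\<close>

lemma ln_Gamma_sum_eq:
  assumes c: "0 < c" and z: "- c < Re z"
  defines "u \<equiv> z / of_real c"
  shows "ln_Gamma_sum c n z = of_nat n * z * of_real (ln c)
     + of_real c * ((\<Sum>j<n. barnes_term u j) - u\<^sup>2 / 2 * of_real (ln (real (Suc n))))
     + (z - 1 / 2) * (ln_Gamma (1 + u + of_nat n) - ln_Gamma (1 + u))
     + of_real (ln (fact n)) / 2 + (binet_tail c 0 z - binet_tail c n z)"
proof (induction n)
  case 0
  show ?case by (simp add: ln_Gamma_sum_def)
next
  case (Suc n)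
  define k where "k = real (Suc n)"
  have k: "0 < k" by (simp add: k_def)
  have ck: "of_nat (Suc n) = complex_of_real k" by (simp add: k_def)
  have zu: "z = of_real c * u" using c by (simp add: u_def)
  have Reu: "-1 < Re u" using z c by (simp add: u_def field_simps)
  have u1: "0 < Re (1 + u)" using Reu by simp
  define \<Lambda> where "\<Lambda> = Ln (1 + u / of_real k)"
  have Ln_k: "Ln (of_real k + u) = of_real (ln k) + \<Lambda>"
  proof -
    have nz: "1 + u / of_real k \<noteq> 0"
      using Re_one_plus_div_pos[OF Reu, of n] unfolding ck by (metis less_irrefl zero_complex.sel(1))
    have "of_real k + u = of_real k * (1 + u / of_real k)" using k by (simp add: field_simps)
    also have "Ln \<dots> = of_real (ln k) + \<Lambda>" unfolding \<Lambda>_def using k nz Ln_times_of_real[of k "1 + u / of_real k"] Ln_of_real[of k] by simp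
    finally show ?thesis .
  qed
  have step1: "ln_Gamma (1 + u + of_nat (Suc n)) = ln_Gamma (1 + u + of_nat n) + (of_real (ln k) + \<Lambda>)"
  proof -
    have e1: "1 + u + of_nat (Suc n) = (1 + u + of_nat n) + 1" by simp
    have "1 + u + of_nat n = of_real k + u" by (simp add: k_def)
    hence e2: "Ln (1 + u + of_nat n) = of_real (ln k) + \<Lambda>" by (simp only: Ln_k)
    have "0 < Re (1 + u + of_nat n)" using u1 by simp
    from ln_Gamma_plus1[OF this] show ?thesis unfolding e1 e2 .
  qed
  have Re1: "0 < Re (of_real (c * k) + z)" "0 < Re (of_real (c * k))"
  proof -
    have "c * 1 \<le> c * k" using c by (intro mult_left_mono) (auto simp: k_def)
    hence "0 < c * k + Re z" "0 < c * k" using c z by linarith+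
    thus "0 < Re (of_real (c * k) + z)" "0 < Re (of_real (c * k))" by simp_all
  qed
  have LnA: "Ln (of_real (c * k) + z) = of_real (ln c) + of_real (ln k) + \<Lambda>"
  proof -
    have nz: "of_real k + u \<noteq> 0" using u1 k Reu by (auto simp: complex_eq_iff k_def)
    have "of_real (c * k) + z = of_real c * (of_real k + u)" by (simp add: zu algebra_simps)
    also have "Ln \<dots> = of_real (ln c) + Ln (of_real k + u)" using c nz Ln_times_of_real[of c "of_real k + u"] Ln_of_real[of c] by simp
    finally show ?thesis using Ln_k by simp
  qed
  have LnB: "Ln (of_real (c * k)) = of_real (ln c) + of_real (ln k)"
    using c k by (simp add: Ln_of_real ln_mult_pos del: of_real_mult)
  have bt: "barnes_term u n = of_real k * \<Lambda> + u\<^sup>2 / 2 * (of_real (ln (real (Suc (Suc n)))) - of_real (ln k)) - u"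
  proof -
    have "1 + 1 / real (Suc n) = real (Suc (Suc n)) / k" by (simp add: k_def field_simps)
    hence "ln (1 + 1 / real (Suc n)) = ln (real (Suc (Suc n))) - ln k" using k by (simp add: ln_div del: of_nat_Suc)
    thus ?thesis unfolding barnes_term_def ck \<Lambda>_def by simp
  qed
  have fact: "ln (fact (Suc n)) = ln k + ln (fact n :: real)"
    by (simp add: k_def ln_mult)
  have "ln_Gamma_sum c (Suc n) z = ln_Gamma_sum c n z + (ln_Gamma (of_real (c * k) + z) - ln_Gamma (of_real (c * k)))"
    by (simp add: ln_Gamma_sum_def k_def)
  also have "ln_Gamma (of_real (c * k) + z) - ln_Gamma (of_real (c * k))
      = stirling_main (of_real (c * k) + z) - stirling_main (of_real (c * k))
        + (binet_tail c n z - binet_tail c (Suc n) z)"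
    unfolding binet_formula[OF Re1(1)] binet_formula[OF Re1(2)] binet_tail_step[OF c z] k_def[symmetric] by simp
  also have "stirling_main (of_real (c * k) + z) - stirling_main (of_real (c * k))
     = z * of_real (ln c) + of_real c * (of_real k * \<Lambda>) - z + (z - 1 / 2) * (of_real (ln k) + \<Lambda>) + of_real (ln k) / 2"
    unfolding stirling_main_def LnA LnB by (simp add: field_simps)
  finally have main: "ln_Gamma_sum c (Suc n) z = ln_Gamma_sum c n z +
     (z * of_real (ln c) + of_real c * (of_real k * \<Lambda>) - z + (z - 1 / 2) * (of_real (ln k) + \<Lambda>) + of_real (ln k) / 2
        + (binet_tail c n z - binet_tail c (Suc n) z))" .
  have e: "of_real c * ((\<Sum>j<Suc n. barnes_term u j) - u\<^sup>2 / 2 * of_real (ln (real (Suc (Suc n)))))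
     = of_real c * ((\<Sum>j<n. barnes_term u j) - u\<^sup>2 / 2 * of_real (ln k)) + of_real c * (of_real k * \<Lambda>) - z"
    unfolding sum.lessThan_Suc bt by (simp add: zu algebra_simps)
  show ?case
    unfolding main Suc.IH step1 e fact k_def[symmetric]
    by (simp add: algebra_simps add_divide_distrib)
qed

text \<open>
  The part of \<open>ln_Gamma_sum (\<beta> / 2) n z\<close> that grows with \<open>n\<close>.
\<close>

definition main_term :: "real \<Rightarrow> nat \<Rightarrow> complex \<Rightarrow> complex" where
  "main_term \<beta> n z = z * of_real ((1 / 2 - 1 / \<beta>) * ln (real n) - real n + real n * ln (\<beta> / 2 * real n))
     + z\<^sup>2 / of_real \<beta> * of_real (ln (real n))"

text \<open>
  The limit is taken along an arbitrary filter, so that it applies when \<open>n\<close> and \<open>z\<close> vary jointly, and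
  also along the subsequences of matrix sizes in the Jacobi ensemble.  The remainders in
  \<open>ln_Gamma_sum_eq\<close> are the tail of the Barnes series, the error \<open>E\<close> in Stirling's formula at
  $n + 1 + u$ and at $n + 1$, the replacement of $\ln(n + 1)$ by $\ln n$, and the tail of the geometric
  series.
\<close>

lemma ln_Gamma_sum_asymptotics:
  fixes n :: "'x \<Rightarrow> nat" and z :: "'x \<Rightarrow> complex"
  assumes \<beta>: "0 < \<beta>" and n: "filterlim n at_top F" and z: "(z \<longlongrightarrow> z0) F" and z0: "- (\<beta> / 2) < Re z0"
  shows "((\<lambda>x. ln_Gamma_sum (\<beta> / 2) (n x) (z x) - (main_term \<beta> (n x) (z x) + Upsilon \<beta> (z x))) \<longlongrightarrow> 0) F"
proof -
  define c where "c = \<beta> / 2"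
  have c: "0 < c" and \<beta>c: "\<beta> = 2 * c" using \<beta> by (auto simp: c_def)
  define u where "u = (\<lambda>x. z x / of_real c)"
  have u: "(u \<longlongrightarrow> z0 / of_real c) F" unfolding u_def using c by (intro tendsto_intros z) auto
  have zpos: "eventually (\<lambda>x. - c < Re (z x)) F"
    using z0 order_tendstoD(1)[OF tendsto_Re[OF z]] by (simp add: c_def)
  have upos: "eventually (\<lambda>x. 0 < Re (1 + u x)) F"
    using zpos by eventually_elim (use c in \<open>simp add: u_def field_simps\<close>)
  define E where "E = (\<lambda>v k. ln_Gamma (1 + v + of_nat k) -
     ((of_nat k + 1 / 2 + v) * of_real (ln (real k)) - of_nat k + of_real (ln (2 * pi) / 2)) :: complex)"
  have E_lim: "((\<lambda>x. E (v x) (n x)) \<longlongrightarrow> 0) F" if v: "(v \<longlongrightarrow> v0) F" and vpos: "eventually (\<lambda>x. 0 < Re (1 + v x)) F" for v v0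
  proof -
    have inf: "filterlim (\<lambda>x. Re (1 + v x + of_nat (n x))) at_top F"
    proof -
      have "filterlim (\<lambda>x. Re (1 + v x) + real (n x)) at_top F"
        by (rule filterlim_tendsto_add_at_top[OF tendsto_Re[OF tendsto_add[OF tendsto_const v]]
              filterlim_compose[OF filterlim_real_sequentially n]])
      thus ?thesis by simp
    qed
    have "((\<lambda>x. stirling_main (1 + v x + of_nat (n x)) -
            ((of_nat (n x) + 1 / 2 + v x) * of_real (ln (real (n x))) - of_nat (n x)) + binet (1 + v x + of_nat (n x))) \<longlongrightarrow> 0 + 0) F"
      by (intro tendsto_add stirling_main_shift[OF v n vpos] binet_tendsto_0[OF inf])
    moreover have "eventually (\<lambda>x. stirling_main (1 + v x + of_nat (n x)) -
            ((of_nat (n x) + 1 / 2 + v x) * of_real (ln (real (n x))) - of_nat (n x)) + binet (1 + v x + of_nat (n x)) = E (v x) (n x)) F"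
      using vpos
    proof eventually_elim
      case (elim x)
      hence "0 < Re (1 + v x + of_nat (n x))" by simp
      from binet_formula[OF this] show ?case unfolding E_def by simp
    qed
    ultimately show ?thesis by (simp add: Lim_transform_eventually)
  qed
  define S where "S = (\<lambda>v. \<Sum>j. barnes_term v j)"
  have barnes: "((\<lambda>x. (\<Sum>j<n x. barnes_term (u x) j) - S (u x)) \<longlongrightarrow> 0) F"
  proof (rule tendstoI)
    fix e :: real assume e: "0 < e"
    define R where "R = norm (z0 / of_real c) + 1"
    have ev1: "eventually (\<lambda>x. norm (u x) < R) F"
      by (rule order_tendstoD(2)[OF tendsto_norm[OF u]]) (simp add: R_def)
    have "\<forall>\<^sub>F k in sequentially. \<forall>v\<in>cball 0 R. dist (\<Sum>j<k. barnes_term v j) (S v) < e"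
      using uniform_limit_barnes_series[of R] e unfolding uniform_limit_iff S_def by blast
    hence "\<forall>\<^sub>F x in F. \<forall>v\<in>cball 0 R. dist (\<Sum>j<n x. barnes_term v j) (S v) < e"
      by (rule eventually_compose_filterlim[OF _ n])
    with ev1 show "\<forall>\<^sub>F x in F. dist ((\<Sum>j<n x. barnes_term (u x) j) - S (u x)) 0 < e"
      by eventually_elim (auto simp: dist_norm)
  qed
  have tail: "((\<lambda>x. binet_tail c (n x) (z x)) \<longlongrightarrow> 0) F"
  proof -
    obtain K where K: "\<And>k w. - c < Re w \<Longrightarrow> norm (binet_tail c (Suc (Suc k)) w) \<le> K * norm w / real (Suc k)"
      using norm_binet_tail_le[OF c] by blast
    show ?thesis
    proof (rule Lim_null_comparison)
      show "eventually (\<lambda>x. norm (binet_tail c (n x) (z x)) \<le> K * norm (z x) / real (n x - 1)) F"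
        using zpos eventually_compose_filterlim[OF eventually_ge_at_top[of 2] n]
      proof eventually_elim
        case (elim x)
        obtain k where "n x = Suc (Suc k)" using le_Suc_ex[OF elim(2)] by auto
        thus ?case using K[OF elim(1), of k] by simp
      qed
      have "filterlim (\<lambda>k::nat. real (k - 1)) at_top sequentially" by real_asymp
      hence "filterlim (\<lambda>x. real (n x - 1)) at_infinity F"
        by (intro filterlim_at_top_imp_at_infinity filterlim_compose[OF _ n])
      thus "((\<lambda>x. K * norm (z x) / real (n x - 1)) \<longlongrightarrow> 0) F"
        by (intro tendsto_divide_0[OF tendsto_mult[OF tendsto_const tendsto_norm[OF z]]])
    qed
  qed
  have log: "((\<lambda>x. complex_of_real (ln (real (Suc (n x))) - ln (real (n x)))) \<longlongrightarrow> of_real 0) F"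
  proof (intro tendsto_of_real)
    have "(\<lambda>k. ln (real (Suc k)) - ln (real k)) \<longlonglongrightarrow> 0" by real_asymp
    thus "((\<lambda>x. ln (real (Suc (n x))) - ln (real (n x))) \<longlongrightarrow> 0) F" by (rule filterlim_compose[OF _ n])
  qed
  have "((\<lambda>x. of_real c * ((\<Sum>j<n x. barnes_term (u x) j) - S (u x))
      - z x * u x / 2 * of_real (ln (real (Suc (n x))) - ln (real (n x)))
      + (z x - 1 / 2) * E (u x) (n x) + E 0 (n x) / 2 - binet_tail c (n x) (z x))
      \<longlongrightarrow> of_real c * 0 - z0 * (z0 / of_real c) / 2 * of_real 0 + (z0 - 1 / 2) * 0 + 0 / 2 - 0) F"
    by (intro tendsto_intros barnes z u log E_lim[OF u upos] E_lim[of "\<lambda>_. 0" 0] tail) auto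
  moreover have "eventually (\<lambda>x. of_real c * ((\<Sum>j<n x. barnes_term (u x) j) - S (u x))
      - z x * u x / 2 * of_real (ln (real (Suc (n x))) - ln (real (n x)))
      + (z x - 1 / 2) * E (u x) (n x) + E 0 (n x) / 2 - binet_tail c (n x) (z x)
      = ln_Gamma_sum (\<beta> / 2) (n x) (z x) - (main_term \<beta> (n x) (z x) + Upsilon \<beta> (z x))) F"
    using zpos eventually_compose_filterlim[OF eventually_gt_at_top[of 0] n]
  proof eventually_elim
    case (elim x)
    define Z where "Z = z x"
    define U where "U = u x"
    define N where "N = n x"
    define l where "l = complex_of_real (ln (real N))"
    define lc where "lc = complex_of_real (ln c)"
    define C where "C = complex_of_real c"
    have C0: "C \<noteq> 0" using c by (simp add: C_def)
    have ZU: "Z = C * U" using c by (simp add: Z_def U_def u_def C_def)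
    have N: "0 < N" using elim by (simp add: N_def)
    have ReU: "-1 < Re U" using elim c by (simp add: U_def u_def field_simps)
    have arg: "2 * Z / of_real \<beta> + 1 = 1 + U" using C0 by (simp add: \<beta>c ZU C_def)
    have T0: "(LINT s:{0<..}|lborel. of_real (binet_phi s) * (exp (- (of_real s * Z)) - 1) / of_real (exp (s * \<beta> / 2) - 1)) = binet_tail c 0 Z"
      unfolding binet_tail_def tail_integrand_def by (simp add: \<beta>c)
    have Ups: "Upsilon \<beta> Z = C * (U / 2 * of_real (ln (2 * pi)) - (U + 1) * U / 2 + S U)
       - (Z - 1 / 2) * ln_Gamma (1 + U) + binet_tail c 0 Z + Z\<^sup>2 / (2 * C) + Z / 2"
      unfolding Upsilon_def arg ln_barnes_G_eq[OF ReU] T0 ln_G_def by (simp add: \<beta>c C_def S_def)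
    have main: "main_term \<beta> N Z = Z * ((1 / 2 - 1 / (2 * C)) * l - of_nat N + of_nat N * (lc + l)) + Z\<^sup>2 / (2 * C) * l"
    proof -
      have "ln (\<beta> / 2 * real N) = ln c + ln (real N)" using c N by (simp add: \<beta>c ln_mult_pos)
      thus ?thesis unfolding main_term_def by (simp add: \<beta>c C_def l_def lc_def)
    qed
    have sum: "ln_Gamma_sum c N Z = of_nat N * Z * lc
     + C * ((\<Sum>j<N. barnes_term U j) - U\<^sup>2 / 2 * of_real (ln (real (Suc N))))
     + (Z - 1 / 2) * (ln_Gamma (1 + U + of_nat N) - ln_Gamma (1 + U))
     + of_real (ln (fact N)) / 2 + (binet_tail c 0 Z - binet_tail c N Z)"
      using ln_Gamma_sum_eq[OF c, of Z N] elim(1) unfolding Z_def U_def u_def C_def lc_def by simp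
    have fact: "of_real (ln (fact N)) = ln_Gamma (1 + 0 + of_nat N :: complex)"
    proof -
      have "ln_Gamma (of_nat (Suc N) :: complex) = ln (fact N)" using ln_Gamma_complex_conv_fact[of "Suc N"] by simp
      also have "\<dots> = of_real (ln (fact N))" using Ln_of_real[of "fact N"] by simp
      finally show ?thesis by simp
    qed
    have EU: "ln_Gamma (1 + U + of_nat N) = E U N + ((of_nat N + 1 / 2 + U) * l - of_nat N + of_real (ln (2 * pi) / 2))"
      by (simp add: E_def l_def)
    have E0: "ln_Gamma (1 + 0 + of_nat N) = E 0 N + ((of_nat N + 1 / 2) * l - of_nat N + of_real (ln (2 * pi) / 2))"
      by (simp add: E_def l_def)
    define p where "p = complex_of_real (ln (2 * pi))"
    have half: "complex_of_real (ln (2 * pi) / 2) = p / 2" by (simp add: p_def)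
    show ?case
      unfolding Z_def[symmetric] U_def[symmetric] N_def[symmetric] c_def[symmetric]
      unfolding Ups main sum fact EU E0 half p_def[symmetric] of_real_diff C_def[symmetric] l_def[symmetric]
      using C0 by (simp add: ZU field_simps power2_eq_square)
  qed
  ultimately show ?thesis by (simp add: Lim_transform_eventually)
qed

text \<open>
  The difference of two exponentials brings in a factor \<open>s\<close>, which gains one power of \<open>a\<close> in the
  integral.
\<close>

lemma norm_binet_diff_le:
  "\<exists>C. \<forall>a v w. 0 < a \<longrightarrow> a \<le> Re v \<longrightarrow> a \<le> Re w \<longrightarrow> norm (binet v - binet w) \<le> C * norm (v - w) / a\<^sup>2"
proof -
  obtain C where C: "0 \<le> C" "\<And>s. 0 < s \<Longrightarrow> \<bar>binet_phi s\<bar> \<le> C" using binet_phi_bounded by blast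
  have "norm (binet v - binet w) \<le> (4 * C) * norm (v - w) / a\<^sup>2" if a: "0 < a" "a \<le> Re v" "a \<le> Re w" for a v w
  proof -
    have vw: "0 < Re v" "0 < Re w" using a by auto
    have a2: "0 < a / 2" using a by simp
    have "norm (binet v - binet w) = norm (LINT s:{0<..}|lborel.
        of_real (binet_phi s) * exp (- (of_real s * v)) - of_real (binet_phi s) * exp (- (of_real s * w)))"
      unfolding binet_def by (subst set_integral_diff(2)[OF set_integrable_binet set_integrable_binet]) (use vw in auto)
    also have "\<dots> \<le> (LINT s:{0<..}|lborel. C * norm (v - w) * (2 / a) * exp (- (s * (a / 2))))"
    proof (rule set_integrable_dominated(2))
      show "set_integrable lborel {0<..} (\<lambda>s. C * norm (v - w) * (2 / a) * exp (- (s * (a / 2))))"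
        by (intro set_integrable_mult_right set_integrable_exp_decay(1)[OF a2])
      show "(\<lambda>s. indicator {0<..} s *\<^sub>R (of_real (binet_phi s) * exp (- (of_real s * v)) - of_real (binet_phi s) * exp (- (of_real s * w)))) \<in> borel_measurable lborel"
        by measurable
      fix s :: real assume "s \<in> {0<..}"
      hence s: "0 < s" by simp
      have "norm (exp (- (of_real s * v)) - exp (- (of_real s * w))) = norm (exp (- (of_real s * w)) * (exp (- (of_real s * (v - w))) - 1))"
        by (simp add: right_diff_distrib mult_exp_exp algebra_simps)
      also have "\<dots> \<le> exp (- (s * Re w)) * (norm (- (of_real s * (v - w))) * max 1 (exp (Re (- (of_real s * (v - w))))))"
        unfolding norm_mult[of "exp _"] by (intro mult_mono norm_exp_minus_1_le_max) auto
      also have "\<dots> = s * norm (v - w) * (exp (- (s * Re w)) * max 1 (exp (- (s * (Re v - Re w)))))"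
        using s by (simp add: norm_mult)
      also have "exp (- (s * Re w)) * max 1 (exp (- (s * (Re v - Re w)))) = max (exp (- (s * Re w))) (exp (- (s * Re v)))"
        by (auto simp: max_def mult_exp_exp algebra_simps)
      also have "s * norm (v - w) * \<dots> \<le> (2 / a * exp (s * (a / 2))) * norm (v - w) * exp (- (s * a))"
      proof (intro mult_mono)
        have "s * (a / 2) \<le> exp (s * (a / 2))" using exp_ge_add_one_self[of "s * (a / 2)"] by linarith
        thus "s \<le> 2 / a * exp (s * (a / 2))" using a by (simp add: field_simps)
      qed (use s a in \<open>auto simp: max_def\<close>)
      also have "\<dots> = norm (v - w) * (2 / a) * (exp (s * (a / 2)) * exp (- (s * a)))" by simp
      also have "exp (s * (a / 2)) * exp (- (s * a)) = exp (- (s * (a / 2)))" by (simp add: mult_exp_exp algebra_simps)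
      finally have le: "norm (exp (- (of_real s * v)) - exp (- (of_real s * w))) \<le> norm (v - w) * (2 / a) * exp (- (s * (a / 2)))" .
      have "norm (of_real (binet_phi s) * exp (- (of_real s * v)) - of_real (binet_phi s) * exp (- (of_real s * w)))
          = \<bar>binet_phi s\<bar> * norm (exp (- (of_real s * v)) - exp (- (of_real s * w)))"
        unfolding right_diff_distrib[symmetric] norm_mult by simp
      also have "\<dots> \<le> C * (norm (v - w) * (2 / a) * exp (- (s * (a / 2))))"
        using C s le by (intro mult_mono) auto
      finally show "norm (of_real (binet_phi s) * exp (- (of_real s * v)) - of_real (binet_phi s) * exp (- (of_real s * w)))
          \<le> C * norm (v - w) * (2 / a) * exp (- (s * (a / 2)))" by (simp only: mult.assoc)
    qed
    also have "\<dots> = C * norm (v - w) * (2 / a) * (1 / (a / 2))"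
      unfolding set_integral_mult_right set_integrable_exp_decay(2)[OF a2] ..
    also have "\<dots> = (4 * C) * norm (v - w) / a\<^sup>2" by (simp add: power2_eq_square)
    finally show ?thesis .
  qed
  thus ?thesis by blast
qed

text \<open>
  The factor \<open>n\<close> requires one order more than Stirling's formula: with $h = cn$, the second order of
  $\ln(1 + z / h)$ contributes $(z^2 - z) / (2c)$, and the Binet remainders at $h + z$ and $h$ differ
  only by $O(h^{-2})$.
\<close>

lemma ln_Gamma_increment_asymptotics:
  fixes n :: "'x \<Rightarrow> nat" and z :: "'x \<Rightarrow> complex"
  assumes c: "0 < c" and n: "filterlim n at_top F" and z: "(z \<longlongrightarrow> z0) F" and z0: "- c < Re z0"
  shows "((\<lambda>x. of_nat (n x) * (ln_Gamma (of_real (c * real (n x)) + z x) - ln_Gamma (of_real (c * real (n x))))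
     - (of_nat (n x) * z x * of_real (ln (c * real (n x))) + ((z x)\<^sup>2 - z x) / (2 * of_real c))) \<longlongrightarrow> 0) F"
proof -
  define h where "h = (\<lambda>x. complex_of_real (c * real (n x)))"
  have zpos: "eventually (\<lambda>x. - c < Re (z x)) F"
    using z0 order_tendstoD(1)[OF tendsto_Re[OF z]] by simp
  have n2: "eventually (\<lambda>x. 2 \<le> n x) F" by (rule eventually_compose_filterlim[OF eventually_ge_at_top n])
  have h_inf: "filterlim h at_infinity F"
  proof -
    have "filterlim (\<lambda>x. c * real (n x)) at_top F"
      using c by (intro filterlim_tendsto_pos_mult_at_top[OF tendsto_const] filterlim_compose[OF filterlim_real_sequentially n])
    hence "filterlim (\<lambda>x. norm (h x)) at_top F"
      using c by (simp add: h_def norm_mult abs_of_pos)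
    thus ?thesis by (rule filterlim_norm_at_top_imp_at_infinity)
  qed
  define \<Lambda> where "\<Lambda> = (\<lambda>x. Ln (1 + z x / h x))"
  have lin: "((\<lambda>x. h x * \<Lambda> x) \<longlongrightarrow> z0) F"
    using tendsto_Ln_div[OF z h_inf tendsto_const[of 0]] by (simp add: \<Lambda>_def)
  have small: "eventually (\<lambda>x. norm (z x / h x) < 1 / 2) F"
  proof -
    have "((\<lambda>x. z x / h x) \<longlongrightarrow> 0) F" by (rule tendsto_divide_0[OF z h_inf])
    from order_tendstoD(2)[OF tendsto_norm_zero[OF this], of "1 / 2"] show ?thesis by simp
  qed
  have quad: "((\<lambda>x. of_nat (n x) * (h x * \<Lambda> x - z x) + (z x)\<^sup>2 / (2 * of_real c)) \<longlongrightarrow> 0) F"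
  proof (rule Lim_null_comparison)
    show "eventually (\<lambda>x. norm (of_nat (n x) * (h x * \<Lambda> x - z x) + (z x)\<^sup>2 / (2 * of_real c)) \<le> 8 * norm (z x) ^ 3 / c\<^sup>2 / real (n x)) F"
      using small n2
    proof eventually_elim
      case (elim x)
      define N where "N = real (n x)"
      have N: "0 < N" "complex_of_nat (n x) = of_real N" "h x = of_real (c * N)" using elim by (auto simp: N_def h_def)
      have hz: "h x \<noteq> 0" using c N by simp
      have "of_nat (n x) * (h x * \<Lambda> x - z x) + (z x)\<^sup>2 / (2 * of_real c)
          = of_real (c * N\<^sup>2) * (\<Lambda> x - z x / h x + (z x / h x)\<^sup>2 / 2)"
        unfolding N(2,3) using c N(1) by (simp add: field_simps power2_eq_square)
      hence "norm (of_nat (n x) * (h x * \<Lambda> x - z x) + (z x)\<^sup>2 / (2 * of_real c))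
          = c * N\<^sup>2 * norm (\<Lambda> x - z x / h x + (z x / h x)\<^sup>2 / 2)"
        using c by (simp only: norm_mult norm_of_real) simp
      also have "\<dots> \<le> c * N\<^sup>2 * (8 * norm (z x / h x) ^ 3)"
        unfolding \<Lambda>_def using c elim by (intro mult_left_mono Ln_approx_quadratic) auto
      also have "norm (z x / h x) = norm (z x) / (c * N)"
        unfolding N(3) using c N(1) by (simp add: norm_divide norm_mult)
      also have "c * N\<^sup>2 * (8 * (norm (z x) / (c * N)) ^ 3) = 8 * norm (z x) ^ 3 / c\<^sup>2 / N"
        using c N(1) by (simp add: field_simps power2_eq_square power3_eq_cube)
      finally show ?case by (simp only: N_def)
    qed
    have "filterlim (\<lambda>x. real (n x)) at_infinity F"
      by (intro filterlim_at_top_imp_at_infinity filterlim_compose[OF filterlim_real_sequentially n])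
    thus "((\<lambda>x. 8 * norm (z x) ^ 3 / c\<^sup>2 / real (n x)) \<longlongrightarrow> 0) F"
      using c by (intro tendsto_divide_0[of "\<lambda>x. 8 * norm (z x) ^ 3 / c\<^sup>2" "8 * norm z0 ^ 3 / c\<^sup>2"] tendsto_intros z) auto
  qed
  have binet: "((\<lambda>x. of_nat (n x) * (binet (h x + z x) - binet (h x))) \<longlongrightarrow> 0) F"
  proof -
    obtain C where C: "\<And>a v w. 0 < a \<Longrightarrow> a \<le> Re v \<Longrightarrow> a \<le> Re w \<Longrightarrow> norm (binet v - binet w) \<le> C * norm (v - w) / a\<^sup>2"
      using norm_binet_diff_le by blast
    show ?thesis
    proof (rule Lim_null_comparison)
      show "eventually (\<lambda>x. norm (of_nat (n x) * (binet (h x + z x) - binet (h x)))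
          \<le> C * norm (z x) * (real (n x) / (c * (real (n x) - 1))\<^sup>2)) F"
        using zpos n2
      proof eventually_elim
        case (elim x)
        have "0 < c * (real (n x) - 1)" using c elim by simp
        moreover have "c * (real (n x) - 1) \<le> Re (h x + z x)" "c * (real (n x) - 1) \<le> Re (h x)"
          using c elim by (auto simp: h_def algebra_simps)
        ultimately have "norm (binet (h x + z x) - binet (h x)) \<le> C * norm (h x + z x - h x) / (c * (real (n x) - 1))\<^sup>2"
          by (rule C)
        hence "real (n x) * norm (binet (h x + z x) - binet (h x)) \<le> real (n x) * (C * norm (h x + z x - h x) / (c * (real (n x) - 1))\<^sup>2)"
          by (rule mult_left_mono) simp
        thus ?case by (simp add: norm_mult mult_ac)
      qed
      have "((\<lambda>k. real k / (c * (real k - 1))\<^sup>2) \<longlongrightarrow> 0) sequentially" using c by real_asymp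
      from filterlim_compose[OF this n]
      have "((\<lambda>x. C * norm (z x) * (real (n x) / (c * (real (n x) - 1))\<^sup>2)) \<longlongrightarrow> C * norm z0 * 0) F"
        by (intro tendsto_mult tendsto_const tendsto_norm z)
      thus "((\<lambda>x. C * norm (z x) * (real (n x) / (c * (real (n x) - 1))\<^sup>2)) \<longlongrightarrow> 0) F" by simp
    qed
  qed
  have "((\<lambda>x. (of_nat (n x) * (h x * \<Lambda> x - z x) + (z x)\<^sup>2 / (2 * of_real c))
       + ((z x - 1 / 2) * (h x * \<Lambda> x) / of_real c - (z x - 1 / 2) * z x / of_real c)
       + of_nat (n x) * (binet (h x + z x) - binet (h x)))
       \<longlongrightarrow> 0 + ((z0 - 1 / 2) * z0 / of_real c - (z0 - 1 / 2) * z0 / of_real c) + 0) F"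
    using c by (intro tendsto_intros quad binet lin z) auto
  moreover have "eventually (\<lambda>x. (of_nat (n x) * (h x * \<Lambda> x - z x) + (z x)\<^sup>2 / (2 * of_real c))
       + ((z x - 1 / 2) * (h x * \<Lambda> x) / of_real c - (z x - 1 / 2) * z x / of_real c)
       + of_nat (n x) * (binet (h x + z x) - binet (h x))
     = of_nat (n x) * (ln_Gamma (of_real (c * real (n x)) + z x) - ln_Gamma (of_real (c * real (n x))))
     - (of_nat (n x) * z x * of_real (ln (c * real (n x))) + ((z x)\<^sup>2 - z x) / (2 * of_real c))) F"
    using zpos n2
  proof eventually_elim
    case (elim x)
    define N where "N = complex_of_nat (n x)"
    define Z where "Z = z x"
    define H where "H = h x"
    define C where "C = complex_of_real c"
    define l where "l = complex_of_real (ln (c * real (n x)))"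
    have "c * 1 \<le> c * real (n x)" using c elim by (intro mult_left_mono) auto
    hence pos: "0 < c * real (n x)" "0 < c * real (n x) + Re Z" using c elim unfolding Z_def by linarith+
    have re: "0 < Re H" "0 < Re (H + Z)" using pos by (auto simp: H_def h_def)
    have C0: "C \<noteq> 0" and HN: "H = C * N" using c by (auto simp: C_def H_def h_def N_def)
    have LnH: "Ln H = l" unfolding H_def h_def l_def using pos(1) by (rule Ln_of_real)
    have LnHZ: "Ln (H + Z) = l + \<Lambda> x"
    proof -
      have H0: "H \<noteq> 0" "H + Z \<noteq> 0" using re by (metis less_irrefl zero_complex.sel(1))+
      have "H + Z = H * (1 + Z / H)" using H0 by (simp add: field_simps)
      hence "H + Z = of_real (c * real (n x)) * (1 + Z / H)" by (simp only: H_def h_def)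
      moreover have "1 + Z / H \<noteq> 0" using H0 by (simp add: field_simps)
      ultimately have "Ln (H + Z) = Ln (of_real (c * real (n x))) + Ln (1 + Z / H)"
        using Ln_times_of_real[OF pos(1), of "1 + Z / H"] Ln_of_real[OF pos(1)] by simp
      thus ?thesis using Ln_of_real[OF pos(1)] by (simp add: l_def \<Lambda>_def Z_def H_def)
    qed
    have Hc: "complex_of_real (c * real (n x)) = H" by (simp only: H_def h_def)
    show ?case
      unfolding Hc l_def[symmetric] C_def[symmetric] N_def[symmetric] Z_def[symmetric] H_def[symmetric]
      unfolding binet_formula[OF re(1)] binet_formula[OF re(2)] stirling_main_def LnH LnHZ
      using C0 by (simp add: HN field_simps power2_eq_square)
  qed
  ultimately show ?thesis by (simp add: Lim_transform_eventually)
qed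


section \<open>Locally uniform limits\<close>

text \<open>
  A joint limit at each point gives, for every tolerance, a neighbourhood of the point on which the
  bound holds uniformly for large $n$.  The neighbourhood depends on the tolerance, but finitely many of
  them cover a compact disc.
\<close>

lemma locally_uniform_limit_0I:
  fixes f :: "nat \<Rightarrow> complex \<Rightarrow> complex"
  assumes A: "open A"
    and lim: "\<And>z. z \<in> A \<Longrightarrow> ((\<lambda>p. f (fst p) (snd p)) \<longlongrightarrow> 0) (sequentially \<times>\<^sub>F nhds z)"
  shows "locally_uniform_limit_on A f (\<lambda>_. 0) sequentially"
  unfolding locally_uniform_limit_on_def
proof
  fix x assume "x \<in> A"
  then obtain r where r: "0 < r" "cball x r \<subseteq> A" using A open_contains_cball by blast
  have "uniform_limit (cball x r) f (\<lambda>_. 0) sequentially"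
    unfolding uniform_limit_iff
  proof (intro allI impI)
    fix e :: real assume e: "0 < e"
    have "\<exists>S. open S \<and> y \<in> S \<and> (\<forall>\<^sub>F n in sequentially. \<forall>w\<in>S. dist (f n w) 0 < e)" if "y \<in> cball x r" for y
    proof -
      have "y \<in> A" using that r by blast
      from tendstoD[OF lim[OF this] e]
      have "\<forall>\<^sub>F p in sequentially \<times>\<^sub>F nhds y. dist (f (fst p) (snd p)) 0 < e" .
      then obtain P Q where PQ: "eventually P sequentially" "eventually Q (nhds y)"
        "\<And>n w. P n \<Longrightarrow> Q w \<Longrightarrow> dist (f n w) 0 < e"
        unfolding eventually_prod_filter by auto
      from PQ(2) obtain S where "open S" "y \<in> S" "\<And>w. w \<in> S \<Longrightarrow> Q w" by (auto simp: eventually_nhds)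
      moreover have "\<forall>\<^sub>F n in sequentially. \<forall>w\<in>S. dist (f n w) 0 < e"
        using PQ(1) by eventually_elim (use PQ(3) \<open>\<And>w. w \<in> S \<Longrightarrow> Q w\<close> in blast)
      ultimately show ?thesis by blast
    qed
    hence "\<forall>y\<in>cball x r. \<exists>S. open S \<and> y \<in> S \<and> (\<forall>\<^sub>F n in sequentially. \<forall>w\<in>S. dist (f n w) 0 < e)"
      by blast
    from bchoice[OF this] obtain S where
      S: "\<And>y. y \<in> cball x r \<Longrightarrow> open (S y) \<and> y \<in> S y \<and> (\<forall>\<^sub>F n in sequentially. \<forall>w\<in>S y. dist (f n w) 0 < e)"
      by blast
    have "compact (cball x r)" by simp
    then obtain C where C: "C \<subseteq> cball x r" "finite C" "cball x r \<subseteq> (\<Union>y\<in>C. S y)"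
    proof (rule compactE_image[of "cball x r" "cball x r" S])
      show "open (S y)" if "y \<in> cball x r" for y using S[OF that] by simp
      show "cball x r \<subseteq> (\<Union>y\<in>cball x r. S y)" using S by blast
    qed auto
    have "\<forall>\<^sub>F n in sequentially. \<forall>y\<in>C. \<forall>w\<in>S y. dist (f n w) 0 < e"
      using C S by (intro eventually_ball_finite) auto
    thus "\<forall>\<^sub>F n in sequentially. \<forall>w\<in>cball x r. dist (f n w) 0 < e"
      by eventually_elim (use C(3) in blast)
  qed
  hence "uniform_limit (ball x r \<inter> A) f (\<lambda>_. 0) sequentially"
    by (rule uniform_limit_on_subset) auto
  thus "\<exists>U. open U \<and> x \<in> U \<and> uniform_limit (U \<inter> A) f (\<lambda>_. 0) sequentially"
    using r by (intro exI[of _ "ball x r"]) auto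
qed

lemma n_floor_asymptotics:
  assumes "0 < \<tau>"
  shows "(\<lambda>n. real (n_floor \<tau> n) / real n) \<longlonglongrightarrow> \<tau>" and "filterlim (n_floor \<tau>) at_top sequentially"
proof -
  have eq: "real (n_floor \<tau> n) = of_int \<lfloor>real n * \<tau>\<rfloor>" for n
    using assms by (simp add: n_floor_def)
  show "(\<lambda>n. real (n_floor \<tau> n) / real n) \<longlonglongrightarrow> \<tau>"
    unfolding eq using assms by real_asymp
  have "filterlim (\<lambda>n. real (n_floor \<tau> n)) at_top sequentially"
    unfolding eq using assms by real_asymp
  thus "filterlim (n_floor \<tau>) at_top sequentially"
    by (simp add: filterlim_sequentially_iff_filterlim_real)
qed

lemma eventually_seq_nhds_half_plane:
  assumes "z0 \<in> half_plane c"
  shows "\<forall>\<^sub>F p in sequentially \<times>\<^sub>F nhds z0. 0 < fst p \<and> snd p \<in> half_plane c"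
  using eventually_compose_filterlim[OF eventually_gt_at_top[of "0 :: nat"] filterlim_fst]
    topological_tendstoD[OF filterlim_snd open_half_plane assms]
  by (rule eventually_conj)

lemma log_mellin_laguerre_tendsto:
  assumes \<beta>: "0 < \<beta>" and z0: "z0 \<in> half_plane (\<beta> / 2)"
  shows "((\<lambda>p. log_mellin \<beta> (laguerre_ensemble \<beta> (fst p)) (laguerre_det (fst p)) (snd p)
         - (snd p * of_real (mu_L \<beta> (fst p)) + (snd p)\<^sup>2 / of_real \<beta> * of_real (ln (real (fst p)))
            + Upsilon \<beta> (snd p))) \<longlongrightarrow> 0) (sequentially \<times>\<^sub>F nhds z0)"
    (is "((\<lambda>p. ?f p) \<longlongrightarrow> 0) _")
proof (rule Lim_transform_eventually)
  show "((\<lambda>p. ln_Gamma_sum (\<beta> / 2) (fst p) (snd p) - (main_term \<beta> (fst p) (snd p) + Upsilon \<beta> (snd p))) \<longlongrightarrow> 0)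
      (sequentially \<times>\<^sub>F nhds z0)"
    using z0 by (intro ln_Gamma_sum_asymptotics[OF \<beta> filterlim_fst filterlim_snd]) (simp add: half_plane_def)
  show "\<forall>\<^sub>F p in sequentially \<times>\<^sub>F nhds z0.
      ln_Gamma_sum (\<beta> / 2) (fst p) (snd p) - (main_term \<beta> (fst p) (snd p) + Upsilon \<beta> (snd p)) = ?f p"
    using eventually_seq_nhds_half_plane[OF z0]
  proof eventually_elim
    case (elim p)
    have "ln (\<beta> * real (fst p)) = ln 2 + ln (\<beta> / 2 * real (fst p))"
      using \<beta> elim ln_mult_pos[of 2 "\<beta> / 2 * real (fst p)"] by simp
    thus ?case
      unfolding log_mellin_laguerre[OF \<beta> conjunct2[OF elim]] main_term_def mu_L_def by (simp add: algebra_simps)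
  qed
qed

lemma log_mellin_gram_tendsto:
  assumes \<beta>: "0 < \<beta>" and z0: "z0 \<in> half_plane (\<beta> / 2)"
  shows "((\<lambda>p. log_mellin \<beta> (gram_ensemble \<beta> (fst p)) (gram_det (fst p)) (snd p)
         - (snd p * of_real (mu_G \<beta> (fst p)) + (snd p)\<^sup>2 / of_real \<beta> * of_real (ln (real (fst p)))
            - (snd p)\<^sup>2 / of_real \<beta> + Upsilon \<beta> (snd p))) \<longlongrightarrow> 0) (sequentially \<times>\<^sub>F nhds z0)"
    (is "((\<lambda>p. ?f p) \<longlongrightarrow> 0) _")
proof (rule Lim_transform_eventually)
  let ?S = "\<lambda>p. ln_Gamma_sum (\<beta> / 2) (fst p) (snd p) - (main_term \<beta> (fst p) (snd p) + Upsilon \<beta> (snd p))"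
  let ?I = "\<lambda>p. of_nat (fst p) * (ln_Gamma (of_real (\<beta> / 2 * real (fst p)) + snd p) - ln_Gamma (of_real (\<beta> / 2 * real (fst p))))
     - (of_nat (fst p) * snd p * of_real (ln (\<beta> / 2 * real (fst p))) + ((snd p)\<^sup>2 - snd p) / (2 * of_real (\<beta> / 2)))"
  have Re_z0: "- (\<beta> / 2) < Re z0" using z0 by (simp add: half_plane_def)
  have "((\<lambda>p. ?S p - ?I p) \<longlongrightarrow> 0 - 0) (sequentially \<times>\<^sub>F nhds z0)"
    using \<beta> by (intro tendsto_diff ln_Gamma_sum_asymptotics[OF \<beta> filterlim_fst filterlim_snd Re_z0]
      ln_Gamma_increment_asymptotics[OF _ filterlim_fst filterlim_snd Re_z0]) simp
  thus "((\<lambda>p. ?S p - ?I p) \<longlongrightarrow> 0) (sequentially \<times>\<^sub>F nhds z0)" by simp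
  show "\<forall>\<^sub>F p in sequentially \<times>\<^sub>F nhds z0. ?S p - ?I p = ?f p"
    using eventually_seq_nhds_half_plane[OF z0]
  proof eventually_elim
    case (elim p)
    have "((snd p)\<^sup>2 - snd p) / (2 * of_real (\<beta> / 2)) = (snd p)\<^sup>2 / of_real \<beta> - snd p * of_real (1 / \<beta>)"
      by (simp add: diff_divide_distrib)
    thus ?case unfolding log_mellin_gram[OF \<beta> conjunct1[OF elim] conjunct2[OF elim]] main_term_def mu_G_def
      by (simp only: of_real_add of_real_diff of_real_mult of_real_minus of_real_of_nat_eq) (simp add: algebra_simps)
  qed
qed

text \<open>
  The expansions at $n_1$, $n_2$ and $n_1 + n_2$ are combined.  Their logarithmic terms add up to
  $\ln(n_1 n_2 / (n_1 + n_2))$, which is $\ln n + \ln(\tau_1 \tau_2 / (\tau_1 + \tau_2)) + \Delta$ with a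
  small error $\Delta$; the terms of order $n \ln n$ form the two values of \<open>epsilon\<close>.
\<close>

lemma log_mellin_jacobi_tendsto:
  assumes \<beta>: "0 < \<beta>" and \<tau>12: "0 < \<tau>1" "0 < \<tau>2" and z0: "z0 \<in> half_plane (\<beta> / 2)"
  shows "((\<lambda>p. log_mellin \<beta> (jacobi_ensemble \<beta> (n_floor \<tau>1 (fst p)) (n_floor \<tau>2 (fst p)))
                (jacobi_det (n_floor \<tau>1 (fst p)) (n_floor \<tau>2 (fst p))) (snd p)
         - (snd p * of_real (mu_J \<beta> \<tau>1 \<tau>2 (fst p)) + (snd p)\<^sup>2 / of_real \<beta> * of_real (ln (real (fst p)))
            + (snd p)\<^sup>2 / of_real \<beta> * of_real (ln (\<tau>1 * \<tau>2 / (\<tau>1 + \<tau>2)))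
            + Upsilon \<beta> (snd p))) \<longlongrightarrow> 0) (sequentially \<times>\<^sub>F nhds z0)"
    (is "((\<lambda>p. ?f p) \<longlongrightarrow> 0) ?F")
proof (rule Lim_transform_eventually)
  have Re_z0: "- (\<beta> / 2) < Re z0" using z0 by (simp add: half_plane_def)
  define n1 where "n1 = (\<lambda>p::nat \<times> complex. n_floor \<tau>1 (fst p))"
  define n2 where "n2 = (\<lambda>p::nat \<times> complex. n_floor \<tau>2 (fst p))"
  have n1: "filterlim n1 at_top ?F" and n2: "filterlim n2 at_top ?F"
    unfolding n1_def n2_def using n_floor_asymptotics(2) \<tau>12 filterlim_fst by (auto intro: filterlim_compose)
  have n12: "filterlim (\<lambda>p. n1 p + n2 p) at_top ?F"
    by (rule filterlim_at_top_mono[OF n1]) simp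
  define \<tau> where "\<tau> = \<tau>1 * \<tau>2 / (\<tau>1 + \<tau>2)"
  have \<tau>: "0 < \<tau>" using \<tau>12 by (simp add: \<tau>_def)
  have "(\<lambda>n. ln ((real (n_floor \<tau>1 n) / real n) * (real (n_floor \<tau>2 n) / real n) /
      (real (n_floor \<tau>1 n) / real n + real (n_floor \<tau>2 n) / real n))) \<longlonglongrightarrow> ln \<tau>"
    unfolding \<tau>_def using \<tau>12 by (intro tendsto_intros n_floor_asymptotics) auto
  from filterlim_compose[OF this filterlim_fst]
  have log: "((\<lambda>p. ln ((real (n1 p) / real (fst p)) * (real (n2 p) / real (fst p)) /
      (real (n1 p) / real (fst p) + real (n2 p) / real (fst p)))) \<longlongrightarrow> ln \<tau>) ?F"
    by (simp add: n1_def n2_def)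
  \<comment> \<open>the error in replacing \<open>n_i / n\<close> by \<open>\<tau>_i\<close>\<close>
  define \<Delta> where "\<Delta> = (\<lambda>p. ln ((real (n1 p) / real (fst p)) * (real (n2 p) / real (fst p)) /
      (real (n1 p) / real (fst p) + real (n2 p) / real (fst p))) - ln \<tau>)"
  have \<Delta>: "((\<lambda>p. complex_of_real (\<Delta> p)) \<longlongrightarrow> of_real 0) ?F"
    unfolding \<Delta>_def using tendsto_diff[OF log tendsto_const[of "ln \<tau>"]] by (intro tendsto_of_real) simp
  define D where "D = (\<lambda>k z. ln_Gamma_sum (\<beta> / 2) k z - (main_term \<beta> k z + Upsilon \<beta> z))"
  have D: "((\<lambda>p. D (k p) (snd p)) \<longlongrightarrow> 0) ?F" if "filterlim k at_top ?F" for k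
    unfolding D_def by (rule ln_Gamma_sum_asymptotics[OF \<beta> that filterlim_snd Re_z0])
  let ?g = "\<lambda>p. D (n1 p) (snd p) + D (n2 p) (snd p) - D (n1 p + n2 p) (snd p)
      + (snd p * of_real (1 / 2 - 1 / \<beta>) + (snd p)\<^sup>2 / of_real \<beta>) * of_real (\<Delta> p)"
  have "(?g \<longlongrightarrow> 0 + 0 - 0 + (z0 * of_real (1 / 2 - 1 / \<beta>) + z0\<^sup>2 / of_real \<beta>) * of_real 0) ?F"
    using \<beta> by (intro tendsto_intros D n1 n2 n12 filterlim_snd \<Delta>) auto
  thus "(?g \<longlongrightarrow> 0) ?F" by simp
  show "\<forall>\<^sub>F p in ?F. ?g p = ?f p"
    using eventually_seq_nhds_half_plane[OF z0] eventually_compose_filterlim[OF eventually_gt_at_top[of 0] n1]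
      eventually_compose_filterlim[OF eventually_gt_at_top[of 0] n2]
  proof eventually_elim
    case (elim p)
    define Z where "Z = snd p"
    define x where "x = real (n1 p)"
    define y where "y = real (n2 p)"
    define N where "N = real (fst p)"
    define q where "q = 1 / 2 - 1 / \<beta>"
    have pos: "0 < x" "0 < y" "0 < N" "0 < x + y" using elim by (auto simp: x_def y_def N_def)
    have \<Delta>_eq: "\<Delta> p = ln x + ln y - ln (x + y) - ln N - ln \<tau>"
    proof -
      have "(x / N) * (y / N) / (x / N + y / N) = x * y / ((x + y) * N)" using pos by (simp add: field_simps)
      hence "\<Delta> p = ln (x * y / ((x + y) * N)) - ln \<tau>"
        unfolding \<Delta>_def x_def[symmetric] y_def[symmetric] N_def[symmetric] by (simp only:)
      also have "ln (x * y / ((x + y) * N)) = ln x + ln y - (ln (x + y) + ln N)"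
        using pos by (simp add: ln_div ln_mult_pos)
      finally show ?thesis by simp
    qed
    have eps: "epsilon x y = x * (ln (x + y) - ln x)" "epsilon y x = y * (ln (x + y) - ln y)"
    proof -
      have "1 + y / x = (x + y) / x" "1 + x / y = (x + y) / y" using pos by (auto simp: field_simps)
      thus "epsilon x y = x * (ln (x + y) - ln x)" "epsilon y x = y * (ln (x + y) - ln y)"
        using pos by (auto simp: epsilon_def ln_div)
    qed
    have mu: "mu_J \<beta> \<tau>1 \<tau>2 (fst p) = q * ln N + q * ln \<tau> - x * (ln (x + y) - ln x) - y * (ln (x + y) - ln y)"
    proof -
      have "n_floor \<tau>1 (fst p) = n1 p" "n_floor \<tau>2 (fst p) = n2 p" by (simp_all add: n1_def n2_def)
      thus ?thesis
        unfolding mu_J_def x_def[symmetric] y_def[symmetric] N_def[symmetric] \<tau>_def[symmetric] q_def[symmetric]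
        by (simp only: x_def[symmetric] y_def[symmetric] eps)
    qed
    have main: "main_term \<beta> k Z = Z * of_real (q * ln K - K + K * (ln (\<beta> / 2) + ln K)) + Z\<^sup>2 / of_real \<beta> * of_real (ln K)"
      if "real k = K" "0 < K" for k K
      using that \<beta> ln_mult_pos[of "\<beta> / 2" K] by (simp add: main_term_def q_def)
    have "log_mellin \<beta> (jacobi_ensemble \<beta> (n_floor \<tau>1 (fst p)) (n_floor \<tau>2 (fst p)))
                (jacobi_det (n_floor \<tau>1 (fst p)) (n_floor \<tau>2 (fst p))) Z
        = ln_Gamma_sum (\<beta> / 2) (n1 p) Z + ln_Gamma_sum (\<beta> / 2) (n2 p) Z - ln_Gamma_sum (\<beta> / 2) (n1 p + n2 p) Z"
      unfolding n1_def n2_def Z_def by (rule log_mellin_jacobi[OF \<beta> conjunct2[OF elim(1)]])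
    moreover have "main_term \<beta> (n1 p) Z + main_term \<beta> (n2 p) Z - main_term \<beta> (n1 p + n2 p) Z
        = Z * of_real (mu_J \<beta> \<tau>1 \<tau>2 (fst p)) + Z\<^sup>2 / of_real \<beta> * of_real (ln N) + Z\<^sup>2 / of_real \<beta> * of_real (ln \<tau>)
          + (Z * of_real q + Z\<^sup>2 / of_real \<beta>) * of_real (\<Delta> p)"
    proof -
      have xy: "real (n1 p + n2 p) = x + y" by (simp add: x_def y_def)
      show ?thesis
        unfolding main[OF x_def[symmetric] pos(1)] main[OF y_def[symmetric] pos(2)] main[OF xy pos(4)] mu \<Delta>_eq
        by (simp add: algebra_simps add_divide_distrib)
    qed
    ultimately show ?case
      unfolding D_def Z_def[symmetric] N_def[symmetric] \<tau>_def[symmetric] q_def[symmetric]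
      by (simp add: algebra_simps)
  qed
qed

theorem lemma4p2:
  fixes \<beta> \<tau>1 \<tau>2 :: real
  assumes "\<beta> > 0" and "\<tau>1 > 0" and "\<tau>2 > 0"
  shows
    "locally_uniform_limit_on (half_plane (\<beta> / 2))
       (\<lambda>n z. log_mellin \<beta> (laguerre_ensemble \<beta> n) (laguerre_det n) z
         - (z * of_real (mu_L \<beta> n) + z\<^sup>2 / of_real \<beta> * of_real (ln (real n))
            + Upsilon \<beta> z))
       (\<lambda>_. 0) sequentially \<and>
     locally_uniform_limit_on (half_plane (\<beta> / 2))
       (\<lambda>n z. log_mellin \<beta> (gram_ensemble \<beta> n) (gram_det n) z
         - (z * of_real (mu_G \<beta> n) + z\<^sup>2 / of_real \<beta> * of_real (ln (real n))
            - z\<^sup>2 / of_real \<beta> + Upsilon \<beta> z))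
       (\<lambda>_. 0) sequentially \<and>
     locally_uniform_limit_on (half_plane (\<beta> / 2))
       (\<lambda>n z. log_mellin \<beta> (jacobi_ensemble \<beta> (n_floor \<tau>1 n) (n_floor \<tau>2 n))
                (jacobi_det (n_floor \<tau>1 n) (n_floor \<tau>2 n)) z
         - (z * of_real (mu_J \<beta> \<tau>1 \<tau>2 n) + z\<^sup>2 / of_real \<beta> * of_real (ln (real n))
            + z\<^sup>2 / of_real \<beta> * of_real (ln (\<tau>1 * \<tau>2 / (\<tau>1 + \<tau>2)))
            + Upsilon \<beta> z))
       (\<lambda>_. 0) sequentially"
  using log_mellin_laguerre_tendsto[OF assms(1)] log_mellin_gram_tendsto[OF assms(1)]
    log_mellin_jacobi_tendsto[OF assms]
  by (intro conjI locally_uniform_limit_0I open_half_plane)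

end
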